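(* (1) Let $x_0\ge0$ and let $W$ be a Brownian motion. There is a process $BES^1(x_0)$ solving the strong martingale problem with respect to $\mathcal D_{L^1}$ and $W$. (2) The martingale problem related to $L^1$ with respect to $\mathcal D_{L^1}$ admits (in general) no uniqueness; that is, it is not true that for every initial condition $x_0\in\mathbb R$ any two solutions have the same law.
   Context: Processes are indexed by $t\in[0,T]$, $T>0$ fixed. $\mathcal D_{L^1}=\{f\in C^2(\mathbb R): f'(0)=0\}$ and $L^1f=\frac{f''}2$. $BESQ^1(s_0)$, $s_0\ge0$, is the pathwise unique (non-negative) solution of $dS_t=2\sqrt{|S_t|}\,dW_t+dt$, $S_0=s_0$, with $W$ a Brownian motion; a non-negative process $X$ is a $BES^1(x_0)$ if $X^2$ is a $BESQ^1(x_0^2)$. Martingale problem: a continuous real process $X$ with $X_0=x_0\in\mathbb R$, on a probability space with probability $\mathbb P$, solves the martingale problem with respect to $\mathcal D_{L^1}$ if for all $f\in\mathcal D_{L^1}$ the process $f(X_t)-f(x_0)-\int_0^tL^1f(X_s)ds$ is a $\mathbb P$-local martingale (with respect to the canonical filtration of $X$). Uniqueness means that any two solutions $(X^i,\mathbb P^i)$, $i=1,2$, with the same initial condition have the same law. Strong martingale problem: a continuous process $X$ with $X_0=x_0$, adapted to the canonical filtration of $W$ (satisfying the usual conditions), solves the strong martingale problem with respect to $\mathcal D_{L^1}$ and $W$ if $f(X_t)-f(x_0)-\int_0^tL^1f(X_s)ds=\int_0^tf'(X_s)dW_s$ for all $f\in\mathcal D_{L^1}$ and all $t\in[0,T]$.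 *)

theory Defs
  imports "HOL-Probability.Probability"
begin

text \<open>
  A process on \<open>[0, T]\<close> is a function \<open>X :: real \<Rightarrow> 'a \<Rightarrow> real\<close>; its values \<open>X t \<omega>\<close> with
  \<open>t \<notin> {0..T}\<close> or \<open>\<omega> \<notin> space M\<close> are never used. Filtrations are families \<open>F :: real \<Rightarrow> 'a measure\<close>
  of which only the \<open>\<sigma>\<close>-algebras matter.
\<close>

definition continuous_paths :: "'a measure \<Rightarrow> real \<Rightarrow> (real \<Rightarrow> 'a \<Rightarrow> real) \<Rightarrow> bool" where
  "continuous_paths M T X \<longleftrightarrow> (\<forall>\<omega>\<in>space M. continuous_on {0..T} (\<lambda>t. X t \<omega>))"

definition adapted_process :: "(real \<Rightarrow> 'a measure) \<Rightarrow> real \<Rightarrow> (real \<Rightarrow> 'a \<Rightarrow> real) \<Rightarrow> bool" where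
  "adapted_process F T X \<longleftrightarrow> (\<forall>t\<in>{0..T}. X t \<in> borel_measurable (F t))"

text \<open>
  Since stopping times in the library are tested at all real times, the canonical filtration is
  extended to all real times: it is trivial for \<open>t < 0\<close> and constant for \<open>t \<ge> T\<close>.
\<close>

definition natural_filtration ::
    "'a measure \<Rightarrow> real \<Rightarrow> (real \<Rightarrow> 'a \<Rightarrow> real) \<Rightarrow> real \<Rightarrow> 'a measure" where
  "natural_filtration M T X t =
     sigma (space M) (\<Union>s\<in>{0..min t T}. {X s -` A \<inter> space M | A. A \<in> sets borel})"

text \<open>
  The right-continuous filtration obtained after adding all subsets of null sets. It lives on the
  completion of \<open>M\<close>, as \<open>M\<close> itself is not assumed to be complete.
\<close>

definition usual_filtration ::
    "'a measure \<Rightarrow> real \<Rightarrow> (real \<Rightarrow> 'a \<Rightarrow> real) \<Rightarrow> real \<Rightarrow> 'a measure" where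
  "usual_filtration M T X t =
     sigma (space M)
       (\<Inter>u\<in>{t<..}. sigma_sets (space M)
          (sets (natural_filtration M T X u) \<union> null_sets (completion M)))"

definition brownian_motion :: "'a measure \<Rightarrow> real \<Rightarrow> (real \<Rightarrow> 'a \<Rightarrow> real) \<Rightarrow> bool" where
  "brownian_motion M T W \<longleftrightarrow>
     prob_space M \<and>
     (\<forall>t\<in>{0..T}. W t \<in> borel_measurable M) \<and>
     continuous_paths M T W \<and>
     (AE \<omega> in M. W 0 \<omega> = 0) \<and>
     (\<forall>s t. 0 \<le> s \<longrightarrow> s < t \<longrightarrow> t \<le> T \<longrightarrow>
        distributed M lborel (\<lambda>\<omega>. W t \<omega> - W s \<omega>) (normal_density 0 (sqrt (t - s))) \<and>
        prob_space.indep_set M (sets (natural_filtration M T W s))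
          (sets (vimage_algebra (space M) (\<lambda>\<omega>. W t \<omega> - W s \<omega>) borel)))"

definition tendsto_in_probability :: "'a measure \<Rightarrow> (nat \<Rightarrow> 'a \<Rightarrow> real) \<Rightarrow> ('a \<Rightarrow> real) \<Rightarrow> bool" where
  "tendsto_in_probability M Y Z \<longleftrightarrow>
     (\<forall>n. Y n \<in> borel_measurable M) \<and> Z \<in> borel_measurable M \<and>
     (\<forall>\<epsilon>>0. (\<lambda>n. measure M {\<omega>\<in>space M. \<epsilon> < \<bar>Y n \<omega> - Z \<omega>\<bar>}) \<longlonglongrightarrow> 0)"

text \<open>
  The triple \<open>(m, \<tau>, \<xi>)\<close> stands for the simple process equal to \<open>\<xi> i\<close> on \<open>(\<tau> i, \<tau> (i + 1)]\<close>, \<open>i < m\<close>.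
\<close>

definition simple_process ::
    "'a measure \<Rightarrow> (real \<Rightarrow> 'a measure) \<Rightarrow> real \<Rightarrow> nat \<Rightarrow> (nat \<Rightarrow> real) \<Rightarrow> (nat \<Rightarrow> 'a \<Rightarrow> real) \<Rightarrow> bool" where
  "simple_process M F T m \<tau> \<xi> \<longleftrightarrow>
     0 \<le> \<tau> 0 \<and> (\<forall>i<m. \<tau> i \<le> \<tau> (Suc i)) \<and> \<tau> m \<le> T \<and>
     (\<forall>i<m. \<xi> i \<in> borel_measurable (F (\<tau> i)) \<and> (\<exists>C. \<forall>\<omega>\<in>space M. \<bar>\<xi> i \<omega>\<bar> \<le> C))"

definition simple_value ::
    "nat \<Rightarrow> (nat \<Rightarrow> real) \<Rightarrow> (nat \<Rightarrow> 'a \<Rightarrow> real) \<Rightarrow> real \<Rightarrow> 'a \<Rightarrow> real" where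
  "simple_value m \<tau> \<xi> t \<omega> = (\<Sum>i<m. \<xi> i \<omega> * indicator {\<tau> i<..\<tau> (Suc i)} t)"

definition simple_integral ::
    "(real \<Rightarrow> 'a \<Rightarrow> real) \<Rightarrow> nat \<Rightarrow> (nat \<Rightarrow> real) \<Rightarrow> (nat \<Rightarrow> 'a \<Rightarrow> real) \<Rightarrow> real \<Rightarrow> 'a \<Rightarrow> real" where
  "simple_integral W m \<tau> \<xi> t \<omega> =
     (\<Sum>i<m. \<xi> i \<omega> * (W (min t (\<tau> (Suc i))) \<omega> - W (min t (\<tau> i)) \<omega>))"

text \<open>
  \<open>has_ito_integral M F T W H I\<close>: the continuous process \<open>I\<close> is the Ito integral of the continuous
  adapted process \<open>H\<close> with respect to \<open>W\<close>, that is, almost surely, \<open>I\<^sub>t\<close> is the integral of \<open>H\<close>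
  against \<open>W\<close> over \<open>[0, t]\<close> for all \<open>t \<in> [0, T]\<close>. This is the usual extension of the elementary
  integral: if simple processes converge to \<open>H\<close> in \<open>L\<^sup>2([0, T])\<close> in probability, then their integrals
  converge uniformly on \<open>[0, T]\<close> in probability. The limit does not depend on the approximating
  sequence and is determined up to indistinguishability.
\<close>

definition has_ito_integral ::
    "'a measure \<Rightarrow> (real \<Rightarrow> 'a measure) \<Rightarrow> real \<Rightarrow> (real \<Rightarrow> 'a \<Rightarrow> real) \<Rightarrow>
     (real \<Rightarrow> 'a \<Rightarrow> real) \<Rightarrow> (real \<Rightarrow> 'a \<Rightarrow> real) \<Rightarrow> bool" where
  "has_ito_integral M F T W H I \<longleftrightarrow>
     adapted_process F T H \<and> continuous_paths M T H \<and>
     adapted_process F T I \<and> continuous_paths M T I \<and>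
     (\<exists>m \<tau> \<xi>.
        (\<forall>n. simple_process M F T (m n) (\<tau> n) (\<xi> n)) \<and>
        tendsto_in_probability M
          (\<lambda>n \<omega>. LINT t:{0..T}|lborel. (simple_value (m n) (\<tau> n) (\<xi> n) t \<omega> - H t \<omega>)\<^sup>2) (\<lambda>\<omega>. 0) \<and>
        tendsto_in_probability M
          (\<lambda>n \<omega>. SUP t\<in>{0..T}. \<bar>simple_integral W (m n) (\<tau> n) (\<xi> n) t \<omega> - I t \<omega>\<bar>) (\<lambda>\<omega>. 0))"

text \<open>
  \<open>besq1 M T W s\<^sub>0 S\<close>: \<open>S\<close> is the non-negative (strong) solution of
  \<open>dS\<^sub>t = 2 sqrt \<bar>S\<^sub>t\<bar> dW\<^sub>t + dt\<close>, \<open>S\<^sub>0 = s\<^sub>0\<close>, driven by the Brownian motion \<open>W\<close>.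
\<close>

definition besq1 ::
    "'a measure \<Rightarrow> real \<Rightarrow> (real \<Rightarrow> 'a \<Rightarrow> real) \<Rightarrow> real \<Rightarrow> (real \<Rightarrow> 'a \<Rightarrow> real) \<Rightarrow> bool" where
  "besq1 M T W s\<^sub>0 S \<longleftrightarrow>
     brownian_motion M T W \<and>
     adapted_process (usual_filtration M T W) T S \<and> continuous_paths M T S \<and>
     (\<forall>\<omega>\<in>space M. S 0 \<omega> = s\<^sub>0) \<and>
     (\<forall>t\<in>{0..T}. \<forall>\<omega>\<in>space M. 0 \<le> S t \<omega>) \<and>
     has_ito_integral (completion M) (usual_filtration M T W) T W
       (\<lambda>t \<omega>. 2 * sqrt \<bar>S t \<omega>\<bar>) (\<lambda>t \<omega>. S t \<omega> - s\<^sub>0 - t)"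

definition bes1 ::
    "'a measure \<Rightarrow> real \<Rightarrow> (real \<Rightarrow> 'a \<Rightarrow> real) \<Rightarrow> real \<Rightarrow> (real \<Rightarrow> 'a \<Rightarrow> real) \<Rightarrow> bool" where
  "bes1 M T W x\<^sub>0 X \<longleftrightarrow>
     (\<forall>t\<in>{0..T}. \<forall>\<omega>\<in>space M. 0 \<le> X t \<omega>) \<and>
     besq1 M T W (x\<^sub>0\<^sup>2) (\<lambda>t \<omega>. (X t \<omega>)\<^sup>2)"

definition martingale ::
    "'a measure \<Rightarrow> (real \<Rightarrow> 'a measure) \<Rightarrow> real \<Rightarrow> (real \<Rightarrow> 'a \<Rightarrow> real) \<Rightarrow> bool" where
  "martingale M F T Z \<longleftrightarrow>
     adapted_process F T Z \<and>
     (\<forall>t\<in>{0..T}. integrable M (Z t)) \<and>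
     (\<forall>s t. 0 \<le> s \<longrightarrow> s \<le> t \<longrightarrow> t \<le> T \<longrightarrow> (AE \<omega> in M. real_cond_exp M (F s) (Z t) \<omega> = Z s \<omega>))"

text \<open>
  On the closed interval \<open>[0, T]\<close> a localizing sequence has to reach \<open>T\<close> after finitely many steps,
  almost surely; merely converging to \<open>T\<close> would give local martingales on \<open>[0, T)\<close>.
\<close>

definition local_martingale ::
    "'a measure \<Rightarrow> (real \<Rightarrow> 'a measure) \<Rightarrow> real \<Rightarrow> (real \<Rightarrow> 'a \<Rightarrow> real) \<Rightarrow> bool" where
  "local_martingale M F T Z \<longleftrightarrow>
     adapted_process F T Z \<and>
     (\<exists>\<sigma> :: nat \<Rightarrow> 'a \<Rightarrow> real.
        (\<forall>n. stopping_time F (\<sigma> n) \<and> (\<forall>\<omega>\<in>space M. 0 \<le> \<sigma> n \<omega> \<and> \<sigma> n \<omega> \<le> T)) \<and>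
        (AE \<omega> in M. incseq (\<lambda>n. \<sigma> n \<omega>) \<and> (\<forall>\<^sub>F n in sequentially. \<sigma> n \<omega> = T)) \<and>
        (\<forall>n. martingale M F T (\<lambda>t \<omega>. Z (min t (\<sigma> n \<omega>)) \<omega>)))"

definition C2 :: "(real \<Rightarrow> real) set" where
  "C2 = {f. (\<forall>x. f field_differentiable at x) \<and> (\<forall>x. deriv f field_differentiable at x) \<and>
            continuous_on UNIV (deriv (deriv f))}"

definition L1 :: "(real \<Rightarrow> real) \<Rightarrow> real \<Rightarrow> real" where
  "L1 f x = deriv (deriv f) x / 2"

definition D_L1 :: "(real \<Rightarrow> real) set" where
  "D_L1 = {f \<in> C2. deriv f 0 = 0}"

definition mp_process ::
    "((real \<Rightarrow> real) \<Rightarrow> real \<Rightarrow> real) \<Rightarrow> real \<Rightarrow> (real \<Rightarrow> 'a \<Rightarrow> real) \<Rightarrow> (real \<Rightarrow> real) \<Rightarrow>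
     real \<Rightarrow> 'a \<Rightarrow> real" where
  "mp_process L x\<^sub>0 X f t \<omega> = f (X t \<omega>) - f x\<^sub>0 - integral {0..t} (\<lambda>s. L f (X s \<omega>))"

definition solves_martingale_problem ::
    "'a measure \<Rightarrow> real \<Rightarrow> (real \<Rightarrow> real) set \<Rightarrow> ((real \<Rightarrow> real) \<Rightarrow> real \<Rightarrow> real) \<Rightarrow>
     real \<Rightarrow> (real \<Rightarrow> 'a \<Rightarrow> real) \<Rightarrow> bool" where
  "solves_martingale_problem M T D L x\<^sub>0 X \<longleftrightarrow>
     prob_space M \<and>
     (\<forall>t\<in>{0..T}. X t \<in> borel_measurable M) \<and>
     continuous_paths M T X \<and>
     (\<forall>\<omega>\<in>space M. X 0 \<omega> = x\<^sub>0) \<and>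
     (\<forall>f\<in>D. local_martingale M (natural_filtration M T X) T (mp_process L x\<^sub>0 X f))"

definition solves_strong_martingale_problem ::
    "'a measure \<Rightarrow> real \<Rightarrow> (real \<Rightarrow> real) set \<Rightarrow> ((real \<Rightarrow> real) \<Rightarrow> real \<Rightarrow> real) \<Rightarrow>
     (real \<Rightarrow> 'a \<Rightarrow> real) \<Rightarrow> real \<Rightarrow> (real \<Rightarrow> 'a \<Rightarrow> real) \<Rightarrow> bool" where
  "solves_strong_martingale_problem M T D L W x\<^sub>0 X \<longleftrightarrow>
     brownian_motion M T W \<and>
     adapted_process (usual_filtration M T W) T X \<and> continuous_paths M T X \<and>
     (\<forall>\<omega>\<in>space M. X 0 \<omega> = x\<^sub>0) \<and>
     (\<forall>f\<in>D. has_ito_integral (completion M) (usual_filtration M T W) T W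
               (\<lambda>t \<omega>. deriv f (X t \<omega>)) (mp_process L x\<^sub>0 X f))"

text \<open>
  The law of a continuous process on \<open>[0, T]\<close>: the \<open>\<sigma>\<close>-algebra generated by the evaluation maps is,
  on continuous paths, the Borel \<open>\<sigma>\<close>-algebra of uniform convergence.
\<close>

definition law :: "'a measure \<Rightarrow> real \<Rightarrow> (real \<Rightarrow> 'a \<Rightarrow> real) \<Rightarrow> (real \<Rightarrow> real) measure" where
  "law M T X = distr M (PiM {0..T} (\<lambda>_. borel)) (\<lambda>\<omega>. \<lambda>t\<in>{0..T}. X t \<omega>)"

text \<open>
  A definition cannot quantify over the types of the sample spaces, so they are taken to be sets of
  paths. Nothing is lost: a solution on any probability space has a copy with the same law on
  path space, consisting of the coordinate process and the law of the solution, carried by the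
  continuous paths starting at \<open>x\<^sub>0\<close>.
\<close>

definition martingale_problem_unique ::
    "real \<Rightarrow> (real \<Rightarrow> real) set \<Rightarrow> ((real \<Rightarrow> real) \<Rightarrow> real \<Rightarrow> real) \<Rightarrow> bool" where
  "martingale_problem_unique T D L \<longleftrightarrow>
     (\<forall>x\<^sub>0. \<forall>(P\<^sub>1 :: (real \<Rightarrow> real) measure) X\<^sub>1 (P\<^sub>2 :: (real \<Rightarrow> real) measure) X\<^sub>2.
        solves_martingale_problem P\<^sub>1 T D L x\<^sub>0 X\<^sub>1 \<longrightarrow>
        solves_martingale_problem P\<^sub>2 T D L x\<^sub>0 X\<^sub>2 \<longrightarrow>
        law P\<^sub>1 T X\<^sub>1 = law P\<^sub>2 T X\<^sub>2)"

end

theory Submission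
  imports Defs
begin

text \<open>
  For the first part, \<open>X\<close> is Brownian motion from \<open>x\<^sub>0\<close> reflected at \<open>0\<close>, \<open>X = x\<^sub>0 + W + L\<close> with the
  Skorokhod term \<open>L\<^sub>t = sup {(x\<^sub>0 + W\<^sub>s)\<^sup>- | s \<le> t}\<close>, which grows only when \<open>X = 0\<close>. Ito's formula for \<open>f(X)\<close>
  is proved path by path (Foellmer): along the dyadic partitions the quadratic variation of almost
  every path of \<open>W\<close> converges to \<open>t\<close>, the rest is Taylor's formula, and \<open>f' (0) = 0\<close> kills the integral
  of \<open>f' (X)\<close> against \<open>L\<close>. The Bessel property is the case \<open>f x = x\<^sup>2\<close>.

  For the second part take \<open>x\<^sub>0 = 0\<close>. If \<open>f\<close> is in the domain then so is \<open>f (- x)\<close>, so both \<open>X\<close> and \<open>- X\<close>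
  solve the martingale problem; their laws differ, since \<open>X \<ge> 0\<close> does not vanish. The Brownian motion
  needed here comes from Levy's construction: dyadic increments are split into halves by independent
  normal variables, and independence of the halves is the rotation invariance of the Gaussian law.
\<close>

section \<open>Dyadic grids\<close>

text \<open>\<open>has_ito_integral\<close> asks for convergence of simple integrals uniformly in
  time, so the pathwise estimates must hold at all times at once, along one sequence of partitions
  that does not depend on the path. Dyadic meshes serve both needs: they shrink geometrically, so
  the second moments of the quadratic variation errors are summable, and convergence at the
  countably many dyadic times becomes uniform by monotonicity. No general stochastic integral is
  constructed. The same discrete sums, with coefficients switched off after a hitting time, are
  bounded in mean square and have centred increments; both facts survive the limit and give the
  martingale property for the filtration of \<open>X\<close>, which is contained in that of
  \<open>W\<close>. Uniqueness would hold vacuously if there were no solution, so a Brownian motion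
  must exist on the sample type fixed by \<open>martingale_problem_unique\<close>. The halving
  scheme controls it at dyadic times only. Characteristic functions tested on events of the past
  carry normality and independence to all times, because they pass to limits along continuous
  paths.\<close>

definition grid :: "real \<Rightarrow> nat \<Rightarrow> nat \<Rightarrow> real" where
  "grid T n i = T * real i / 2 ^ n"

lemma grid_0 [simp]: "grid T n 0 = 0"
  by (simp add: grid_def)

lemma grid_end [simp]: "grid T n (2 ^ n) = T"
  by (simp add: grid_def)

lemma grid_Suc: "grid T n (Suc i) = grid T n i + T / 2 ^ n"
  by (simp add: grid_def field_simps)

lemma grid_refine: "m \<le> n \<Longrightarrow> grid T n (j * 2 ^ (n - m)) = grid T m j"
  by (simp add: grid_def field_simps flip: power_add)

lemma grid_mono: "0 \<le> T \<Longrightarrow> i \<le> j \<Longrightarrow> grid T n i \<le> grid T n j"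
  by (simp add: grid_def divide_right_mono mult_left_mono)

lemma grid_in: "0 \<le> T \<Longrightarrow> i \<le> 2 ^ n \<Longrightarrow> grid T n i \<in> {0..T}"
  using grid_mono[of T 0 i n] grid_mono[of T i "2 ^ n" n] by simp

lemma eventually_grid_mesh:
  fixes T :: real
  assumes "0 < T" "0 < \<epsilon>"
  shows "\<forall>\<^sub>F n in sequentially. T / 2 ^ n < \<epsilon>"
proof -
  have "(\<lambda>n. T * (1 / 2) ^ n) \<longlonglongrightarrow> T * 0"
    by (intro tendsto_intros) auto
  then have "\<forall>\<^sub>F n in sequentially. T * (1 / 2) ^ n < \<epsilon>"
    by (rule order_tendstoD(2)) (use assms in simp)
  then show ?thesis by (simp add: power_divide)
qed

text \<open>Sums along a partition are estimated at partition points, and at level \<open>n\<close>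
  only the indices up to \<open>2 ^ n\<close> count. The passage to all times is made once, in
  \<open>ito_uniform\<close>.\<close>

definition grid_null :: "(nat \<Rightarrow> nat \<Rightarrow> real) \<Rightarrow> bool" where
  "grid_null E \<longleftrightarrow> (\<forall>\<epsilon>>0. \<forall>\<^sub>F n in sequentially. \<forall>k\<le>2 ^ n. \<bar>E n k\<bar> < \<epsilon>)"

lemma grid_null_add:
  assumes "grid_null E" "grid_null F"
  shows "grid_null (\<lambda>n k. E n k + F n k)"
  unfolding grid_null_def
proof (intro allI impI)
  fix \<epsilon> :: real assume "\<epsilon> > 0"
  then have "\<epsilon> / 2 > 0" by simp
  then have "\<forall>\<^sub>F n in sequentially. \<forall>k\<le>2 ^ n. \<bar>E n k\<bar> < \<epsilon> / 2"
    "\<forall>\<^sub>F n in sequentially. \<forall>k\<le>2 ^ n. \<bar>F n k\<bar> < \<epsilon> / 2"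
    using assms unfolding grid_null_def by blast+
  then show "\<forall>\<^sub>F n in sequentially. \<forall>k\<le>2 ^ n. \<bar>E n k + F n k\<bar> < \<epsilon>"
  proof eventually_elim
    case (elim n)
    show ?case
    proof (intro allI impI)
      fix k :: nat assume "k \<le> 2 ^ n"
      then show "\<bar>E n k + F n k\<bar> < \<epsilon>"
        using elim(1)[rule_format, of k] elim(2)[rule_format, of k] by linarith
    qed
  qed
qed

text \<open>Every partial sum is at most \<epsilon> times the total weight, whatever its length. The
  weights used below are squared increments of the path, increments of the pushing term, and cell
  lengths.\<close>

lemma grid_null_sumI:
  assumes b: "\<And>n i. i < 2 ^ n \<Longrightarrow> 0 \<le> b n i"
    and K: "\<forall>\<^sub>F n in sequentially. (\<Sum>i<2 ^ n. b n i) \<le> K"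
    and E: "\<And>\<epsilon>. 0 < \<epsilon> \<Longrightarrow> \<forall>\<^sub>F n in sequentially. \<forall>i<2 ^ n. \<bar>E n i\<bar> \<le> \<epsilon> * b n i"
  shows "grid_null (\<lambda>n k. \<Sum>i<k. E n i)"
  unfolding grid_null_def
proof (intro allI impI)
  fix \<epsilon> :: real assume "\<epsilon> > 0"
  \<comment> \<open>The absolute value and the \<open>+ 1\<close> keep the denominator positive for
    every \<open>K\<close> and make the final estimate strict.\<close>
  define \<delta> where "\<delta> = \<epsilon> / (2 * (\<bar>K\<bar> + 1))"
  have \<delta>: "\<delta> > 0" "\<delta> * \<bar>K\<bar> < \<epsilon>"
    using \<open>\<epsilon> > 0\<close> by (auto simp: \<delta>_def field_simps add_nonneg_pos)
  from E[OF \<delta>(1)] K show "\<forall>\<^sub>F n in sequentially. \<forall>k\<le>2 ^ n. \<bar>\<Sum>i<k. E n i\<bar> < \<epsilon>"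
  proof eventually_elim
    case (elim n)
    show ?case
    proof (intro allI impI)
      fix k :: nat assume k: "k \<le> 2 ^ n"
      have "\<bar>\<Sum>i<k. E n i\<bar> \<le> (\<Sum>i<k. \<bar>E n i\<bar>)" by (rule sum_abs)
      also have "\<dots> \<le> (\<Sum>i<k. \<delta> * b n i)"
        using elim k by (intro sum_mono) auto
      also have "\<dots> = \<delta> * (\<Sum>i<k. b n i)" by (simp add: sum_distrib_left)
      also have "\<dots> \<le> \<delta> * (\<Sum>i<2 ^ n. b n i)"
        using b k \<delta> by (intro mult_left_mono sum_mono2) auto
      also have "\<dots> \<le> \<delta> * \<bar>K\<bar>"
        using elim \<delta> by (intro mult_left_mono) auto
      finally show "\<bar>\<Sum>i<k. E n i\<bar> < \<epsilon>" using \<delta> by simp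
    qed
  qed
qed

lemma eventually_grid_osc:
  fixes h :: "real \<Rightarrow> real"
  assumes "0 < T" "continuous_on {0..T} h" "0 < \<epsilon>"
  shows "\<forall>\<^sub>F n in sequentially. \<forall>s\<in>{0..T}. \<forall>t\<in>{0..T}. \<bar>s - t\<bar> \<le> T / 2 ^ n \<longrightarrow> \<bar>h s - h t\<bar> < \<epsilon>"
proof -
  have "uniformly_continuous_on {0..T} h"
    using assms by (intro compact_uniformly_continuous) auto
  then obtain d where d: "d > 0" "\<And>s t. s \<in> {0..T} \<Longrightarrow> t \<in> {0..T} \<Longrightarrow> dist t s < d \<Longrightarrow> dist (h t) (h s) < \<epsilon>"
    using assms(3) unfolding uniformly_continuous_on_def by metis
  show ?thesis
    using eventually_grid_mesh[OF assms(1) d(1)]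
    by eventually_elim (use d(2) in \<open>auto simp: dist_real_def\<close>)
qed

section \<open>Taylor expansion and polynomial approximation\<close>

lemma C2_derivs:
  assumes "f \<in> C2"
  shows "(f has_real_derivative deriv f x) (at x)"
    and "(deriv f has_real_derivative deriv (deriv f) x) (at x)"
    and "continuous_on S f" "continuous_on S (deriv f)" "continuous_on S (deriv (deriv f))"
proof -
  have f: "\<And>x. f field_differentiable at x" "\<And>x. deriv f field_differentiable at x"
    "continuous_on UNIV (deriv (deriv f))"
    using assms by (auto simp: C2_def)
  show "(f has_real_derivative deriv f x) (at x)"
    "(deriv f has_real_derivative deriv (deriv f) x) (at x)"
    using f by (auto simp: DERIV_deriv_iff_field_differentiable)
  show "continuous_on S f" "continuous_on S (deriv f)"
    using f(1,2) by (auto intro!: continuous_at_imp_continuous_on field_differentiable_imp_continuous_at)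
  show "continuous_on S (deriv (deriv f))"
    using f(3) by (rule continuous_on_subset) simp
qed

text \<open>The Lagrange remainder has the second derivative at an intermediate point; replacing it
  by the value at \<open>a\<close> costs at most its oscillation. Uniform continuity on
  \<open>{-R..R}\<close> makes one \<open>d\<close> serve all base points, as needed along a whole
  path.\<close>

lemma C2_taylor:
  assumes f: "f \<in> C2" and "\<epsilon> > 0"
  obtains d where "d > 0" "\<And>a b. \<bar>a\<bar> \<le> R \<Longrightarrow> \<bar>b\<bar> \<le> R \<Longrightarrow> \<bar>b - a\<bar> < d \<Longrightarrow>
     \<bar>f b - f a - deriv f a * (b - a) - deriv (deriv f) a / 2 * (b - a)\<^sup>2\<bar> \<le> \<epsilon> * (b - a)\<^sup>2"
proof -
  have "uniformly_continuous_on {-R..R} (deriv (deriv f))"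
    using C2_derivs(5)[OF f] by (intro compact_uniformly_continuous) auto
  then obtain d where d: "d > 0" "\<And>a b. a \<in> {-R..R} \<Longrightarrow> b \<in> {-R..R} \<Longrightarrow> dist b a < d \<Longrightarrow>
      dist (deriv (deriv f) b) (deriv (deriv f) a) < \<epsilon>"
    using assms(2) unfolding uniformly_continuous_on_def by metis
  show ?thesis
  proof (rule that[OF d(1)])
    fix a b assume ab: "\<bar>a\<bar> \<le> R" "\<bar>b\<bar> \<le> R" "\<bar>b - a\<bar> < d"
    show "\<bar>f b - f a - deriv f a * (b - a) - deriv (deriv f) a / 2 * (b - a)\<^sup>2\<bar> \<le> \<epsilon> * (b - a)\<^sup>2"
    proof (cases "a = b")
      case False
      define df where "df = (\<lambda>m::nat. if m = 0 then f else if m = 1 then deriv f else deriv (deriv f))"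
      have "\<forall>m t. m < 2 \<and> -R \<le> t \<and> t \<le> R \<longrightarrow> (df m has_real_derivative df (Suc m) t) (at t)"
        using C2_derivs[OF f] by (auto simp: df_def less_Suc_eq numeral_2_eq_2)
      then have "\<exists>t. (if b < a then b < t \<and> t < a else a < t \<and> t < b) \<and>
        f b = (\<Sum>m<2. (df m a / fact m) * (b - a)^m) + (df 2 t / fact 2) * (b - a)^2"
        using ab False by (intro Taylor[where a = "-R" and b = R]) (auto simp: df_def)
      then obtain t where t: "if b < a then b < t \<and> t < a else a < t \<and> t < b"
        "f b = f a + deriv f a * (b - a) + deriv (deriv f) t / 2 * (b - a)^2"
        by (auto simp: df_def numeral_2_eq_2)
      have "dist (deriv (deriv f) t) (deriv (deriv f) a) < \<epsilon>"
        using t(1) ab by (intro d(2)) (auto simp: dist_real_def split: if_splits)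
      then have "\<bar>deriv (deriv f) t - deriv (deriv f) a\<bar> / 2 \<le> \<epsilon>"
        using assms by (auto simp: dist_real_def)
      moreover have "f b - f a - deriv f a * (b - a) - deriv (deriv f) a / 2 * (b - a)\<^sup>2 =
          (deriv (deriv f) t - deriv (deriv f) a) / 2 * (b - a)\<^sup>2"
        unfolding t(2) by (simp add: algebra_simps diff_divide_distrib)
      ultimately show ?thesis
        by (simp only: abs_mult abs_divide abs_power2 abs_numeral mult_right_mono zero_le_power2)
    qed (use assms in auto)
  qed
qed

text \<open>A continuous weight need not have bounded variation, which summation by parts requires.
  A uniformly close polynomial has it, since its derivative is bounded on the compact
  interval.\<close>

lemma continuous_polynomial_approx:
  fixes g :: "real \<Rightarrow> real"
  assumes "continuous_on {0..T} g" "\<eta> > 0"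
  obtains p B L where "\<And>t. t \<in> {0..T} \<Longrightarrow> \<bar>g t - p t\<bar> < \<eta>" "\<And>t. t \<in> {0..T} \<Longrightarrow> \<bar>p t\<bar> \<le> B"
    "0 \<le> B" "0 \<le> L" "\<And>s t. s \<in> {0..T} \<Longrightarrow> t \<in> {0..T} \<Longrightarrow> \<bar>p s - p t\<bar> \<le> L * \<bar>s - t\<bar>"
proof -
  obtain p where p: "real_polynomial_function p" "\<And>t. t \<in> {0..T} \<Longrightarrow> \<bar>g t - p t\<bar> < \<eta>"
    using Stone_Weierstrass_real_polynomial_function[OF _ assms] by auto
  obtain p' where p': "real_polynomial_function p'" "\<And>x. (p has_real_derivative p' x) (at x)"
    using has_real_derivative_polynomial_function[OF p(1)] by blast
  have cont: "continuous_on {0..T} p" "continuous_on {0..T} p'"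
    using p(1) p'(1) by (auto simp: real_polynomial_function_eq intro: continuous_on_polymonial_function)
  have bdd: "\<exists>C\<ge>0. \<forall>t\<in>{0..T}. \<bar>h t\<bar> \<le> C" if "continuous_on {0..T} h" for h :: "real \<Rightarrow> real"
  proof -
    have "bounded (h ` {0..T})"
      using that by (intro compact_imp_bounded compact_continuous_image) auto
    then obtain C where "\<forall>y\<in>h ` {0..T}. norm y \<le> C" by (auto simp: bounded_iff)
    then show ?thesis by (intro exI[of _ "\<bar>C\<bar>"]) force
  qed
  obtain B L where B: "B \<ge> 0" "\<forall>t\<in>{0..T}. \<bar>p t\<bar> \<le> B" and L: "L \<ge> 0" "\<forall>t\<in>{0..T}. \<bar>p' t\<bar> \<le> L"
    using bdd[OF cont(1)] bdd[OF cont(2)] by blast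
  have "\<bar>p s - p t\<bar> \<le> L * \<bar>s - t\<bar>" if "s \<in> {0..T}" "t \<in> {0..T}" for s t
    using field_differentiable_bound[of "{0..T}" p p' L s t] that L
      has_field_derivative_at_within[OF p'(2)] by auto
  then show ?thesis using that p(2) B L by metis
qed

section \<open>Pathwise Ito formula for reflected paths\<close>

text \<open>The deterministic facts about one path on which Ito's formula rests.
  \<open>l_growth\<close> says without a Stieltjes integral that \<open>l\<close> increases only
  where \<open>x\<close> vanishes. \<open>qv\<close> asks for convergence at each dyadic time
  separately, which is what countably many null sets can give.\<close>

locale reflected_path =
  fixes T :: real and w l x :: "real \<Rightarrow> real"
  assumes T_pos: "0 < T"
    and cont_w: "continuous_on {0..T} w"
    and cont_l: "continuous_on {0..T} l"
    and mono_l: "\<And>s t. 0 \<le> s \<Longrightarrow> s \<le> t \<Longrightarrow> t \<le> T \<Longrightarrow> l s \<le> l t"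
    and x_diff: "\<And>s t. s \<in> {0..T} \<Longrightarrow> t \<in> {0..T} \<Longrightarrow> x t - x s = (w t - w s) + (l t - l s)"
    and l_growth: "\<And>s t. 0 \<le> s \<Longrightarrow> s \<le> t \<Longrightarrow> t \<le> T \<Longrightarrow> l s < l t \<Longrightarrow> \<exists>r\<in>{s..t}. x r = 0"
    and qv: "\<And>m j. j \<le> 2 ^ m \<Longrightarrow>
      (\<lambda>n. \<Sum>i<j * 2 ^ (n - m). (w (grid T n (Suc i)) - w (grid T n i))\<^sup>2) \<longlonglongrightarrow> grid T m j"
begin

abbreviation G :: "nat \<Rightarrow> nat \<Rightarrow> real" where "G \<equiv> grid T"

definition dw where "dw n i = w (G n (Suc i)) - w (G n i)"
definition dl where "dl n i = l (G n (Suc i)) - l (G n i)"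
definition dx where "dx n i = x (G n (Suc i)) - x (G n i)"

lemma G_in: "i \<le> 2 ^ n \<Longrightarrow> G n i \<in> {0..T}"
  using grid_in[of T i n] T_pos by simp

lemma G_in': "i < 2 ^ n \<Longrightarrow> G n i \<in> {0..T}" "i < 2 ^ n \<Longrightarrow> G n (Suc i) \<in> {0..T}"
  using G_in[of i n] G_in[of "Suc i" n] by auto

lemma G_le_Suc: "G n i \<le> G n (Suc i)"
  using grid_mono[of T i "Suc i" n] T_pos by simp

lemma cont_x: "continuous_on {0..T} x"
proof -
  have "continuous_on {0..T} (\<lambda>t. x 0 + (w t - w 0) + (l t - l 0))"
    by (intro continuous_intros cont_w cont_l)
  moreover have "x 0 + (w t - w 0) + (l t - l 0) = x t" if "t \<in> {0..T}" for t
    using x_diff[of 0 t] that T_pos by auto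
  ultimately show ?thesis by (rule continuous_on_eq)
qed

lemma dx_eq: "i < 2 ^ n \<Longrightarrow> dx n i = dw n i + dl n i"
  using x_diff[of "G n i" "G n (Suc i)"] G_in'[of i n] by (simp add: dx_def dw_def dl_def)

lemma dl_nonneg: "i < 2 ^ n \<Longrightarrow> 0 \<le> dl n i"
  using mono_l[of "G n i" "G n (Suc i)"] G_in'[of i n] G_le_Suc[of n i] by (simp add: dl_def)

lemma sum_dl: "(\<Sum>i<2 ^ n. dl n i) = l T - l 0"
  using sum_lessThan_telescope[of "\<lambda>i. l (G n i)" "2 ^ n"] by (simp add: dl_def)

text \<open>Polya's argument: monotone functions with a continuous limit on a dense set converge uniformly.\<close>

lemma qv_uniform: "grid_null (\<lambda>n k. (\<Sum>i<k. (dw n i)\<^sup>2) - G n k)"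
  unfolding grid_null_def
proof (intro allI impI)
  fix \<epsilon> :: real assume "\<epsilon> > 0"
  \<comment> \<open>The coarse level \<open>m\<close> is fixed before \<open>n\<close>. Between
    neighbouring coarse points the sum and its limit are both monotone, so the error is at most one
    coarse mesh plus the error at one of these points.\<close>
  obtain m where m: "T / 2 ^ m < \<epsilon> / 2"
    using eventually_grid_mesh[OF T_pos, of "\<epsilon> / 2"] \<open>\<epsilon> > 0\<close> by (auto simp: eventually_sequentially)
  have "\<forall>\<^sub>F n in sequentially. \<bar>(\<Sum>i<j * 2 ^ (n - m). (dw n i)\<^sup>2) - G m j\<bar> < \<epsilon> / 2" if "j \<le> 2 ^ m" for j
    using tendstoD[OF qv[OF that], of "\<epsilon> / 2"] \<open>\<epsilon> > 0\<close> by (simp add: dw_def dist_real_def)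
  then have "\<forall>\<^sub>F n in sequentially. \<forall>j\<in>{..2 ^ m}. \<bar>(\<Sum>i<j * 2 ^ (n - m). (dw n i)\<^sup>2) - G m j\<bar> < \<epsilon> / 2"
    by (intro eventually_ball_finite) auto
  then show "\<forall>\<^sub>F n in sequentially. \<forall>k\<le>2 ^ n. \<bar>(\<Sum>i<k. (dw n i)\<^sup>2) - G n k\<bar> < \<epsilon>"
    using eventually_ge_at_top[of m]
  proof eventually_elim
    case (elim n)
    define q where "q k = (\<Sum>i<k. (dw n i)\<^sup>2)" for k
    have q_mono: "q i \<le> q j" if "i \<le> j" for i j
      unfolding q_def using that by (intro sum_mono2) auto
    have near: "\<bar>q (j * 2 ^ (n - m)) - G m j\<bar> < \<epsilon> / 2" if "j \<le> 2 ^ m" for j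
      using elim that by (auto simp: q_def)
    show ?case
    proof (intro allI impI)
      fix k :: nat assume k: "k \<le> 2 ^ n"
      have N: "(2::nat) ^ n = 2 ^ m * 2 ^ (n - m)"
        using elim(2) by (simp flip: power_add)
      have "\<bar>q k - G n k\<bar> < \<epsilon>"
      \<comment> \<open>The last index is itself a coarse point; its block number would be
        \<open>2 ^ m\<close>, which has no right neighbour in the grid.\<close>
      proof (cases "k = 2 ^ n")
        case True
        then show ?thesis using near[of "2 ^ m"] \<open>\<epsilon> > 0\<close> by (simp flip: N)
      next
        case False
        define j where "j = k div 2 ^ (n - m)"
        have j: "j < 2 ^ m"
          using False k N by (simp add: j_def less_mult_imp_div_less)
        have lo: "j * 2 ^ (n - m) \<le> k" and hi: "k \<le> Suc j * 2 ^ (n - m)"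
          using dividend_less_div_times[of "2 ^ (n - m)" k] by (auto simp: j_def)
        have "q (j * 2 ^ (n - m)) \<le> q k" "q k \<le> q (Suc j * 2 ^ (n - m))"
          using lo hi by (auto intro: q_mono)
        moreover have "G m j \<le> G n k" "G n k \<le> G m (Suc j)"
          using grid_mono[OF _ lo, of T n] grid_mono[OF _ hi, of T n] T_pos elim(2)
          by (simp_all add: grid_refine del: mult_Suc)
        ultimately show ?thesis
          using near[of j] near[of "Suc j"] j m grid_Suc[of T m j] by linarith
      qed
      then show "\<bar>(\<Sum>i<k. (dw n i)\<^sup>2) - G n k\<bar> < \<epsilon>" by (simp add: q_def)
    qed
  qed
qed

lemma eventually_sum_dw2: "\<forall>\<^sub>F n in sequentially. \<forall>k\<le>2 ^ n. (\<Sum>i<k. (dw n i)\<^sup>2) \<le> T + 1"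
  using qv_uniform[unfolded grid_null_def, rule_format, OF zero_less_one]
proof eventually_elim
  case (elim n)
  show ?case
  proof (intro allI impI)
    fix k :: nat assume "k \<le> 2 ^ n"
    then show "(\<Sum>i<k. (dw n i)\<^sup>2) \<le> T + 1"
      using elim[rule_format, of k] G_in[of k n] by auto
  qed
qed

text \<open>Since \<open>(a + b)^2\<close> is at most \<open>2 a^2 + 2 b^2\<close>, the two parts of
  \<open>dx\<close> are bounded separately. Each increment of the monotone \<open>l\<close> is at
  most its total growth, so their squares sum to at most the square of that growth.\<close>

lemma eventually_sum_dx2:
  "\<forall>\<^sub>F n in sequentially. (\<Sum>i<2 ^ n. (dx n i)\<^sup>2) \<le> 2 * (T + 1) + 2 * (l T - l 0)\<^sup>2"
  using eventually_sum_dw2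
proof eventually_elim
  case (elim n)
  define \<Lambda> where "\<Lambda> = l T - l 0"
  have "dl n i \<le> \<Lambda>" if "i < 2 ^ n" for i
    unfolding \<Lambda>_def sum_dl[of n, symmetric] using that dl_nonneg by (intro member_le_sum) auto
  then have "(\<Sum>i<2 ^ n. (dl n i)\<^sup>2) \<le> (\<Sum>i<2 ^ n. \<Lambda> * dl n i)"
    using dl_nonneg by (intro sum_mono) (auto simp: power2_eq_square intro: mult_right_mono)
  also have "\<dots> = \<Lambda>\<^sup>2"
    by (simp add: sum_dl \<Lambda>_def power2_eq_square flip: sum_distrib_left)
  finally have 1: "(\<Sum>i<2 ^ n. (dl n i)\<^sup>2) \<le> \<Lambda>\<^sup>2" .
  have "(\<Sum>i<2 ^ n. (dx n i)\<^sup>2) \<le> (\<Sum>i<2 ^ n. 2 * (dw n i)\<^sup>2 + 2 * (dl n i)\<^sup>2)"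
  proof (rule sum_mono)
    fix i :: nat assume "i \<in> {..<2 ^ n}"
    then show "(dx n i)\<^sup>2 \<le> 2 * (dw n i)\<^sup>2 + 2 * (dl n i)\<^sup>2"
      using sum_squares_bound[of "dw n i" "dl n i"] by (simp add: dx_eq power2_sum)
  qed
  also have "\<dots> = 2 * (\<Sum>i<2 ^ n. (dw n i)\<^sup>2) + 2 * (\<Sum>i<2 ^ n. (dl n i)\<^sup>2)"
    by (simp add: sum.distrib sum_distrib_left)
  finally show ?case using elim[rule_format, of "2 ^ n"] 1 by (simp add: \<Lambda>_def)
qed

text \<open>For Lipschitz \<open>g\<close> this is summation by parts; polynomials are dense and Lipschitz.\<close>

lemma qv_weighted:
  assumes g: "continuous_on {0..T} g"
  shows "grid_null (\<lambda>n k. \<Sum>i<k. g (G n i) * ((dw n i)\<^sup>2 - T / 2 ^ n))"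
  unfolding grid_null_def
proof (intro allI impI)
  fix \<epsilon> :: real assume "\<epsilon> > 0"
  \<comment> \<open>Replacing \<open>g\<close> by a polynomial within \<open>\<eta>\<close> costs
    \<open>\<eta>\<close> times the sum of squared increments plus the total length, eventually at
    most \<open>2 * T + 1\<close>.\<close>
  define \<eta> where "\<eta> = \<epsilon> / (2 * (2 * T + 1))"
  have \<eta>: "\<eta> > 0" "\<eta> * (2 * T + 1) = \<epsilon> / 2"
    using \<open>\<epsilon> > 0\<close> T_pos by (auto simp: \<eta>_def field_simps add_pos_pos)
  obtain p B L where p: "\<And>t. t \<in> {0..T} \<Longrightarrow> \<bar>g t - p t\<bar> < \<eta>" "\<And>t. t \<in> {0..T} \<Longrightarrow> \<bar>p t\<bar> \<le> B"
    "0 \<le> B" "0 \<le> L" "\<And>s t. s \<in> {0..T} \<Longrightarrow> t \<in> {0..T} \<Longrightarrow> \<bar>p s - p t\<bar> \<le> L * \<bar>s - t\<bar>"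
    using continuous_polynomial_approx[OF g \<eta>(1)] by metis
  \<comment> \<open>After summation by parts, \<open>B\<close> bounds the weight of the boundary
    term and \<open>L * T\<close> the variation of the polynomial.\<close>
  define \<delta> where "\<delta> = \<epsilon> / (2 * (B + L * T + 1))"
  have BL: "B + L * T \<ge> 0" using p T_pos by auto
  have \<delta>: "\<delta> > 0" "\<delta> * (B + L * T) < \<epsilon> / 2"
    using \<open>\<epsilon> > 0\<close> BL by (auto simp: \<delta>_def field_simps add_nonneg_pos)
  from qv_uniform[unfolded grid_null_def, rule_format, OF \<delta>(1)] eventually_sum_dw2
  show "\<forall>\<^sub>F n in sequentially. \<forall>k\<le>2 ^ n. \<bar>\<Sum>i<k. g (G n i) * ((dw n i)\<^sup>2 - T / 2 ^ n)\<bar> < \<epsilon>"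
  proof eventually_elim
    case (elim n)
    show ?case
    proof (intro allI impI)
      fix k :: nat assume k: "k \<le> 2 ^ n"
      define e where "e j = (\<Sum>i<j. (dw n i)\<^sup>2) - G n j" for j
      have e: "\<bar>e j\<bar> \<le> \<delta>" if "j \<le> k" for j
        using elim(1)[rule_format, of j] that k by (simp add: e_def)
      have de: "(dw n i)\<^sup>2 - T / 2 ^ n = e (Suc i) - e i" for i
        by (simp add: e_def grid_Suc)
      have parts: "(\<Sum>i<j. p (G n i) * (e (Suc i) - e i)) =
          p (G n j) * e j - (\<Sum>i<j. (p (G n (Suc i)) - p (G n i)) * e (Suc i))" for j
        by (induction j) (auto simp: e_def[of 0] algebra_simps)
      have "\<bar>\<Sum>i<k. (p (G n (Suc i)) - p (G n i)) * e (Suc i)\<bar> \<le> (\<Sum>i<k. (L * (T / 2 ^ n)) * \<delta>)"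
      proof (rule order_trans[OF sum_abs sum_mono])
        fix i assume "i \<in> {..<k}"
        then have i: "i < 2 ^ n" "Suc i \<le> k" using k by auto
        have "\<bar>p (G n (Suc i)) - p (G n i)\<bar> \<le> L * \<bar>G n (Suc i) - G n i\<bar>"
          using i(1) by (intro p(5) G_in') auto
        also have "\<bar>G n (Suc i) - G n i\<bar> = T / 2 ^ n" using T_pos by (simp add: grid_Suc)
        finally have "\<bar>p (G n (Suc i)) - p (G n i)\<bar> \<le> L * (T / 2 ^ n)" .
        then show "\<bar>(p (G n (Suc i)) - p (G n i)) * e (Suc i)\<bar> \<le> L * (T / 2 ^ n) * \<delta>"
          unfolding abs_mult using e[OF i(2)] \<delta>(1) by (intro mult_mono) auto
      qed
      also have "\<dots> = G n k * L * \<delta>" by (simp add: grid_def)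
      also have "\<dots> \<le> T * L * \<delta>"
        using G_in[OF k] p \<delta> by (intro mult_right_mono) auto
      finally have 1: "\<bar>\<Sum>i<k. (p (G n (Suc i)) - p (G n i)) * e (Suc i)\<bar> \<le> T * L * \<delta>" .
      have "\<bar>p (G n k) * e k\<bar> \<le> B * \<delta>"
        unfolding abs_mult using p(2)[OF G_in[OF k]] e[of k] p(3) by (intro mult_mono) auto
      then have 2: "\<bar>\<Sum>i<k. p (G n i) * (e (Suc i) - e i)\<bar> \<le> \<delta> * (B + L * T)"
        unfolding parts using 1 by (simp add: algebra_simps)
      have "\<bar>\<Sum>i<k. (g (G n i) - p (G n i)) * (e (Suc i) - e i)\<bar> \<le> (\<Sum>i<k. \<eta> * ((dw n i)\<^sup>2 + T / 2 ^ n))"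
      proof (rule order_trans[OF sum_abs sum_mono])
        fix i assume "i \<in> {..<k}"
        then have "i < 2 ^ n" using k by auto
        then have "\<bar>g (G n i) - p (G n i)\<bar> \<le> \<eta>" using p(1) G_in' by (intro less_imp_le) auto
        moreover have "\<bar>e (Suc i) - e i\<bar> \<le> (dw n i)\<^sup>2 + T / 2 ^ n"
          using T_pos unfolding de[symmetric] by (simp add: abs_if)
        ultimately show "\<bar>(g (G n i) - p (G n i)) * (e (Suc i) - e i)\<bar> \<le> \<eta> * ((dw n i)\<^sup>2 + T / 2 ^ n)"
          unfolding abs_mult using \<eta> by (intro mult_mono) auto
      qed
      also have "\<dots> = \<eta> * ((\<Sum>i<k. (dw n i)\<^sup>2) + G n k)"
        by (simp add: sum_distrib_left sum.distrib grid_def algebra_simps)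
      also have "\<dots> \<le> \<eta> * (2 * T + 1)"
        using elim(2)[rule_format, OF k] G_in[OF k] \<eta> by (intro mult_left_mono) auto
      finally have 3: "\<bar>\<Sum>i<k. (g (G n i) - p (G n i)) * (e (Suc i) - e i)\<bar> \<le> \<epsilon> / 2"
        using \<eta> by simp
      have "(\<Sum>i<k. g (G n i) * ((dw n i)\<^sup>2 - T / 2 ^ n)) =
          (\<Sum>i<k. (g (G n i) - p (G n i)) * (e (Suc i) - e i)) + (\<Sum>i<k. p (G n i) * (e (Suc i) - e i))"
        unfolding de by (simp add: algebra_simps flip: sum.distrib)
      then show "\<bar>\<Sum>i<k. g (G n i) * ((dw n i)\<^sup>2 - T / 2 ^ n)\<bar> < \<epsilon>"
        using 2 3 \<delta>(2) by linarith
    qed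
  qed
qed

text \<open>The error over one cell splits into five pieces: the Taylor remainder
  (\<open>E1\<close>), the first-order term against \<open>dl\<close> (\<open>E2\<close>), the
  replacement of \<open>dx^2\<close> by \<open>dw^2\<close>, whose difference is
  \<open>dl * (dx + dw)\<close> (\<open>E3\<close>), the replacement of \<open>dw^2\<close> by the
  cell length (\<open>E4\<close>), and the Riemann sum error (\<open>E5\<close>). Each sums to a
  grid-null quantity.\<close>

lemma ito_grid:
  assumes f: "f \<in> C2" and f0: "deriv f 0 = 0"
  shows "grid_null (\<lambda>n k. f (x (G n k)) - f (x 0) - integral {0..G n k} (\<lambda>s. deriv (deriv f) (x s)) / 2
     - (\<Sum>i<k. deriv f (x (G n i)) * dw n i))"
proof -
  define g where "g = (\<lambda>t. deriv (deriv f) (x t))"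
  have g: "continuous_on {0..T} g"
    unfolding g_def by (intro continuous_on_compose2[OF C2_derivs(5)[OF f] cont_x]) auto
  obtain R where R: "R > 0" "\<And>t. t \<in> {0..T} \<Longrightarrow> \<bar>x t\<bar> \<le> R" "\<And>t. t \<in> {0..T} \<Longrightarrow> \<bar>g t\<bar> \<le> R"
  proof -
    have "bounded (x ` {0..T} \<union> g ` {0..T})"
      unfolding bounded_Un using cont_x g by (auto intro!: compact_imp_bounded compact_continuous_image)
    then obtain R where "R > 0" "\<forall>y\<in>x ` {0..T} \<union> g ` {0..T}. norm y \<le> R"
      by (auto simp: bounded_pos)
    then show ?thesis by (intro that[of R]) auto
  qed
  define E1 where "E1 n i = f (x (G n (Suc i))) - f (x (G n i)) - deriv f (x (G n i)) * dx n i
      - g (G n i) / 2 * (dx n i)\<^sup>2" for n i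
  define E2 where "E2 n i = deriv f (x (G n i)) * dl n i" for n i
  define E3 where "E3 n i = g (G n i) / 2 * (dl n i * (dx n i + dw n i))" for n i
  define E4 where "E4 n i = (g (G n i) / 2) * ((dw n i)\<^sup>2 - T / 2 ^ n)" for n i
  define E5 where "E5 n i = (g (G n i) * (T / 2 ^ n) - integral {G n i..G n (Suc i)} g) / 2" for n i
  have close: "i < 2 ^ n \<Longrightarrow> \<bar>G n (Suc i) - G n i\<bar> \<le> T / 2 ^ n" for n i
    using T_pos by (simp add: grid_Suc)

  have 1: "grid_null (\<lambda>n k. \<Sum>i<k. E1 n i)"
  proof (rule grid_null_sumI[OF _ eventually_sum_dx2])
    fix \<epsilon> :: real assume "0 < \<epsilon>"
    obtain d where d: "d > 0" "\<And>a b. \<bar>a\<bar> \<le> R \<Longrightarrow> \<bar>b\<bar> \<le> R \<Longrightarrow> \<bar>b - a\<bar> < d \<Longrightarrow>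
        \<bar>f b - f a - deriv f a * (b - a) - deriv (deriv f) a / 2 * (b - a)\<^sup>2\<bar> \<le> \<epsilon> * (b - a)\<^sup>2"
      using C2_taylor[OF f \<open>0 < \<epsilon>\<close>] by metis
    from eventually_grid_osc[OF T_pos cont_x d(1)]
    show "\<forall>\<^sub>F n in sequentially. \<forall>i<2 ^ n. \<bar>E1 n i\<bar> \<le> \<epsilon> * (dx n i)\<^sup>2"
    proof eventually_elim
      case (elim n)
      then show ?case
        using close G_in' R(2) unfolding E1_def dx_def g_def by (intro allI impI d(2)) auto
    qed
  qed auto

  have L: "\<forall>\<^sub>F n in sequentially. (\<Sum>i<2 ^ n. dl n i) \<le> l T - l 0"
    by (simp add: sum_dl)
  \<comment> \<open>A cell with \<open>dl n i > 0\<close> contains a zero of \<open>x\<close>, so at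
    its left end \<open>x\<close> is within one oscillation of 0, where \<open>deriv f\<close> is
    small. All other cells contribute nothing.\<close>
  have 2: "grid_null (\<lambda>n k. \<Sum>i<k. E2 n i)"
  proof (rule grid_null_sumI[OF dl_nonneg L])
    fix \<epsilon> :: real assume "0 < \<epsilon>"
    have "isCont (deriv f) 0"
      using C2_derivs(4)[OF f, of UNIV] by (simp add: continuous_on_eq_continuous_at)
    then obtain d where d: "d > 0" "\<And>a. \<bar>a\<bar> < d \<Longrightarrow> \<bar>deriv f a\<bar> < \<epsilon>"
      using \<open>0 < \<epsilon>\<close> f0 unfolding continuous_at_eps_delta dist_real_def by (metis diff_zero)
    from eventually_grid_osc[OF T_pos cont_x d(1)]
    show "\<forall>\<^sub>F n in sequentially. \<forall>i<2 ^ n. \<bar>E2 n i\<bar> \<le> \<epsilon> * dl n i"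
    proof eventually_elim
      case (elim n)
      show ?case
      proof (intro allI impI)
        fix i :: nat assume i: "i < 2 ^ n"
        show "\<bar>E2 n i\<bar> \<le> \<epsilon> * dl n i"
        proof (cases "dl n i = 0")
          case False
          then have "l (G n i) < l (G n (Suc i))"
            using dl_nonneg[OF i] by (simp add: dl_def)
          then obtain r where r: "r \<in> {G n i..G n (Suc i)}" "x r = 0"
            using l_growth[of "G n i" "G n (Suc i)"] G_in'[OF i] G_le_Suc[of n i] by auto
          have "\<bar>x (G n i) - x r\<bar> < d"
            using elim[rule_format, of "G n i" r] r G_in'[OF i] close[OF i] by auto
          then have "\<bar>deriv f (x (G n i))\<bar> \<le> \<epsilon>" using d(2) r by (intro less_imp_le) auto
          then show ?thesis
            using dl_nonneg[OF i] by (simp add: E2_def abs_mult mult_right_mono)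
        qed (simp add: E2_def)
      qed
    qed
  qed

  have 3: "grid_null (\<lambda>n k. \<Sum>i<k. E3 n i)"
  proof (rule grid_null_sumI[OF dl_nonneg L])
    fix \<epsilon> :: real assume "0 < \<epsilon>"
    then have "\<epsilon> / R > 0" using R by simp
    from eventually_grid_osc[OF T_pos cont_x this] eventually_grid_osc[OF T_pos cont_w this]
    show "\<forall>\<^sub>F n in sequentially. \<forall>i<2 ^ n. \<bar>E3 n i\<bar> \<le> \<epsilon> * dl n i"
    proof eventually_elim
      case (elim n)
      show ?case
      proof (intro allI impI)
        fix i :: nat assume i: "i < 2 ^ n"
        have "\<bar>dx n i\<bar> < \<epsilon> / R" "\<bar>dw n i\<bar> < \<epsilon> / R"
          using elim close[OF i] G_in'[OF i] unfolding dx_def dw_def by blast+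
        moreover have "\<bar>a + b\<bar> / 2 \<le> c" if "\<bar>a\<bar> < c" "\<bar>b\<bar> < c" for a b c :: real
          using that abs_triangle_ineq[of a b] by simp
        ultimately have "\<bar>dx n i + dw n i\<bar> / 2 \<le> \<epsilon> / R" by blast
        then have "\<bar>g (G n i)\<bar> * (\<bar>dx n i + dw n i\<bar> / 2) \<le> R * (\<epsilon> / R)"
          using R(1) R(3)[OF G_in'(1)[OF i]] by (intro mult_mono) auto
        then have "(\<bar>g (G n i)\<bar> * (\<bar>dx n i + dw n i\<bar> / 2)) * dl n i \<le> \<epsilon> * dl n i"
          using dl_nonneg[OF i] R(1) by (intro mult_right_mono) auto
        then show "\<bar>E3 n i\<bar> \<le> \<epsilon> * dl n i"
          using dl_nonneg[OF i] by (simp add: E3_def abs_mult mult_ac)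
      qed
    qed
  qed

  have 4: "grid_null (\<lambda>n k. \<Sum>i<k. E4 n i)"
    unfolding E4_def using g by (intro qv_weighted continuous_intros) auto

  have int: "g integrable_on {a..b}" if "0 \<le> a" "b \<le> T" for a b
    using that by (intro integrable_continuous_real continuous_on_subset[OF g]) auto

  have 5: "grid_null (\<lambda>n k. \<Sum>i<k. E5 n i)"
  proof (rule grid_null_sumI[where b = "\<lambda>n i. T / 2 ^ n" and K = T])
    fix \<epsilon> :: real assume "0 < \<epsilon>"
    from eventually_grid_osc[OF T_pos g this]
    show "\<forall>\<^sub>F n in sequentially. \<forall>i<2 ^ n. \<bar>E5 n i\<bar> \<le> \<epsilon> * (T / 2 ^ n)"
    proof eventually_elim
      case (elim n)
      show ?case
      proof (intro allI impI)
        fix i :: nat assume i: "i < 2 ^ n"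
        have I: "integral {G n i..G n (Suc i)} (\<lambda>t. g (G n i)) = g (G n i) * (T / 2 ^ n)"
          using T_pos by (simp add: grid_Suc)
        have "\<bar>integral {G n i..G n (Suc i)} (\<lambda>t. g (G n i) - g t)\<bar> \<le> \<epsilon> * (G n (Suc i) - G n i)"
        proof (rule integral_bound[where 'a = real, unfolded real_norm_def])
          show "continuous_on {G n i..G n (Suc i)} (\<lambda>t. g (G n i) - g t)"
            using G_in'[OF i] by (intro continuous_intros continuous_on_subset[OF g]) auto
          fix t assume t: "t \<in> {G n i..G n (Suc i)}"
          then show "\<bar>g (G n i) - g t\<bar> \<le> \<epsilon>"
            using elim[rule_format, of "G n i" t] G_in'[OF i] close[OF i] by fastforce
        qed (rule G_le_Suc)
        also have "integral {G n i..G n (Suc i)} (\<lambda>t. g (G n i) - g t) = 2 * E5 n i"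
          using G_in'[OF i] unfolding E5_def I[symmetric]
          by (subst Henstock_Kurzweil_Integration.integral_diff) (auto intro!: int)
        also have "G n (Suc i) - G n i = T / 2 ^ n" by (simp add: grid_Suc)
        finally show "\<bar>E5 n i\<bar> \<le> \<epsilon> * (T / 2 ^ n)" by linarith
      qed
    qed
  qed (use T_pos in auto)

  have "grid_null (\<lambda>n k. ((((\<Sum>i<k. E1 n i) + (\<Sum>i<k. E2 n i)) + (\<Sum>i<k. E3 n i)) + (\<Sum>i<k. E4 n i)) + (\<Sum>i<k. E5 n i))"
    by (intro grid_null_add 1 2 3 4 5)
  moreover have "f (x (G n k)) - f (x 0) - integral {0..G n k} g / 2 - (\<Sum>i<k. deriv f (x (G n i)) * dw n i) =
      ((((\<Sum>i<k. E1 n i) + (\<Sum>i<k. E2 n i)) + (\<Sum>i<k. E3 n i)) + (\<Sum>i<k. E4 n i)) + (\<Sum>i<k. E5 n i)"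
    if "k \<le> 2 ^ n" for n k
    using that
  proof (induction k)
    case (Suc k)
    then have k: "k < 2 ^ n" by simp
    have "integral {0..G n (Suc k)} g = integral {0..G n k} g + integral {G n k..G n (Suc k)} g"
      using G_in'[OF k] G_le_Suc[of n k]
      by (intro Henstock_Kurzweil_Integration.integral_combine[symmetric] int) auto
    moreover have "f (x (G n (Suc k))) - f (x (G n k)) - integral {G n k..G n (Suc k)} g / 2 - deriv f (x (G n k)) * dw n k =
        E1 n k + E2 n k + E3 n k + E4 n k + E5 n k"
      by (simp add: E1_def E2_def E3_def E4_def E5_def dx_eq[OF k] field_simps power2_eq_square)
    ultimately show ?case
      using Suc by (simp add: add_divide_distrib)
  qed auto
  ultimately show ?thesis
    unfolding grid_null_def g_def[symmetric] by (auto elim!: eventually_mono)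
qed

text \<open>At grid points this is \<open>ito_grid\<close>. For other times the cell containing
  \<open>t\<close> adds one term, a bounded factor times a small increment of \<open>w\<close>, and
  the continuous limit moves by its oscillation over a cell. Each of the three errors is at most
  \<open>\<epsilon> / 3\<close>.\<close>

lemma ito_uniform:
  assumes f: "f \<in> C2" and f0: "deriv f 0 = 0" and "\<epsilon> > 0"
  shows "\<forall>\<^sub>F n in sequentially. \<forall>t\<in>{0..T}.
    \<bar>(\<Sum>i<2 ^ n. deriv f (x (G n i)) * (w (min t (G n (Suc i))) - w (min t (G n i)))) -
     (f (x t) - f (x 0) - integral {0..t} (\<lambda>s. deriv (deriv f) (x s)) / 2)\<bar> < \<epsilon>"
proof -
  define I where "I t = f (x t) - f (x 0) - integral {0..t} (\<lambda>s. deriv (deriv f) (x s)) / 2" for t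
  have "continuous_on {0..T} (\<lambda>t. integral {0..t} (\<lambda>s. deriv (deriv f) (x s)))"
    by (intro indefinite_integral_continuous_1 integrable_continuous_real
        continuous_on_compose2[OF C2_derivs(5)[OF f] cont_x]) auto
  then have I: "continuous_on {0..T} I"
    unfolding I_def by (intro continuous_intros continuous_on_compose2[OF C2_derivs(3)[OF f] cont_x]) auto
  have "bounded ((\<lambda>t. deriv f (x t)) ` {0..T})"
    by (intro compact_imp_bounded compact_continuous_image continuous_on_compose2[OF C2_derivs(4)[OF f] cont_x]) auto
  then obtain R where R: "R > 0" "\<And>t. t \<in> {0..T} \<Longrightarrow> \<bar>deriv f (x t)\<bar> \<le> R"
    by (auto simp: bounded_pos)
  have e: "\<epsilon> / 3 > 0" "\<epsilon> / (3 * R) > 0" using \<open>\<epsilon> > 0\<close> R by auto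
  from ito_grid[OF f f0, unfolded grid_null_def, rule_format, OF e(1)]
    eventually_grid_osc[OF T_pos I e(1)] eventually_grid_osc[OF T_pos cont_w e(2)]
  show ?thesis
  proof eventually_elim
    case (elim n)
    show ?case
    proof
      fix t assume t: "t \<in> {0..T}"
      define J where "J = (\<Sum>i<2 ^ n. deriv f (x (G n i)) * (w (min t (G n (Suc i))) - w (min t (G n i))))"
      \<comment> \<open>At \<open>t = T\<close> the floor would give \<open>2 ^ n\<close>, which is
        not the index of a cell.\<close>
      define k where "k = (if t = T then 2 ^ n - 1 else nat \<lfloor>t * 2 ^ n / T\<rfloor>)"
      have k: "k < 2 ^ n" "G n k \<le> t" "t \<le> G n (Suc k)"
      proof -
        show "k < 2 ^ n"
          using t T_pos by (auto simp: k_def nat_less_iff floor_less_iff field_simps)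
        show "G n k \<le> t"
        proof (cases "t = T")
          case True then show ?thesis using T_pos G_in[of k n] \<open>k < 2 ^ n\<close> by auto
        next
          case False
          then have "real k \<le> t * 2 ^ n / T" using t T_pos by (auto simp: k_def)
          then show ?thesis using T_pos by (simp add: grid_def field_simps)
        qed
        show "t \<le> G n (Suc k)"
        proof (cases "t = T")
          case True then show ?thesis by (simp add: k_def)
        next
          case False
          then have "t * 2 ^ n / T \<le> real (Suc k)" using t T_pos by (simp add: k_def) linarith
          then show ?thesis using T_pos by (simp add: grid_def field_simps)
        qed
      qed
      have tk: "\<bar>t - G n k\<bar> \<le> T / 2 ^ n" using k by (simp add: grid_Suc)
      \<comment> \<open>Cells before \<open>k\<close> are complete at time \<open>t\<close>, cell
        \<open>k\<close> is cut at \<open>t\<close>, and in later cells both minima equal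
        \<open>t\<close>.\<close>
      have "J = (\<Sum>i<2 ^ n. if i < k then deriv f (x (G n i)) * dw n i
          else if i = k then deriv f (x (G n k)) * (w t - w (G n k)) else 0)"
        unfolding J_def
      proof (rule sum.cong)
        fix i assume "i \<in> {..<(2::nat) ^ n}"
        have *: "G n (Suc i) \<le> t" if "i < k"
          using that k grid_mono[of T "Suc i" k n] T_pos by simp
        have **: "t \<le> G n i" if "k < i"
          using that k grid_mono[of T "Suc k" i n] T_pos by simp
        show "deriv f (x (G n i)) * (w (min t (G n (Suc i))) - w (min t (G n i))) =
          (if i < k then deriv f (x (G n i)) * dw n i
          else if i = k then deriv f (x (G n k)) * (w t - w (G n k)) else 0)"
          using * ** k G_le_Suc[of n i] by (cases i k rule: linorder_cases) (auto simp: dw_def min_def)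
      qed simp
      also have "\<dots> = (\<Sum>i<Suc k. if i < k then deriv f (x (G n i)) * dw n i
          else if i = k then deriv f (x (G n k)) * (w t - w (G n k)) else 0)"
        using k by (intro sum.mono_neutral_right) auto
      also have "\<dots> = (\<Sum>i<k. deriv f (x (G n i)) * dw n i) + deriv f (x (G n k)) * (w t - w (G n k))"
        by simp
      finally have J: "J = \<dots>" .
      have "\<bar>w t - w (G n k)\<bar> \<le> \<epsilon> / (3 * R)"
        using elim(3) t G_in'(1)[OF k(1)] tk by (intro less_imp_le) auto
      then have "\<bar>deriv f (x (G n k)) * (w t - w (G n k))\<bar> \<le> R * (\<epsilon> / (3 * R))"
        unfolding abs_mult using R(1) R(2)[OF G_in'(1)[OF k(1)]] by (intro mult_mono) auto
      also have "\<dots> = \<epsilon> / 3" using R by simp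
      finally have 1: "\<bar>deriv f (x (G n k)) * (w t - w (G n k))\<bar> \<le> \<epsilon> / 3" .
      have 2: "\<bar>I t - I (G n k)\<bar> < \<epsilon> / 3" using elim(2) t G_in'(1)[OF k(1)] tk by auto
      have 3: "\<bar>I (G n k) - (\<Sum>i<k. deriv f (x (G n i)) * dw n i)\<bar> < \<epsilon> / 3"
        using elim(1) k by (simp add: I_def)
      have "\<bar>J - I t\<bar> < \<epsilon>" using 1 2 3 unfolding J by linarith
      then show "\<bar>(\<Sum>i<2 ^ n. deriv f (x (G n i)) * (w (min t (G n (Suc i))) - w (min t (G n i)))) -
         (f (x t) - f (x 0) - integral {0..t} (\<lambda>s. deriv (deriv f) (x s)) / 2)\<bar> < \<epsilon>"
        by (simp add: J_def I_def)
    qed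
  qed
qed

end

section \<open>The Skorokhod map\<close>

definition running_sup :: "(real \<Rightarrow> real) \<Rightarrow> real \<Rightarrow> real" where
  "running_sup h t = (SUP s\<in>{0..t}. h s)"

lemma running_sup_attained:
  assumes "continuous_on {0..t} h" "0 \<le> t"
  obtains r where "r \<in> {0..t}" "running_sup h t = h r" "\<And>s. s \<in> {0..t} \<Longrightarrow> h s \<le> h r"
proof -
  obtain r where r: "r \<in> {0..t}" "\<And>s. s \<in> {0..t} \<Longrightarrow> h s \<le> h r"
    using continuous_attains_sup[of "{0..t}" h] assms by auto
  moreover have "running_sup h t = h r"
    unfolding running_sup_def using r by (intro cSup_eq_maximum) auto
  ultimately show ?thesis using that by blast
qed

lemma running_sup_upper:
  assumes "continuous_on {0..t} h" "s \<in> {0..t}"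
  shows "h s \<le> running_sup h t"
  using running_sup_attained[OF assms(1)] assms(2) by (metis atLeastAtMost_iff order_trans)

lemma running_sup_mono:
  assumes "continuous_on {0..t} h" "0 \<le> s" "s \<le> t"
  shows "running_sup h s \<le> running_sup h t"
proof -
  have "continuous_on {0..s} h" using assms by (auto intro: continuous_on_subset)
  then obtain r where "r \<in> {0..s}" "running_sup h s = h r"
    using assms running_sup_attained by blast
  then show ?thesis using running_sup_upper[of t h r] assms by auto
qed

lemma running_sup_continuous:
  assumes h: "continuous_on {0..T} h"
  shows "continuous_on {0..T} (running_sup h)"
proof -
  have "uniformly_continuous_on {0..T} h"
    using h by (intro compact_uniformly_continuous) auto
  have cont: "continuous_on {0..t} h" if "t \<le> T" for t
    using that by (intro continuous_on_subset[OF h]) auto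
  have "uniformly_continuous_on {0..T} (running_sup h)"
    unfolding uniformly_continuous_on_def
  proof (intro allI impI)
    fix \<epsilon> :: real assume "\<epsilon> > 0"
    then obtain d where d: "d > 0" "\<And>s t. s \<in> {0..T} \<Longrightarrow> t \<in> {0..T} \<Longrightarrow> dist t s < d \<Longrightarrow> dist (h t) (h s) < \<epsilon>"
      using \<open>uniformly_continuous_on {0..T} h\<close> unfolding uniformly_continuous_on_def by metis
    have main: "running_sup h t - running_sup h s < \<epsilon>"
      if st: "s \<in> {0..T}" "t \<in> {0..T}" "s \<le> t" "t - s < d" for s t
    proof -
      obtain r where r: "r \<in> {0..t}" "running_sup h t = h r"
        by (rule running_sup_attained[OF cont, of t]) (use st in auto)
      show ?thesis
      proof (cases "r \<le> s")
        case True
        then have "h r \<le> running_sup h s" using r st by (intro running_sup_upper cont) auto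
        then show ?thesis using r \<open>\<epsilon> > 0\<close> by simp
      next
        case False
        have "dist (h r) (h s) < \<epsilon>" using False r st by (intro d(2)) (auto simp: dist_real_def)
        moreover have "h s \<le> running_sup h s" using st by (intro running_sup_upper cont) auto
        ultimately show ?thesis using r by (auto simp: dist_real_def)
      qed
    qed
    have "dist (running_sup h t) (running_sup h s) < \<epsilon>"
      if "s \<in> {0..T}" "t \<in> {0..T}" "dist t s < d" for s t
      using that main[of s t] main[of t s] running_sup_mono[OF cont, of t s] running_sup_mono[OF cont, of s t]
      by (cases "s \<le> t") (auto simp: dist_real_def)
    then show "\<exists>d>0. \<forall>s\<in>{0..T}. \<forall>t\<in>{0..T}. dist t s < d \<longrightarrow> dist (running_sup h t) (running_sup h s) < \<epsilon>"
      using d(1) by blast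
  qed
  then show ?thesis by (rule uniformly_continuous_imp_continuous)
qed

text \<open>Measurability of a supremum over an interval of times needs a countable index set.
  Writing times as \<open>t * q\<close> lets the rationals of \<open>[0, 1]\<close> serve every
  \<open>t\<close>, including 0.\<close>

lemma running_sup_dense:
  assumes h: "continuous_on {0..t} h" and "0 \<le> t"
  shows "running_sup h t = (SUP q\<in>\<rat> \<inter> {0..1}. h (t * q))"
    and "bdd_above ((\<lambda>q. h (t * q)) ` (\<rat> \<inter> {0..1}))"
proof -
  have in_t: "t * q \<in> {0..t}" if "q \<in> {0..1}" for q
    using that assms(2) by (auto simp: mult_left_le)
  obtain r where r: "r \<in> {0..t}" "running_sup h t = h r" "\<And>s. s \<in> {0..t} \<Longrightarrow> h s \<le> h r"
    using running_sup_attained[OF assms] by blast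
  have ub: "h (t * q) \<le> h r" if "q \<in> \<rat> \<inter> {0..1}" for q
    using that r(3) in_t by auto
  show bdd: "bdd_above ((\<lambda>q. h (t * q)) ` (\<rat> \<inter> {0..1}))"
    by (rule bdd_aboveI2[OF ub])
  \<comment> \<open>A dense set meets an open set in a dense subset of it; the closure of the open
    interval then brings back the end points.\<close>
  have dense: "closure (\<rat> \<inter> {0<..<1}) = {0..1::real}"
  proof -
    have "{0<..<1} \<subseteq> closure (\<rat> \<inter> {0<..<1::real})"
      using open_Int_closure_subset[of "{0<..<1::real}" \<rat>] by (simp add: Rats_closure_real Int_commute)
    then have "closure {0<..<1} \<subseteq> closure (\<rat> \<inter> {0<..<1::real})"
      by (rule closure_minimal) simp
    moreover have "closure (\<rat> \<inter> {0<..<1::real}) \<subseteq> closure {0<..<1}"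
      by (rule closure_mono) simp
    ultimately show ?thesis by simp
  qed
  have "h (t * q) \<le> (SUP q\<in>\<rat> \<inter> {0..1}. h (t * q))" if "q \<in> {0..1}" for q
  proof (rule continuous_le_on_closure[of "\<rat> \<inter> {0<..<1}" "\<lambda>q. h (t * q)"])
    show "continuous_on (closure (\<rat> \<inter> {0<..<1})) (\<lambda>q. h (t * q))"
      unfolding dense using in_t by (intro continuous_on_compose2[OF h] continuous_intros) auto
    show "q \<in> closure (\<rat> \<inter> {0<..<1})" using that dense by simp
    show "h (t * q) \<le> (SUP q\<in>\<rat> \<inter> {0..1}. h (t * q))" if "q \<in> \<rat> \<inter> {0<..<1}" for q
      using that by (intro cSUP_upper bdd) auto
  qed
  moreover obtain q where "q \<in> {0..1}" "r = t * q"
    using r(1) assms(2) that[of "r / t"] that[of 0] by (cases "t = 0") auto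
  ultimately have "h r \<le> (SUP q\<in>\<rat> \<inter> {0..1}. h (t * q))" by blast
  moreover have "(SUP q\<in>\<rat> \<inter> {0..1}. h (t * q)) \<le> h r"
    using ub by (intro cSUP_least) (auto intro: exI[of _ 0])
  ultimately show "running_sup h t = (SUP q\<in>\<rat> \<inter> {0..1}. h (t * q))" using r by simp
qed

lemma borel_measurable_running_sup:
  assumes "\<And>s. s \<in> {0..t} \<Longrightarrow> h s \<in> borel_measurable N" "0 \<le> t"
    "\<And>\<omega>. \<omega> \<in> space N \<Longrightarrow> continuous_on {0..t} (\<lambda>s. h s \<omega>)"
  shows "(\<lambda>\<omega>. running_sup (\<lambda>s. h s \<omega>) t) \<in> borel_measurable N"
proof -
  have "(\<lambda>\<omega>. SUP q\<in>\<rat> \<inter> {0..1}. h (t * q) \<omega>) \<in> borel_measurable N"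
  proof (rule borel_measurable_cSUP)
    show "countable (\<rat> \<inter> {0..1::real})"
      by (intro countable_Int1 countable_rat)
    show "h (t * q) \<in> borel_measurable N" if "q \<in> \<rat> \<inter> {0..1}" for q
      using that assms(2) by (intro assms(1)) (auto simp: mult_left_le)
    show "bdd_above ((\<lambda>q. h (t * q) \<omega>) ` (\<rat> \<inter> {0..1}))" if "\<omega> \<in> space N" for \<omega>
      using running_sup_dense(2)[OF assms(3)[OF that] assms(2)] .
  qed
  then show ?thesis
    using running_sup_dense(1)[OF assms(3) assms(2)] by (simp cong: measurable_cong)
qed

text \<open>The Skorokhod map: the smallest nondecreasing push keeping the path nonnegative.\<close>

definition push :: "(real \<Rightarrow> real) \<Rightarrow> real \<Rightarrow> real" where
  "push y = running_sup (\<lambda>s. max 0 (- y s))"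

context
  fixes y :: "real \<Rightarrow> real" and T :: real
  assumes y: "continuous_on {0..T} y"
begin

lemma push_path: "t \<le> T \<Longrightarrow> continuous_on {0..t} (\<lambda>s. max 0 (- y s))"
  by (intro continuous_intros continuous_on_subset[OF y]) auto

lemma push_continuous: "continuous_on {0..T} (push y)"
  unfolding push_def by (intro running_sup_continuous push_path) auto

lemma push_mono: "0 \<le> s \<Longrightarrow> s \<le> t \<Longrightarrow> t \<le> T \<Longrightarrow> push y s \<le> push y t"
  unfolding push_def by (intro running_sup_mono push_path) auto

lemma push_ge: "t \<in> {0..T} \<Longrightarrow> max 0 (- y t) \<le> push y t"
  unfolding push_def by (rule running_sup_upper) (auto intro: push_path)

text \<open>If the supremum grows between \<open>s\<close> and \<open>t\<close>, it is attained at
  some \<open>r\<close> in \<open>{s..t}\<close> and equals \<open>- y r\<close> there, being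
  positive. At \<open>r\<close> the push lies between \<open>- y r\<close> and
  \<open>push y t\<close>, which coincide, so the pushed path vanishes.\<close>

lemma push_growth:
  assumes "0 \<le> s" "s \<le> t" "t \<le> T" "push y s < push y t"
  shows "\<exists>r\<in>{s..t}. y r + push y r = 0"
proof -
  obtain r where r: "r \<in> {0..t}" "push y t = max 0 (- y r)"
    unfolding push_def by (rule running_sup_attained[OF push_path, of t]) (use assms in auto)
  have "r \<in> {s..t}"
  proof (rule ccontr)
    assume "r \<notin> {s..t}"
    then have "max 0 (- y r) \<le> push y s"
      unfolding push_def using r assms by (intro running_sup_upper push_path) auto
    then show False using r(2) assms(4) by linarith
  qed
  moreover have "0 \<le> push y s" using push_ge[of s] assms by auto
  then have "push y t = - y r" using r assms by auto
  moreover have "- y r \<le> push y r" "push y r \<le> push y t"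
    using push_ge[of r] push_mono[of r t] r assms by auto
  ultimately show ?thesis by force
qed

end

section \<open>Filtrations and measurability of path functionals\<close>

lemma natural_filtration_generators:
  "(\<Union>s\<in>{0..min t T}. {X s -` A \<inter> space M | A. A \<in> sets borel}) \<subseteq> Pow (space M)"
  by auto

lemma space_natural_filtration [simp]: "space (natural_filtration M T X t) = space M"
  unfolding natural_filtration_def by (rule space_measure_of[OF natural_filtration_generators])

lemma sets_natural_filtration:
  "sets (natural_filtration M T X t) =
     sigma_sets (space M) (\<Union>s\<in>{0..min t T}. {X s -` A \<inter> space M | A. A \<in> sets borel})"
  unfolding natural_filtration_def by (rule sets_measure_of[OF natural_filtration_generators])

lemma natural_filtration_mono:
  "s \<le> t \<Longrightarrow> sets (natural_filtration M T X s) \<subseteq> sets (natural_filtration M T X t)"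
  unfolding sets_natural_filtration by (intro sigma_sets_mono' UN_mono) auto

lemma measurable_natural_filtration:
  assumes "s \<in> {0..T}" "s \<le> t"
  shows "X s \<in> borel_measurable (natural_filtration M T X t)"
proof (rule measurableI)
  fix A :: "real set" assume "A \<in> sets borel"
  then show "X s -` A \<inter> space (natural_filtration M T X t) \<in> sets (natural_filtration M T X t)"
    using assms unfolding sets_natural_filtration space_natural_filtration
    by (intro sigma_sets.Basic UN_I[of s]) auto
qed auto

lemma natural_filtration_least:
  assumes "space N = space M" "\<And>s. s \<in> {0..T} \<Longrightarrow> s \<le> t \<Longrightarrow> X s \<in> borel_measurable N"
  shows "sets (natural_filtration M T X t) \<subseteq> sets N"
  unfolding sets_natural_filtration assms(1)[symmetric]
  by (rule sets.sigma_sets_subset) (auto intro!: measurable_sets[OF assms(2)])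

lemma usual_filtration_generators:
  "(\<Inter>u\<in>{t<..}. sigma_sets (space M) (sets (natural_filtration M T X u) \<union> null_sets (completion M)))
     \<subseteq> Pow (space M)"
proof -
  have gen: "sets (natural_filtration M T X (t + 1)) \<union> null_sets (completion M) \<subseteq> Pow (space M)"
    using sets.space_closed[of "natural_filtration M T X (t + 1)"] sets.space_closed[of "completion M"]
    by (auto simp: null_sets_def)
  have "sigma_sets (space M) (sets (natural_filtration M T X (t + 1)) \<union> null_sets (completion M)) \<subseteq> Pow (space M)"
    by (intro subsetI, rule PowI) (rule sigma_sets_into_sp[OF gen])
  then show ?thesis by (rule INF_lower2[rotated]) simp
qed

lemma space_usual_filtration [simp]: "space (usual_filtration M T X t) = space M"
  unfolding usual_filtration_def by (rule space_measure_of[OF usual_filtration_generators])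

text \<open>The processes built below are adapted already to the raw filtration of \<open>W\<close>;
  the usual augmentation enters only through this inclusion.\<close>

lemma natural_subset_usual: "sets (natural_filtration M T X t) \<subseteq> sets (usual_filtration M T X t)"
proof
  fix A assume "A \<in> sets (natural_filtration M T X t)"
  then have "A \<in> sets (natural_filtration M T X u)" if "t < u" for u
    using natural_filtration_mono[of t u M T X] that by auto
  then show "A \<in> sets (usual_filtration M T X t)"
    unfolding usual_filtration_def sets_measure_of[OF usual_filtration_generators]
    by (intro sigma_sets.Basic INT_I UnI1) auto
qed

lemma measurable_usual_filtration:
  "h \<in> borel_measurable (natural_filtration M T X t) \<Longrightarrow> h \<in> borel_measurable (usual_filtration M T X t)"
  using natural_subset_usual[of M T X t] by (auto simp: measurable_def)

section \<open>Measurability of evaluations and integrals of continuous processes\<close>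

definition confine :: "real \<Rightarrow> real \<Rightarrow> real \<Rightarrow> real" where
  "confine a b s = max a (min b s)"

lemma confine_in: "a \<le> b \<Longrightarrow> confine a b s \<in> {a..b}"
  and confine_id: "s \<in> {a..b} \<Longrightarrow> confine a b s = s"
  by (auto simp: confine_def)

text \<open>Rounding the time to multiples of \<open>1 / (n + 1)\<close> leaves countably many
  measurable pieces, and continuity of the paths gives the limit. The clamp keeps rounded times
  inside the interval, where alone the process is controlled.\<close>

lemma borel_measurable_confined_process:
  fixes h :: "real \<Rightarrow> 'a \<Rightarrow> real"
  assumes "a \<le> b" and meas: "\<And>s. s \<in> {a..b} \<Longrightarrow> h s \<in> borel_measurable N"
    and cont: "\<And>\<omega>. \<omega> \<in> space N \<Longrightarrow> continuous_on {a..b} (\<lambda>s. h s \<omega>)"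
  shows "(\<lambda>(\<omega>, s). h (confine a b s) \<omega>) \<in> borel_measurable (N \<Otimes>\<^sub>M borel)"
proof -
  define r :: "nat \<Rightarrow> real \<Rightarrow> real" where "r n s = of_int \<lfloor>s * real (Suc n)\<rfloor> / real (Suc n)" for n s
  have r: "(\<lambda>n. r n s) \<longlonglongrightarrow> s" for s
  proof -
    have "(\<lambda>n. r n s - s) \<longlonglongrightarrow> 0"
    proof (rule Lim_null_comparison)
      have "\<bar>r n s - s\<bar> \<le> inverse (real (Suc n))" for n
      proof -
        define N where "N = real (Suc n)"
        have "N > 0" by (simp add: N_def)
        then have "of_int \<lfloor>s * N\<rfloor> / N - s = (of_int \<lfloor>s * N\<rfloor> - s * N) / N"
          by (simp add: field_simps)
        moreover have "\<bar>of_int \<lfloor>s * N\<rfloor> - s * N\<bar> / N \<le> 1 / N"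
          using \<open>N > 0\<close> by (intro divide_right_mono) linarith+
        ultimately have "\<bar>of_int \<lfloor>s * N\<rfloor> / N - s\<bar> \<le> inverse N"
          using \<open>N > 0\<close> by (simp add: inverse_eq_divide)
        then show ?thesis by (simp add: r_def N_def)
      qed
      then show "\<forall>\<^sub>F n in sequentially. norm (r n s - s) \<le> inverse (real (Suc n))" by simp
    qed (rule LIMSEQ_inverse_real_of_nat)
    then show ?thesis by (simp add: LIM_zero_iff)
  qed
  show ?thesis
  proof (rule borel_measurable_LIMSEQ_real)
    fix n
    have "(\<lambda>z. h (confine a b (of_int (\<lfloor>snd z * real (Suc n)\<rfloor>) / real (Suc n))) (fst z))
        \<in> borel_measurable (N \<Otimes>\<^sub>M borel)"
    proof (rule measurable_compose_countable[where f = "\<lambda>i z. h (confine a b (of_int i / real (Suc n))) (fst z)"])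
      show "(\<lambda>z. h (confine a b (of_int i / real (Suc n))) (fst z)) \<in> borel_measurable (N \<Otimes>\<^sub>M borel)" for i :: int
        by (rule measurable_compose[OF measurable_fst meas]) (rule confine_in[OF assms(1)])
      show "(\<lambda>z. \<lfloor>snd z * real (Suc n)\<rfloor>) \<in> measurable (N \<Otimes>\<^sub>M borel) (count_space UNIV)"
        by measurable
    qed
    then show "(\<lambda>(\<omega>, s). h (confine a b (r n s)) \<omega>) \<in> borel_measurable (N \<Otimes>\<^sub>M borel)"
      by (simp add: r_def case_prod_beta)
  next
    fix z :: "'a \<times> real" assume "z \<in> space (N \<Otimes>\<^sub>M borel)"
    then obtain \<omega> s where z: "z = (\<omega>, s)" "\<omega> \<in> space N" by (auto simp: space_pair_measure)
    have "(\<lambda>n. confine a b (r n s)) \<longlonglongrightarrow> confine a b s"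
      unfolding confine_def by (intro tendsto_intros r)
    then have "(\<lambda>n. h (confine a b (r n s)) \<omega>) \<longlonglongrightarrow> h (confine a b s) \<omega>"
      by (intro continuous_on_tendsto_compose[OF cont[OF z(2)]] always_eventually allI confine_in assms(1))
    then show "(\<lambda>n. case z of (\<omega>, s) \<Rightarrow> h (confine a b (r n s)) \<omega>) \<longlonglongrightarrow> (case z of (\<omega>, s) \<Rightarrow> h (confine a b s) \<omega>)"
      by (simp add: z)
  qed
qed

lemma borel_measurable_random_time:
  fixes h :: "real \<Rightarrow> 'a \<Rightarrow> real"
  assumes "\<And>s. s \<in> {a..b} \<Longrightarrow> h s \<in> borel_measurable N"
    and "\<And>\<omega>. \<omega> \<in> space N \<Longrightarrow> continuous_on {a..b} (\<lambda>s. h s \<omega>)"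
    and \<tau>: "\<tau> \<in> borel_measurable N" "\<And>\<omega>. \<omega> \<in> space N \<Longrightarrow> \<tau> \<omega> \<in> {a..b}"
  shows "(\<lambda>\<omega>. h (\<tau> \<omega>) \<omega>) \<in> borel_measurable N"
proof (cases "space N = {}")
  case False
  then have "a \<le> b" using \<tau>(2) by force
  have "(\<lambda>\<omega>. (\<omega>, \<tau> \<omega>)) \<in> measurable N (N \<Otimes>\<^sub>M borel)" using \<tau>(1) by measurable
  from measurable_compose[OF this borel_measurable_confined_process[OF \<open>a \<le> b\<close> assms(1,2)]]
  have "(\<lambda>\<omega>. h (confine a b (\<tau> \<omega>)) \<omega>) \<in> borel_measurable N" by simp
  then show ?thesis using confine_id[OF \<tau>(2)] by (simp cong: measurable_cong)
qed (auto simp: measurable_def)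

lemma borel_measurable_path_integral:
  fixes h :: "real \<Rightarrow> 'a \<Rightarrow> real"
  assumes "\<And>s. s \<in> {a..b} \<Longrightarrow> h s \<in> borel_measurable N"
    and cont: "\<And>\<omega>. \<omega> \<in> space N \<Longrightarrow> continuous_on {a..b} (\<lambda>s. h s \<omega>)"
  shows "(\<lambda>\<omega>. integral {a..b} (\<lambda>s. h s \<omega>)) \<in> borel_measurable N"
proof (cases "a \<le> b")
  case True
  have *: "(\<lambda>z. indicat_real {a..b} (snd z) * (case z of (\<omega>, s) \<Rightarrow> h (confine a b s) \<omega>)) \<in> borel_measurable (N \<Otimes>\<^sub>M lborel)"
    using borel_measurable_confined_process[OF True assms]
    by (intro borel_measurable_times measurable_compose[OF measurable_snd]) (auto cong: measurable_cong_sets)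
  have "(\<lambda>\<omega>. LINT s|lborel. indicat_real {a..b} s * h (confine a b s) \<omega>) \<in> borel_measurable N"
    using lborel.borel_measurable_lebesgue_integral[of "\<lambda>\<omega> s. indicat_real {a..b} s * h (confine a b s) \<omega>" N] *
    by (simp add: case_prod_beta)
  moreover have "(LINT s|lborel. indicat_real {a..b} s * h (confine a b s) \<omega>) = integral {a..b} (\<lambda>s. h s \<omega>)"
    if "\<omega> \<in> space N" for \<omega>
  proof -
    have "(LINT s|lborel. indicat_real {a..b} s * h (confine a b s) \<omega>) = (LINT s:{a..b}|lborel. h s \<omega>)"
      unfolding set_lebesgue_integral_def
      by (intro Bochner_Integration.integral_cong) (auto simp: confine_id indicator_def)
    also have "\<dots> = integral {a..b} (\<lambda>s. h s \<omega>)"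
      by (intro set_borel_integral_eq_integral borel_integrable_atLeastAtMost' cont that)
    finally show ?thesis .
  qed
  ultimately show ?thesis by (simp cong: measurable_cong)
qed auto

section \<open>Criteria for convergence of random variables\<close>

lemma tendsto_in_probability_AE:
  assumes "prob_space M" and Y: "\<And>n. Y n \<in> borel_measurable M" and Z: "Z \<in> borel_measurable M"
    and lim: "AE \<omega> in M. (\<lambda>n. Y n \<omega>) \<longlonglongrightarrow> Z \<omega>"
  shows "tendsto_in_probability M Y Z"
  unfolding tendsto_in_probability_def
proof (intro conjI allI impI Y Z)
  interpret prob_space M by fact
  fix \<epsilon> :: real assume "\<epsilon> > 0"
  define A where "A n = {\<omega>\<in>space M. \<epsilon> < \<bar>Y n \<omega> - Z \<omega>\<bar>}" for n
  have A: "A n \<in> sets M" for n unfolding A_def using Y Z by measurable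
  have "(\<lambda>n. LINT \<omega>|M. indicat_real (A n) \<omega>) \<longlonglongrightarrow> (LINT \<omega>|M. 0)"
  proof (rule integral_dominated_convergence[where w = "\<lambda>_. 1"])
    show "AE \<omega> in M. (\<lambda>n. indicat_real (A n) \<omega>) \<longlonglongrightarrow> 0"
      using lim
    proof eventually_elim
      case (elim \<omega>)
      then have "\<forall>\<^sub>F n in sequentially. \<bar>Y n \<omega> - Z \<omega>\<bar> < \<epsilon>"
        using \<open>\<epsilon> > 0\<close> by (auto simp: tendsto_iff dist_real_def)
      then show ?case
        by (intro tendsto_eventually) (auto elim!: eventually_mono simp: A_def indicator_def)
    qed
  qed (use A in \<open>auto simp: indicator_def\<close>)
  then show "(\<lambda>n. measure M {\<omega>\<in>space M. \<epsilon> < \<bar>Y n \<omega> - Z \<omega>\<bar>}) \<longlonglongrightarrow> 0"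
    using A by (simp add: A_def)
qed

text \<open>The sum of the series has finite expectation, so it is finite almost surely, and the
  terms of a convergent series tend to 0. This plays the part of Borel-Cantelli both for the
  quadratic variation and for Levy's construction.\<close>

lemma AE_tendsto_0_of_summable:
  fixes Y :: "nat \<Rightarrow> 'a \<Rightarrow> real"
  assumes int: "\<And>n. integrable M (Y n)" and nonneg: "\<And>n \<omega>. \<omega> \<in> space M \<Longrightarrow> 0 \<le> Y n \<omega>"
    and sum: "summable (\<lambda>n. integral\<^sup>L M (Y n))"
  shows "AE \<omega> in M. (\<lambda>n. Y n \<omega>) \<longlonglongrightarrow> 0"
proof -
  have [measurable]: "Y n \<in> borel_measurable M" for n using int by auto
  have "(\<integral>\<^sup>+\<omega>. (\<Sum>n. ennreal (Y n \<omega>)) \<partial>M) = (\<Sum>n. \<integral>\<^sup>+\<omega>. ennreal (Y n \<omega>) \<partial>M)"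
    by (rule nn_integral_suminf) measurable
  also have "\<dots> = (\<Sum>n. ennreal (integral\<^sup>L M (Y n)))"
    using int nonneg by (intro suminf_cong nn_integral_eq_integral) auto
  also have "\<dots> = ennreal (\<Sum>n. integral\<^sup>L M (Y n))"
    using sum nonneg by (intro suminf_ennreal2) (auto intro: integral_nonneg_AE)
  finally have "(\<integral>\<^sup>+\<omega>. (\<Sum>n. ennreal (Y n \<omega>)) \<partial>M) \<noteq> \<infinity>" by simp
  then have "AE \<omega> in M. (\<Sum>n. ennreal (Y n \<omega>)) \<noteq> \<infinity>"
    by (intro nn_integral_PInf_AE) measurable
  then show ?thesis
  proof (rule AE_mp, intro AE_I2 impI)
    fix \<omega> assume "\<omega> \<in> space M" "(\<Sum>n. ennreal (Y n \<omega>)) \<noteq> \<infinity>"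
    then have "summable (\<lambda>n. Y n \<omega>)"
      using nonneg by (intro summable_suminf_not_top) auto
    then show "(\<lambda>n. Y n \<omega>) \<longlonglongrightarrow> 0" by (rule summable_LIMSEQ_zero)
  qed
qed

section \<open>Quadratic variation of Brownian motion\<close>

text \<open>\<open>brownian_motion\<close> speaks of independent \<sigma>-algebras, while
  expectations of products factor for independent variables. The target spaces are general because
  complex exponentials occur besides real functions.\<close>

lemma (in prob_space) indep_var_of_indep_set:
  assumes ind: "indep_set (sets G) (sets (vimage_algebra (space M) Y borel))" and G: "space G = space M"
    and V: "V \<in> measurable G N" and Y: "Y \<in> borel_measurable M" and g: "g \<in> measurable borel N'"
  shows "indep_var N V N' (\<lambda>\<omega>. g (Y \<omega>))"
  unfolding indep_var_eq
proof (intro conjI)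
  have "sets G \<subseteq> events" using ind by (simp add: indep_sets2_eq)
  then show "random_variable N V" using V G by (auto simp: measurable_def)
  show "random_variable N' (\<lambda>\<omega>. g (Y \<omega>))" by (rule measurable_compose[OF Y g])
  have 1: "sigma_sets (space M) {V -` A \<inter> space M |A. A \<in> sets N} \<subseteq> sets G"
    using measurable_sets[OF V] G by (intro sets.sigma_sets_subset[of _ G, unfolded G]) auto
  have "Y \<in> measurable (vimage_algebra (space M) Y borel) borel"
    by (rule measurable_vimage_algebra1) auto
  from measurable_sets[OF measurable_compose[OF this g]]
  have 2: "sigma_sets (space M) {(\<lambda>\<omega>. g (Y \<omega>)) -` A \<inter> space M |A. A \<in> sets N'}
      \<subseteq> sets (vimage_algebra (space M) Y borel)"
    by (intro sets.sigma_sets_subset[of _ "vimage_algebra (space M) Y borel", unfolded space_vimage_algebra]) auto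
  show "indep_set (sigma_sets (space M) {V -` A \<inter> space M |A. A \<in> sets N})
     (sigma_sets (space M) {(\<lambda>\<omega>. g (Y \<omega>)) -` A \<inter> space M |A. A \<in> sets N'})"
    using ind 1 2 unfolding indep_set_def
    by (elim indep_sets_mono_sets) (auto split: bool.split)
qed

text \<open>The fourth moment serves twice: it gives the variance of a squared increment, and it
  controls the largest dyadic increment in Levy's construction.\<close>

lemma (in prob_space) centered_normal_moments:
  assumes X: "distributed M lborel X (normal_density 0 \<sigma>)" and \<sigma>: "0 < \<sigma>"
  shows "integrable M (\<lambda>\<omega>. (X \<omega>) ^ k)"
    and "expectation X = 0"
    and "expectation (\<lambda>\<omega>. (X \<omega>)\<^sup>2) = \<sigma>\<^sup>2"
    and "expectation (\<lambda>\<omega>. (X \<omega>) ^ 4) = 3 * (\<sigma>\<^sup>2)\<^sup>2"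
proof -
  have E: "expectation (\<lambda>\<omega>. (X \<omega>) ^ k) = (\<integral>x. normal_density 0 \<sigma> x * (x - 0) ^ k \<partial>lborel)" for k
    using distributed_integral[OF X, of "\<lambda>x. x ^ k"] by simp
  show "integrable M (\<lambda>\<omega>. (X \<omega>) ^ k)"
    using distributed_integrable[OF X, of "\<lambda>x. x ^ k"] integrable_normal_moment[OF \<sigma>, of 0 k] by simp
  show "expectation X = 0"
    using E[of 1] integral_normal_moment_odd[OF \<sigma>, of 0 0] by simp
  show "expectation (\<lambda>\<omega>. (X \<omega>)\<^sup>2) = \<sigma>\<^sup>2"
    using E[of 2] integral_normal_moment_even[OF \<sigma>, of 0 1] by (simp add: fact_2)
  have "fact 4 / ((2 / \<sigma>\<^sup>2)\<^sup>2 * fact 2) = 3 * (\<sigma>\<^sup>2)\<^sup>2"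
    using \<sigma> by (simp add: field_simps fact_numeral)
  then show "expectation (\<lambda>\<omega>. (X \<omega>) ^ 4) = 3 * (\<sigma>\<^sup>2)\<^sup>2"
    using E[of 4] integral_normal_moment_even[OF \<sigma>, of 0 2] by simp
qed

locale brownian =
  fixes M :: "'a measure" and T :: real and W :: "real \<Rightarrow> 'a \<Rightarrow> real"
  assumes T_pos: "0 < T" and bm: "brownian_motion M T W"

sublocale brownian \<subseteq> prob_space M
  using bm by (simp add: brownian_motion_def)

context brownian
begin

abbreviation F :: "real \<Rightarrow> 'a measure" where "F \<equiv> natural_filtration M T W"

lemma W_measurable: "t \<in> {0..T} \<Longrightarrow> W t \<in> borel_measurable M"
  using bm by (simp add: brownian_motion_def)

lemma W_continuous: "\<omega> \<in> space M \<Longrightarrow> continuous_on {0..T} (\<lambda>t. W t \<omega>)"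
  using bm by (simp add: brownian_motion_def continuous_paths_def)

lemma F_subset: "sets (F t) \<subseteq> sets M"
  by (rule natural_filtration_least) (auto simp: W_measurable)

lemma F_measurable_M: "V \<in> borel_measurable (F t) \<Longrightarrow> V \<in> borel_measurable M"
  using F_subset[of t] by (auto simp: measurable_def)

lemma F_measurable_mono: "V \<in> borel_measurable (F s) \<Longrightarrow> s \<le> t \<Longrightarrow> V \<in> borel_measurable (F t)"
  using natural_filtration_mono[of s t M T W] by (auto simp: measurable_def)

lemma W_F_measurable: "s \<in> {0..T} \<Longrightarrow> s \<le> t \<Longrightarrow> W s \<in> borel_measurable (F t)"
  by (rule measurable_natural_filtration)

lemma increment_distributed:
  "0 \<le> s \<Longrightarrow> s < t \<Longrightarrow> t \<le> T \<Longrightarrow>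
    distributed M lborel (\<lambda>\<omega>. W t \<omega> - W s \<omega>) (normal_density 0 (sqrt (t - s)))"
  using bm by (simp add: brownian_motion_def)

lemma increment_moments:
  assumes "0 \<le> s" "s < t" "t \<le> T"
  shows "integrable M (\<lambda>\<omega>. (W t \<omega> - W s \<omega>) ^ k)"
    and "expectation (\<lambda>\<omega>. W t \<omega> - W s \<omega>) = 0"
    and "expectation (\<lambda>\<omega>. (W t \<omega> - W s \<omega>)\<^sup>2) = t - s"
    and "expectation (\<lambda>\<omega>. (W t \<omega> - W s \<omega>) ^ 4) = 3 * (t - s)\<^sup>2"
  using centered_normal_moments[OF increment_distributed[OF assms]] assms by simp_all

lemma increment_indep:
  assumes st: "0 \<le> s" "s < t" "t \<le> T" and V: "V \<in> borel_measurable (F s)" and g: "g \<in> borel_measurable borel"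
  shows "indep_var borel V borel (\<lambda>\<omega>. g (W t \<omega> - W s \<omega>))"
proof (rule indep_var_of_indep_set[OF _ _ V _ g])
  show "indep_set (sets (F s)) (sets (vimage_algebra (space M) (\<lambda>\<omega>. W t \<omega> - W s \<omega>) borel))"
    using bm st by (simp add: brownian_motion_def)
  show "(\<lambda>\<omega>. W t \<omega> - W s \<omega>) \<in> borel_measurable M"
    using W_measurable[of s] W_measurable[of t] st by auto
qed simp

lemma expectation_times_increment:
  fixes V :: "'a \<Rightarrow> real" and g :: "real \<Rightarrow> real"
  assumes "0 \<le> s" "s < t" "t \<le> T" "V \<in> borel_measurable (F s)" "g \<in> borel_measurable borel"
    and "integrable M V" "integrable M (\<lambda>\<omega>. g (W t \<omega> - W s \<omega>))"
  shows "expectation (\<lambda>\<omega>. V \<omega> * g (W t \<omega> - W s \<omega>)) = expectation V * expectation (\<lambda>\<omega>. g (W t \<omega> - W s \<omega>))"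
    and "integrable M (\<lambda>\<omega>. V \<omega> * g (W t \<omega> - W s \<omega>))"
  using indep_var_lebesgue_integral[OF increment_indep[OF assms(1-5)] assms(6,7)]
    indep_var_integrable[OF increment_indep[OF assms(1-5)] assms(6,7)] .

definition dW :: "nat \<Rightarrow> nat \<Rightarrow> 'a \<Rightarrow> real" where
  "dW n i \<omega> = W (grid T n (Suc i)) \<omega> - W (grid T n i) \<omega>"

text \<open>The centred squares are orthogonal: each is independent of the past and has mean 0, so
  the cross term vanishes and the variances \<open>3 h^2 - 2 h^2 + h^2 = 2 h^2\<close> add up, with
  \<open>h\<close> the cell length. Measurability with respect to the past is part of the induction
  because independence is applied to the partial sum.\<close>

lemma quadratic_variation_L2:
  assumes "k \<le> 2 ^ n"
  defines "S \<equiv> \<lambda>k \<omega>. \<Sum>i<k. (dW n i \<omega>)\<^sup>2 - T / 2 ^ n"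
  shows "S k \<in> borel_measurable (F (grid T n k)) \<and> integrable M (S k) \<and> integrable M (\<lambda>\<omega>. (S k \<omega>)\<^sup>2) \<and>
    expectation (\<lambda>\<omega>. (S k \<omega>)\<^sup>2) = 2 * real k * (T / 2 ^ n)\<^sup>2"
  using assms(1)
proof (induction k)
  case 0
  then show ?case by (simp add: S_def)
next
  case (Suc k)
  define s t where "s = grid T n k" and "t = grid T n (Suc k)"
  define h where "h = T / 2 ^ n"
  have st: "0 \<le> s" "s < t" "t \<le> T" "t - s = h"
    using grid_in[of T k n] grid_in[of T "Suc k" n] Suc.prems T_pos by (auto simp: s_def t_def grid_Suc h_def)
  define g where "g y = y\<^sup>2 - h" for y :: real
  have [measurable]: "g \<in> borel_measurable borel" unfolding g_def by measurable
  define D where "D \<omega> = g (W t \<omega> - W s \<omega>)" for \<omega>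
  have S: "S (Suc k) = (\<lambda>\<omega>. S k \<omega> + D \<omega>)"
    by (simp add: S_def dW_def D_def g_def s_def t_def h_def)
  have IH: "S k \<in> borel_measurable (F s)" "integrable M (S k)" "integrable M (\<lambda>\<omega>. (S k \<omega>)\<^sup>2)"
    "expectation (\<lambda>\<omega>. (S k \<omega>)\<^sup>2) = 2 * real k * h\<^sup>2"
    using Suc by (auto simp: s_def h_def)
  note mom = increment_moments[OF st(1-3), unfolded st(4)]
  have Dsq: "(\<lambda>\<omega>. (D \<omega>)\<^sup>2) = (\<lambda>\<omega>. (W t \<omega> - W s \<omega>) ^ 4 - 2 * h * (W t \<omega> - W s \<omega>)\<^sup>2 + h\<^sup>2)"
    by (simp add: D_def g_def power2_diff fun_eq_iff algebra_simps power2_eq_square power4_eq_xxxx)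
  have D: "integrable M D" "expectation D = 0" "integrable M (\<lambda>\<omega>. (D \<omega>)\<^sup>2)" "expectation (\<lambda>\<omega>. (D \<omega>)\<^sup>2) = 2 * h\<^sup>2"
  proof -
    show "integrable M D" "integrable M (\<lambda>\<omega>. (D \<omega>)\<^sup>2)"
      unfolding Dsq unfolding D_def g_def using mom(1) by auto
    show "expectation D = 0"
      unfolding D_def g_def using mom(1) mom(3) prob_space by simp
    have "expectation (\<lambda>\<omega>. (D \<omega>)\<^sup>2) = 3 * h\<^sup>2 - 2 * h * h + h\<^sup>2"
      unfolding Dsq using mom(1) mom(3,4) prob_space by simp
    then show "expectation (\<lambda>\<omega>. (D \<omega>)\<^sup>2) = 2 * h\<^sup>2" by (simp add: power2_eq_square)
  qed
  have SD: "integrable M (\<lambda>\<omega>. S k \<omega> * D \<omega>)" "expectation (\<lambda>\<omega>. S k \<omega> * D \<omega>) = 0"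
    using expectation_times_increment[OF st(1-3) IH(1) \<open>g \<in> borel_measurable borel\<close> IH(2) D(1)[unfolded D_def]] D(2)[unfolded D_def]
    by (simp_all add: D_def)
  have sq: "(\<lambda>\<omega>. (S (Suc k) \<omega>)\<^sup>2) = (\<lambda>\<omega>. (S k \<omega>)\<^sup>2 + 2 * (S k \<omega> * D \<omega>) + (D \<omega>)\<^sup>2)"
    unfolding S by (simp add: power2_sum fun_eq_iff)
  have "S k \<in> borel_measurable (F t)"
    by (rule F_measurable_mono[OF IH(1)]) (use st in auto)
  moreover have "D \<in> borel_measurable (F t)"
    unfolding D_def using st by (intro measurable_compose[OF _ \<open>g \<in> borel_measurable borel\<close>] borel_measurable_diff W_F_measurable) auto
  ultimately have "S (Suc k) \<in> borel_measurable (F t)" unfolding S by measurable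
  moreover have "integrable M (S (Suc k))" unfolding S using IH(2) D(1) by simp
  moreover have "integrable M (\<lambda>\<omega>. (S (Suc k) \<omega>)\<^sup>2)"
    unfolding sq using IH(3) D(3) SD(1) by simp
  moreover have "expectation (\<lambda>\<omega>. (S (Suc k) \<omega>)\<^sup>2) = 2 * real k * h\<^sup>2 + 2 * 0 + 2 * h\<^sup>2"
    unfolding sq using IH(3,4) D(3,4) SD by simp
  then have "expectation (\<lambda>\<omega>. (S (Suc k) \<omega>)\<^sup>2) = 2 * real (Suc k) * h\<^sup>2"
    by (simp add: algebra_simps)
  ultimately show ?case by (simp add: t_def h_def)
qed

text \<open>Along the refinements of level \<open>m\<close> the second moment of the error halves at
  each step, hence is summable. The pairs \<open>(m, j)\<close> are countably many, so one null set
  suffices.\<close>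

lemma AE_quadratic_variation:
  "AE \<omega> in M. \<forall>m. \<forall>j\<le>2 ^ m. (\<lambda>n. \<Sum>i<j * 2 ^ (n - m). (dW n i \<omega>)\<^sup>2) \<longlonglongrightarrow> grid T m j"
proof -
  have "AE \<omega> in M. (\<lambda>n. \<Sum>i<j * 2 ^ (n - m). (dW n i \<omega>)\<^sup>2) \<longlonglongrightarrow> grid T m j" if j: "j \<le> 2 ^ m" for m j
  proof -
    define S where "S n \<omega> = (\<Sum>i<j * 2 ^ n. (dW (n + m) i \<omega>)\<^sup>2 - T / 2 ^ (n + m))" for n \<omega>
    have le: "j * 2 ^ n \<le> 2 ^ (n + m)" for n using j by (simp add: power_add)
    note S = quadratic_variation_L2[OF le, folded S_def]
    have ES: "expectation (\<lambda>\<omega>. (S n \<omega>)\<^sup>2) = (2 * real j * (T / 2 ^ m)\<^sup>2) * (1 / 2) ^ n" for n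
      using S[of n] by (simp add: power_add field_simps power2_eq_square)
    have "AE \<omega> in M. (\<lambda>n. (S n \<omega>)\<^sup>2) \<longlonglongrightarrow> 0"
    proof (rule AE_tendsto_0_of_summable)
      show "summable (\<lambda>n. expectation (\<lambda>\<omega>. (S n \<omega>)\<^sup>2))"
        unfolding ES by (intro summable_mult summable_geometric) simp
    qed (use S in auto)
    then show ?thesis
    proof eventually_elim
      case (elim \<omega>)
      then have "(\<lambda>n. sqrt ((S n \<omega>)\<^sup>2)) \<longlonglongrightarrow> sqrt 0" by (intro tendsto_intros)
      then have "(\<lambda>n. S n \<omega>) \<longlonglongrightarrow> 0" by (simp add: tendsto_rabs_zero_iff)
      then have "(\<lambda>n. S n \<omega> + grid T m j) \<longlonglongrightarrow> 0 + grid T m j" by (intro tendsto_intros)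
      also have "(\<lambda>n. S n \<omega> + grid T m j) = (\<lambda>n. \<Sum>i<j * 2 ^ (n + m - m). (dW (n + m) i \<omega>)\<^sup>2)"
        by (simp add: S_def sum_subtractf grid_def power_add)
      finally show ?case by (simp add: LIMSEQ_offset[where k = m])
    qed
  qed
  then show ?thesis by (simp add: AE_all_countable)
qed

end

section \<open>Reflected Brownian motion\<close>

text \<open>Cells are open on the left, as in \<open>simple_value\<close>, so time 0 lies in none of
  them and is excluded.\<close>

lemma grid_cell:
  assumes "0 < T" "t \<in> {0<..T}"
  obtains k where "k < 2 ^ n" "t \<in> {grid T n k<..grid T n (Suc k)}"
    "\<And>i. i < k \<Longrightarrow> grid T n (Suc i) < t" "\<And>i. k < i \<Longrightarrow> t \<le> grid T n i"
proof -
  define k where "k = (LEAST k. t \<le> grid T n (Suc k))"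
  have ex: "t \<le> grid T n (Suc (2 ^ n - 1))" using assms by simp
  have 1: "t \<le> grid T n (Suc k)" unfolding k_def using ex by (rule LeastI)
  have 2: "grid T n (Suc i) < t" if "i < k" for i
    using not_less_Least[of i "\<lambda>k. t \<le> grid T n (Suc k)"] that unfolding k_def by simp
  have "k \<le> 2 ^ n - 1" unfolding k_def using ex by (rule Least_le)
  moreover have "0 < (2::nat) ^ n" by simp
  ultimately have 3: "k < 2 ^ n" by linarith
  have 4: "grid T n k < t"
    using 2[of "k - 1"] assms by (cases k) auto
  show ?thesis
  proof (rule that[OF 3 _ 2])
    show "t \<in> {grid T n k<..grid T n (Suc k)}" using 1 4 by simp
    show "t \<le> grid T n i" if "k < i" for i
      using 1 grid_mono[of T "Suc k" i n] that assms by simp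
  qed
qed

lemma simple_value_grid:
  assumes "0 < T" "t \<in> {0<..T}"
  obtains k where "k < 2 ^ n" "\<bar>grid T n k - t\<bar> \<le> T / 2 ^ n" "simple_value (2 ^ n) (grid T n) \<xi> t \<omega> = \<xi> k \<omega>"
proof -
  obtain k where k: "k < 2 ^ n" "t \<in> {grid T n k<..grid T n (Suc k)}"
    "\<And>i. i < k \<Longrightarrow> grid T n (Suc i) < t" "\<And>i. k < i \<Longrightarrow> t \<le> grid T n i"
    using grid_cell[OF assms] by metis
  have "simple_value (2 ^ n) (grid T n) \<xi> t \<omega> = (\<Sum>i<2 ^ n. if i = k then \<xi> k \<omega> else 0)"
    unfolding simple_value_def
  proof (rule sum.cong)
    fix i
    show "\<xi> i \<omega> * indicator {grid T n i<..grid T n (Suc i)} t = (if i = k then \<xi> k \<omega> else 0)"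
      using k(2) k(3)[of i] k(4)[of i] by (cases i k rule: linorder_cases) (auto simp: indicator_def)
  qed simp
  then show ?thesis using k(1,2) by (intro that[of k]) (auto simp: grid_Suc)
qed

lemma continuous_path_bound:
  fixes h :: "real \<Rightarrow> real"
  assumes "continuous_on {a..b} h"
  obtains B where "0 < B" "\<And>t. t \<in> {a..b} \<Longrightarrow> \<bar>h t\<bar> \<le> B"
proof -
  have "bounded (h ` {a..b})"
    using assms by (intro compact_imp_bounded compact_continuous_image) auto
  then show ?thesis using that by (auto simp: bounded_pos)
qed

lemma tendsto_in_probability_cong:
  assumes "tendsto_in_probability M Y Z" "\<And>n \<omega>. \<omega> \<in> space M \<Longrightarrow> Y n \<omega> = Y' n \<omega>"
  shows "tendsto_in_probability M Y' Z"
proof -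
  have "Y n \<in> borel_measurable M \<longleftrightarrow> Y' n \<in> borel_measurable M" for n
    using assms(2) by (rule measurable_cong)
  moreover have "{\<omega>\<in>space M. \<epsilon> < \<bar>Y n \<omega> - Z \<omega>\<bar>} = {\<omega>\<in>space M. \<epsilon> < \<bar>Y' n \<omega> - Z \<omega>\<bar>}" for n \<epsilon>
    using assms(2) by auto
  ultimately show ?thesis using assms(1) by (simp add: tendsto_in_probability_def)
qed

text \<open>For the Bessel property, \<open>2 * sqrt\<close> of the square of \<open>X\<close> must
  be exchanged for \<open>2 * X\<close>. They agree only at times in \<open>{0..T}\<close> and
  sample points in \<open>space M\<close>, where \<open>X\<close> is nonnegative.\<close>

lemma has_ito_integral_cong:
  assumes ito: "has_ito_integral M F T W H I" and F: "\<And>t. space (F t) = space M"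
    and H: "\<And>t \<omega>. t \<in> {0..T} \<Longrightarrow> \<omega> \<in> space M \<Longrightarrow> H t \<omega> = H' t \<omega>"
    and I: "\<And>t \<omega>. t \<in> {0..T} \<Longrightarrow> \<omega> \<in> space M \<Longrightarrow> I t \<omega> = I' t \<omega>"
  shows "has_ito_integral M F T W H' I'"
  unfolding has_ito_integral_def
proof (intro conjI)
  have adapted: "adapted_process F T Z'" if "adapted_process F T Z"
    "\<And>t \<omega>. t \<in> {0..T} \<Longrightarrow> \<omega> \<in> space M \<Longrightarrow> Z t \<omega> = Z' t \<omega>" for Z Z'
    unfolding adapted_process_def
  proof
    fix t assume t: "t \<in> {0..T}"
    have "Z t \<in> borel_measurable (F t) \<longleftrightarrow> Z' t \<in> borel_measurable (F t)"
      using that(2)[OF t] F by (intro measurable_cong) simp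
    then show "Z' t \<in> borel_measurable (F t)" using that(1) t by (simp add: adapted_process_def)
  qed
  have continuous: "continuous_paths M T Z'" if "continuous_paths M T Z"
    "\<And>t \<omega>. t \<in> {0..T} \<Longrightarrow> \<omega> \<in> space M \<Longrightarrow> Z t \<omega> = Z' t \<omega>" for Z Z'
    unfolding continuous_paths_def
  proof
    fix \<omega> assume \<omega>: "\<omega> \<in> space M"
    then have "continuous_on {0..T} (\<lambda>t. Z t \<omega>)"
      using that(1) by (simp add: continuous_paths_def)
    then show "continuous_on {0..T} (\<lambda>t. Z' t \<omega>)"
      by (rule continuous_on_eq) (rule that(2)[OF _ \<omega>])
  qed
  have base: "adapted_process F T H" "continuous_paths M T H" "adapted_process F T I" "continuous_paths M T I"
    using ito by (simp_all add: has_ito_integral_def)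
  show "adapted_process F T H'" using base(1) H by (rule adapted)
  show "continuous_paths M T H'" using base(2) H by (rule continuous)
  show "adapted_process F T I'" using base(3) I by (rule adapted)
  show "continuous_paths M T I'" using base(4) I by (rule continuous)
  obtain m \<tau> \<xi> where S: "\<forall>n. simple_process M F T (m n) (\<tau> n) (\<xi> n)"
    and 1: "tendsto_in_probability M
      (\<lambda>n \<omega>. LINT t:{0..T}|lborel. (simple_value (m n) (\<tau> n) (\<xi> n) t \<omega> - H t \<omega>)\<^sup>2) (\<lambda>\<omega>. 0)"
    and 2: "tendsto_in_probability M
      (\<lambda>n \<omega>. SUP t\<in>{0..T}. \<bar>simple_integral W (m n) (\<tau> n) (\<xi> n) t \<omega> - I t \<omega>\<bar>) (\<lambda>\<omega>. 0)"
    using ito unfolding has_ito_integral_def by blast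
  have "tendsto_in_probability M
      (\<lambda>n \<omega>. LINT t:{0..T}|lborel. (simple_value (m n) (\<tau> n) (\<xi> n) t \<omega> - H' t \<omega>)\<^sup>2) (\<lambda>\<omega>. 0)"
    by (rule tendsto_in_probability_cong[OF 1]) (auto simp: H intro!: set_lebesgue_integral_cong)
  moreover have "tendsto_in_probability M
      (\<lambda>n \<omega>. SUP t\<in>{0..T}. \<bar>simple_integral W (m n) (\<tau> n) (\<xi> n) t \<omega> - I' t \<omega>\<bar>) (\<lambda>\<omega>. 0)"
    by (rule tendsto_in_probability_cong[OF 2]) (auto simp: I)
  ultimately show "\<exists>m \<tau> \<xi>. (\<forall>n. simple_process M F T (m n) (\<tau> n) (\<xi> n)) \<and>
      tendsto_in_probability M
        (\<lambda>n \<omega>. LINT t:{0..T}|lborel. (simple_value (m n) (\<tau> n) (\<xi> n) t \<omega> - H' t \<omega>)\<^sup>2) (\<lambda>\<omega>. 0) \<and>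
      tendsto_in_probability M
        (\<lambda>n \<omega>. SUP t\<in>{0..T}. \<bar>simple_integral W (m n) (\<tau> n) (\<xi> n) t \<omega> - I' t \<omega>\<bar>) (\<lambda>\<omega>. 0)"
    using S by blast
qed

locale reflected_brownian = brownian +
  fixes x\<^sub>0 :: real
  assumes x0_nonneg: "0 \<le> x\<^sub>0"
begin

text \<open>\<open>W 0\<close> is subtracted because \<open>brownian_motion\<close> makes it vanish
  only almost surely, while both problems demand the initial value at every sample point.\<close>

definition Y :: "real \<Rightarrow> 'a \<Rightarrow> real" where "Y t \<omega> = x\<^sub>0 + (W t \<omega> - W 0 \<omega>)"
definition L :: "real \<Rightarrow> 'a \<Rightarrow> real" where "L t \<omega> = push (\<lambda>s. Y s \<omega>) t"
definition X :: "real \<Rightarrow> 'a \<Rightarrow> real" where "X t \<omega> = Y t \<omega> + L t \<omega>"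

lemma Y_continuous: "\<omega> \<in> space M \<Longrightarrow> continuous_on {0..T} (\<lambda>t. Y t \<omega>)"
  unfolding Y_def by (intro continuous_intros W_continuous)

lemma L_continuous: "\<omega> \<in> space M \<Longrightarrow> continuous_on {0..T} (\<lambda>t. L t \<omega>)"
  unfolding L_def by (rule push_continuous[OF Y_continuous])

lemma X_continuous: "\<omega> \<in> space M \<Longrightarrow> continuous_on {0..T} (\<lambda>t. X t \<omega>)"
  unfolding X_def by (intro continuous_intros Y_continuous L_continuous)

lemma X_0: "X 0 \<omega> = x\<^sub>0"
  using x0_nonneg by (simp add: X_def L_def Y_def push_def running_sup_def)

lemma X_ge_0: "\<omega> \<in> space M \<Longrightarrow> t \<in> {0..T} \<Longrightarrow> 0 \<le> X t \<omega>"
  and X_ge_Y: "\<omega> \<in> space M \<Longrightarrow> t \<in> {0..T} \<Longrightarrow> Y t \<omega> \<le> X t \<omega>"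
  using push_ge[OF Y_continuous, of \<omega> t] by (auto simp: X_def L_def)

lemma Y_F_measurable:
  assumes "s \<in> {0..T}" "s \<le> t"
  shows "Y s \<in> borel_measurable (F t)"
proof -
  have "W s \<in> borel_measurable (F t)" "W 0 \<in> borel_measurable (F t)"
    using assms by (auto intro!: W_F_measurable)
  then show ?thesis unfolding Y_def by measurable
qed

lemma X_F_measurable:
  assumes "s \<in> {0..T}" "s \<le> t"
  shows "X s \<in> borel_measurable (F t)"
proof -
  have "L s \<in> borel_measurable (F s)"
    unfolding L_def push_def
  proof (rule borel_measurable_running_sup)
    show "(\<lambda>\<omega>. max 0 (- Y r \<omega>)) \<in> borel_measurable (F s)" if "r \<in> {0..s}" for r
      using Y_F_measurable[of r s] assms that by auto
    show "continuous_on {0..s} (\<lambda>r. max 0 (- Y r \<omega>))" if "\<omega> \<in> space (F s)" for \<omega>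
      using that assms by (intro push_path[OF Y_continuous]) auto
  qed (use assms in auto)
  then have "L s \<in> borel_measurable (F t)" using F_measurable_mono assms by blast
  then show ?thesis unfolding X_def using Y_F_measurable[OF assms] by measurable
qed

lemma X_measurable: "t \<in> {0..T} \<Longrightarrow> X t \<in> borel_measurable M"
  using F_measurable_M[OF X_F_measurable[of t t]] by simp

lemma AE_reflected_path: "AE \<omega> in M. reflected_path T (\<lambda>t. W t \<omega>) (\<lambda>t. L t \<omega>) (\<lambda>t. X t \<omega>)"
  using AE_quadratic_variation AE_space
proof eventually_elim
  case (elim \<omega>)
  show ?case
  proof
    show "L s \<omega> \<le> L t \<omega>" if "0 \<le> s" "s \<le> t" "t \<le> T" for s t
      unfolding L_def using push_mono[OF Y_continuous] elim that by auto
    show "\<exists>r\<in>{s..t}. X r \<omega> = 0" if "0 \<le> s" "s \<le> t" "t \<le> T" "L s \<omega> < L t \<omega>" for s t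
      using push_growth[OF Y_continuous, of \<omega> s t] elim that unfolding L_def X_def by auto
    show "(\<lambda>n. \<Sum>i<j * 2 ^ (n - m). (W (grid T n (Suc i)) \<omega> - W (grid T n i) \<omega>)\<^sup>2) \<longlonglongrightarrow> grid T m j"
      if "j \<le> 2 ^ m" for m j
      using elim(1) that unfolding dW_def by blast
  qed (use elim T_pos W_continuous L_continuous in \<open>auto simp: X_def Y_def\<close>)
qed

lemma mp_process_X:
  "mp_process L1 x\<^sub>0 X f t \<omega> = f (X t \<omega>) - f x\<^sub>0 - integral {0..t} (\<lambda>s. deriv (deriv f) (X s \<omega>)) / 2"
  by (simp add: mp_process_def L1_def)

lemma C2_X_continuous:
  assumes "f \<in> C2" "\<omega> \<in> space M" "t \<le> T"
  shows "continuous_on {0..t} (\<lambda>t. f (X t \<omega>))" "continuous_on {0..t} (\<lambda>t. deriv f (X t \<omega>))"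
    "continuous_on {0..t} (\<lambda>t. deriv (deriv f) (X t \<omega>))"
proof -
  have X: "continuous_on {0..t} (\<lambda>t. X t \<omega>)"
    using X_continuous[OF assms(2)] by (rule continuous_on_subset) (use assms in auto)
  show "continuous_on {0..t} (\<lambda>t. f (X t \<omega>))"
    by (rule continuous_on_compose2[OF C2_derivs(3)[OF assms(1), of UNIV] X]) simp
  show "continuous_on {0..t} (\<lambda>t. deriv f (X t \<omega>))"
    by (rule continuous_on_compose2[OF C2_derivs(4)[OF assms(1), of UNIV] X]) simp
  show "continuous_on {0..t} (\<lambda>t. deriv (deriv f) (X t \<omega>))"
    by (rule continuous_on_compose2[OF C2_derivs(5)[OF assms(1), of UNIV] X]) simp
qed

lemma mp_process_continuous:
  assumes "f \<in> C2" "\<omega> \<in> space M"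
  shows "continuous_on {0..T} (\<lambda>t. mp_process L1 x\<^sub>0 X f t \<omega>)"
  unfolding mp_process_X
  by (intro continuous_intros C2_X_continuous indefinite_integral_continuous_1 integrable_continuous_real assms) auto

lemma C2_borel_measurable:
  assumes "f \<in> C2"
  shows "f \<in> borel_measurable borel" "deriv f \<in> borel_measurable borel" "deriv (deriv f) \<in> borel_measurable borel"
  using C2_derivs[OF assms] by (auto intro: borel_measurable_continuous_onI)

lemma mp_process_borel_measurable:
  assumes f: "f \<in> C2" and t: "t \<in> {0..T}" and N: "space N = space M"
    and X: "\<And>s. s \<in> {0..t} \<Longrightarrow> X s \<in> borel_measurable N"
  shows "mp_process L1 x\<^sub>0 X f t \<in> borel_measurable N"
proof -
  have "(\<lambda>\<omega>. integral {0..t} (\<lambda>s. deriv (deriv f) (X s \<omega>))) \<in> borel_measurable N"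
    using t f N by (intro borel_measurable_path_integral C2_X_continuous
        measurable_compose[OF X C2_borel_measurable(3)]) auto
  moreover have "(\<lambda>\<omega>. f (X t \<omega>)) \<in> borel_measurable N"
    using t f by (intro measurable_compose[OF X C2_borel_measurable(1)]) auto
  ultimately show ?thesis unfolding mp_process_X[abs_def] by measurable
qed

lemma mp_process_F_measurable:
  "f \<in> C2 \<Longrightarrow> t \<in> {0..T} \<Longrightarrow> mp_process L1 x\<^sub>0 X f t \<in> borel_measurable (F t)"
  by (rule mp_process_borel_measurable) (auto intro: X_F_measurable)

text \<open>Simple processes are bounded by definition, so the integrand is truncated at level \<open>n\<close>.\<close>

definition \<xi> :: "(real \<Rightarrow> real) \<Rightarrow> nat \<Rightarrow> nat \<Rightarrow> 'a \<Rightarrow> real" where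
  "\<xi> f n i \<omega> = confine (- real n) (real n) (deriv f (X (grid T n i) \<omega>))"

lemma \<xi>_F_measurable:
  assumes "f \<in> C2" "i \<le> 2 ^ n"
  shows "\<xi> f n i \<in> borel_measurable (F (grid T n i))"
proof -
  have [measurable]: "(\<lambda>\<omega>. deriv f (X (grid T n i) \<omega>)) \<in> borel_measurable (F (grid T n i))"
    using assms grid_in[of T i n] T_pos
    by (intro measurable_compose[OF X_F_measurable C2_borel_measurable(2)]) auto
  show ?thesis unfolding \<xi>_def confine_def by measurable
qed

text \<open>A continuous path keeps \<open>deriv f\<close> of \<open>X\<close> bounded on
  \<open>{0..T}\<close>, so from some level on, depending on the path, the truncation has no
  effect.\<close>

lemma eventually_\<xi>_eq:
  assumes f: "f \<in> C2" and \<omega>: "\<omega> \<in> space M"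
  shows "\<forall>\<^sub>F n in sequentially. \<forall>i\<le>2 ^ n. \<xi> f n i \<omega> = deriv f (X (grid T n i) \<omega>)"
proof -
  obtain B where B: "0 < B" "\<And>t. t \<in> {0..T} \<Longrightarrow> \<bar>deriv f (X t \<omega>)\<bar> \<le> B"
    using continuous_path_bound[OF C2_X_continuous(2)[OF f \<omega> order_refl]] by metis
  obtain N :: nat where "B \<le> real N" using real_arch_simple by blast
  have "\<forall>i\<le>2 ^ n. \<xi> f n i \<omega> = deriv f (X (grid T n i) \<omega>)" if "N \<le> n" for n
  proof (intro allI impI)
    fix i :: nat assume "i \<le> 2 ^ n"
    then have "\<bar>deriv f (X (grid T n i) \<omega>)\<bar> \<le> B" using B(2) grid_in[of T i n] T_pos by simp
    then show "\<xi> f n i \<omega> = deriv f (X (grid T n i) \<omega>)"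
      unfolding \<xi>_def using \<open>B \<le> real N\<close> that by (intro confine_id) auto
  qed
  then show ?thesis unfolding eventually_sequentially by blast
qed

lemma simple_process_\<xi>:
  assumes "f \<in> C2"
  shows "simple_process (completion M) (usual_filtration M T W) T (2 ^ n) (grid T n) (\<xi> f n)"
  unfolding simple_process_def
proof (intro conjI allI impI)
  fix i :: nat assume "i < 2 ^ n"
  then show "\<xi> f n i \<in> borel_measurable (usual_filtration M T W (grid T n i))"
    by (intro measurable_usual_filtration \<xi>_F_measurable assms) simp
  show "\<exists>C. \<forall>\<omega>\<in>space (completion M). \<bar>\<xi> f n i \<omega>\<bar> \<le> C"
    by (intro exI[of _ "real n"]) (auto simp: \<xi>_def confine_def)
qed (use T_pos in \<open>auto simp: grid_mono\<close>)

text \<open>Away from time 0 the simple process is the truncated integrand at the left end of the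
  cell, so uniform continuity makes the difference small on every path. Joint measurability makes
  the time integral a random variable.\<close>

lemma integrand_convergence:
  assumes f: "f \<in> C2"
  shows "tendsto_in_probability (completion M)
     (\<lambda>n \<omega>. LINT t:{0..T}|lborel. (simple_value (2 ^ n) (grid T n) (\<xi> f n) t \<omega> - deriv f (X t \<omega>))\<^sup>2) (\<lambda>\<omega>. 0)"
proof (rule tendsto_in_probability_AE)
  show "prob_space (completion M)" by (rule prob_space_completion)
  define H where "H t \<omega> = deriv f (X t \<omega>)" for t \<omega>
  fix n
  have \<xi>: "\<xi> f n i \<in> borel_measurable M" if "i < 2 ^ n" for i
    using that by (intro F_measurable_M[OF \<xi>_F_measurable[OF f]]) auto
  have H: "(\<lambda>z. H (confine 0 T (snd z)) (fst z)) \<in> borel_measurable (M \<Otimes>\<^sub>M lborel)"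
    using borel_measurable_confined_process[of 0 T H M] T_pos C2_X_continuous(2)[OF f] unfolding H_def
    by (simp add: case_prod_beta measurable_compose[OF X_measurable C2_borel_measurable(2)[OF f]] cong: measurable_cong_sets)
  have "(\<lambda>z. simple_value (2 ^ n) (grid T n) (\<xi> f n) (snd z) (fst z)) \<in> borel_measurable (M \<Otimes>\<^sub>M lborel)"
    unfolding simple_value_def
    by (intro borel_measurable_sum borel_measurable_times measurable_compose[OF measurable_fst \<xi>]
        measurable_compose[OF measurable_snd]) auto
  with H have "(\<lambda>z. indicat_real {0..T} (snd z) * (simple_value (2 ^ n) (grid T n) (\<xi> f n) (snd z) (fst z) -
      H (confine 0 T (snd z)) (fst z))\<^sup>2) \<in> borel_measurable (M \<Otimes>\<^sub>M lborel)"
    by (intro borel_measurable_times measurable_compose[OF measurable_snd] borel_measurable_power borel_measurable_diff) auto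
  then have "(\<lambda>\<omega>. LINT t|lborel. indicat_real {0..T} t * (simple_value (2 ^ n) (grid T n) (\<xi> f n) t \<omega> -
      H (confine 0 T t) \<omega>)\<^sup>2) \<in> borel_measurable M"
    by (intro lborel.borel_measurable_lebesgue_integral) (simp add: case_prod_beta)
  also have "(\<lambda>\<omega>. LINT t|lborel. indicat_real {0..T} t * (simple_value (2 ^ n) (grid T n) (\<xi> f n) t \<omega> -
      H (confine 0 T t) \<omega>)\<^sup>2) = (\<lambda>\<omega>. LINT t:{0..T}|lborel. (simple_value (2 ^ n) (grid T n) (\<xi> f n) t \<omega> - H t \<omega>)\<^sup>2)"
    unfolding set_lebesgue_integral_def
    by (intro ext Bochner_Integration.integral_cong) (auto simp: confine_id indicator_def)
  finally show "(\<lambda>\<omega>. LINT t:{0..T}|lborel. (simple_value (2 ^ n) (grid T n) (\<xi> f n) t \<omega> - deriv f (X t \<omega>))\<^sup>2)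
      \<in> borel_measurable (completion M)"
    unfolding H_def by (rule measurable_completion)
next
  have "(\<lambda>n. LINT t:{0..T}|lborel. (simple_value (2 ^ n) (grid T n) (\<xi> f n) t \<omega> - deriv f (X t \<omega>))\<^sup>2) \<longlonglongrightarrow> 0"
    if \<omega>: "\<omega> \<in> space M" for \<omega>
  proof (rule tendstoI)
    define D where "D n t = simple_value (2 ^ n) (grid T n) (\<xi> f n) t \<omega> - deriv f (X t \<omega>)" for n t
    fix \<epsilon> :: real assume "\<epsilon> > 0"
    define \<delta> where "\<delta> = sqrt (\<epsilon> / (2 * T))"
    have \<delta>: "\<delta> > 0" "T * \<delta>\<^sup>2 = \<epsilon> / 2" using \<open>\<epsilon> > 0\<close> T_pos by (auto simp: \<delta>_def)
    from eventually_grid_osc[OF T_pos C2_X_continuous(2)[OF f \<omega> order_refl] \<delta>(1)] eventually_\<xi>_eq[OF f \<omega>]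
    show "\<forall>\<^sub>F n in sequentially. dist (LINT t:{0..T}|lborel. (simple_value (2 ^ n) (grid T n) (\<xi> f n) t \<omega> - deriv f (X t \<omega>))\<^sup>2) 0 < \<epsilon>"
    proof eventually_elim
      case (elim n)
      have D: "(D n t)\<^sup>2 \<le> \<delta>\<^sup>2" if t: "t \<in> {0<..T}" for t
      proof -
        obtain k where k: "k < 2 ^ n" "\<bar>grid T n k - t\<bar> \<le> T / 2 ^ n"
          "simple_value (2 ^ n) (grid T n) (\<xi> f n) t \<omega> = \<xi> f n k \<omega>"
          using simple_value_grid[OF T_pos t] by metis
        have "\<bar>D n t\<bar> < \<delta>"
          using elim(1)[rule_format, of "grid T n k" t] elim(2) k t grid_in[of T k n] T_pos by (simp add: D_def)
        then show ?thesis by (simp add: abs_le_square_iff[symmetric])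
      qed
      have "(LINT t:{0..T}|lborel. (D n t)\<^sup>2) \<le> (LINT t:{0..T}|lborel. \<delta>\<^sup>2)"
        unfolding set_lebesgue_integral_def
      proof (rule integral_mono_AE')
        \<comment> \<open>At time 0 the simple process vanishes while the integrand need not; a
          single point is negligible.\<close>
        have "AE t in lborel. t \<noteq> (0::real)" by (rule AE_lborel_singleton)
        then show "AE t in lborel. indicat_real {0..T} t *\<^sub>R (D n t)\<^sup>2 \<le> indicat_real {0..T} t *\<^sub>R \<delta>\<^sup>2"
          by eventually_elim (use D in \<open>auto simp: indicator_def\<close>)
      qed (use T_pos in \<open>auto intro!: integrable_scaleR_left integrable_real_indicator\<close>)
      also have "\<dots> = \<epsilon> / 2" using T_pos \<delta>(2) by (simp add: set_lebesgue_integral_def)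
      finally have "(LINT t:{0..T}|lborel. (D n t)\<^sup>2) \<le> \<epsilon> / 2" .
      moreover have "0 \<le> (LINT t:{0..T}|lborel. (D n t)\<^sup>2)"
        unfolding set_lebesgue_integral_def by (intro Bochner_Integration.integral_nonneg) auto
      ultimately show ?case using \<open>\<epsilon> > 0\<close> by (simp add: D_def)
    qed
  qed
  then show "AE \<omega> in completion M. (\<lambda>n. LINT t:{0..T}|lborel.
      (simple_value (2 ^ n) (grid T n) (\<xi> f n) t \<omega> - deriv f (X t \<omega>))\<^sup>2) \<longlonglongrightarrow> 0"
    by (intro AE_I2) simp
qed simp

lemma integral_convergence:
  assumes f: "f \<in> D_L1"
  shows "tendsto_in_probability (completion M)
     (\<lambda>n \<omega>. SUP t\<in>{0..T}. \<bar>simple_integral W (2 ^ n) (grid T n) (\<xi> f n) t \<omega> - mp_process L1 x\<^sub>0 X f t \<omega>\<bar>) (\<lambda>\<omega>. 0)"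
proof (rule tendsto_in_probability_AE)
  have fC2: "f \<in> C2" and f0: "deriv f 0 = 0" using f by (auto simp: D_L1_def)
  show "prob_space (completion M)" by (rule prob_space_completion)
  define E where "E n t \<omega> = \<bar>simple_integral W (2 ^ n) (grid T n) (\<xi> f n) t \<omega> - mp_process L1 x\<^sub>0 X f t \<omega>\<bar>" for n t \<omega>
  have in_T: "min t (grid T n i) \<in> {0..T}" if "t \<in> {0..T}" for t n i
    using that T_pos by (auto simp: grid_def)
  have E_cont: "continuous_on {0..T} (\<lambda>t. E n t \<omega>)" if "\<omega> \<in> space M" for n \<omega>
    unfolding E_def simple_integral_def
    using in_T by (intro continuous_intros mp_process_continuous[OF fC2 that]
        continuous_on_compose2[OF W_continuous[OF that]]) auto
  {
    fix n
    have "E n t \<in> borel_measurable M" if t: "t \<in> {0..T}" for t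
    proof -
      have 1: "W (min t (grid T n i)) \<in> borel_measurable M" for i by (intro W_measurable in_T t)
      have 2: "\<xi> f n i \<in> borel_measurable M" if "i < 2 ^ n" for i
        using that by (intro F_measurable_M[OF \<xi>_F_measurable[OF fC2]]) auto
      have 3: "mp_process L1 x\<^sub>0 X f t \<in> borel_measurable M"
        by (intro F_measurable_M[OF mp_process_F_measurable[OF fC2 t]])
      show ?thesis
        unfolding E_def simple_integral_def
        by (intro borel_measurable_abs borel_measurable_diff borel_measurable_sum borel_measurable_times 1 2 3) auto
    qed
    then have "(\<lambda>\<omega>. running_sup (\<lambda>t. E n t \<omega>) T) \<in> borel_measurable M"
      using T_pos E_cont by (intro borel_measurable_running_sup) auto
    then show "(\<lambda>\<omega>. SUP t\<in>{0..T}. \<bar>simple_integral W (2 ^ n) (grid T n) (\<xi> f n) t \<omega> - mp_process L1 x\<^sub>0 X f t \<omega>\<bar>)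
        \<in> borel_measurable (completion M)"
      unfolding running_sup_def E_def by (rule measurable_completion)
  }
  have "AE \<omega> in M. (\<lambda>n. SUP t\<in>{0..T}. E n t \<omega>) \<longlonglongrightarrow> 0"
    using AE_reflected_path AE_space
  proof eventually_elim
    case (elim \<omega>)
    interpret reflected_path T "\<lambda>t. W t \<omega>" "\<lambda>t. L t \<omega>" "\<lambda>t. X t \<omega>" by (rule elim(1))
    show ?case
    proof (rule tendstoI)
      fix \<epsilon> :: real assume "\<epsilon> > 0"
      from ito_uniform[OF fC2 f0 this] eventually_\<xi>_eq[OF fC2 elim(2)]
      show "\<forall>\<^sub>F n in sequentially. dist (SUP t\<in>{0..T}. E n t \<omega>) 0 < \<epsilon>"
      proof eventually_elim
        case (elim n)
        have E: "E n t \<omega> < \<epsilon>" if "t \<in> {0..T}" for t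
          using elim that unfolding E_def simple_integral_def mp_process_X X_0 by simp
        \<comment> \<open>The supremum is attained, so the strict bound at every time passes to
          it.\<close>
        obtain r where "r \<in> {0..T}" "running_sup (\<lambda>t. E n t \<omega>) T = E n r \<omega>"
          using running_sup_attained[OF E_cont[OF \<open>\<omega> \<in> space M\<close>]] T_pos by (metis less_imp_le)
        with E[of r] show ?case by (simp add: running_sup_def E_def)
      qed
    qed
  qed
  then show "AE \<omega> in completion M. (\<lambda>n. SUP t\<in>{0..T}.
      \<bar>simple_integral W (2 ^ n) (grid T n) (\<xi> f n) t \<omega> - mp_process L1 x\<^sub>0 X f t \<omega>\<bar>) \<longlonglongrightarrow> 0"
    unfolding E_def by (rule AE_completion)
qed simp

lemma ito_X:
  assumes "f \<in> D_L1"
  shows "has_ito_integral (completion M) (usual_filtration M T W) T W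
     (\<lambda>t \<omega>. deriv f (X t \<omega>)) (mp_process L1 x\<^sub>0 X f)"
  unfolding has_ito_integral_def
proof (intro conjI)
  have f: "f \<in> C2" using assms by (simp add: D_L1_def)
  show "adapted_process (usual_filtration M T W) T (\<lambda>t \<omega>. deriv f (X t \<omega>))"
    unfolding adapted_process_def
    by (intro ballI measurable_usual_filtration measurable_compose[OF X_F_measurable C2_borel_measurable(2)[OF f]]) auto
  show "adapted_process (usual_filtration M T W) T (mp_process L1 x\<^sub>0 X f)"
    unfolding adapted_process_def
    by (intro ballI measurable_usual_filtration mp_process_F_measurable f)
  show "continuous_paths (completion M) T (\<lambda>t \<omega>. deriv f (X t \<omega>))"
    "continuous_paths (completion M) T (mp_process L1 x\<^sub>0 X f)"
    using C2_X_continuous(2)[OF f] mp_process_continuous[OF f] by (auto simp: continuous_paths_def)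
  show "\<exists>m \<tau> \<xi>. (\<forall>n. simple_process (completion M) (usual_filtration M T W) T (m n) (\<tau> n) (\<xi> n)) \<and>
      tendsto_in_probability (completion M)
        (\<lambda>n \<omega>. LINT t:{0..T}|lborel. (simple_value (m n) (\<tau> n) (\<xi> n) t \<omega> - deriv f (X t \<omega>))\<^sup>2) (\<lambda>\<omega>. 0) \<and>
      tendsto_in_probability (completion M)
        (\<lambda>n \<omega>. SUP t\<in>{0..T}. \<bar>simple_integral W (m n) (\<tau> n) (\<xi> n) t \<omega> - mp_process L1 x\<^sub>0 X f t \<omega>\<bar>) (\<lambda>\<omega>. 0)"
    using simple_process_\<xi>[OF f] integrand_convergence[OF f] integral_convergence[OF assms] by blast
qed

lemma X_adapted: "adapted_process (usual_filtration M T W) T X"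
  unfolding adapted_process_def
  by (intro ballI measurable_usual_filtration X_F_measurable) auto

lemma strong_martingale_problem_X: "solves_strong_martingale_problem M T D_L1 L1 W x\<^sub>0 X"
  using bm X_adapted X_continuous X_0 ito_X
  by (simp add: solves_strong_martingale_problem_def continuous_paths_def)

lemma square_D_L1:
  "(\<lambda>x::real. x\<^sup>2) \<in> D_L1" "deriv (\<lambda>x::real. x\<^sup>2) = (\<lambda>x. 2 * x)" "L1 (\<lambda>x. x\<^sup>2) = (\<lambda>x. 1)"
proof -
  have 1: "((\<lambda>x. x\<^sup>2) has_real_derivative 2 * x) (at x)" for x :: real
    by (auto intro!: derivative_eq_intros)
  have 2: "((\<lambda>x. 2 * x) has_real_derivative 2) (at x)" for x :: real
    by (auto intro!: derivative_eq_intros)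
  show d1: "deriv (\<lambda>x::real. x\<^sup>2) = (\<lambda>x. 2 * x)" using DERIV_imp_deriv[OF 1] by auto
  have d2: "deriv (\<lambda>x::real. 2 * x) = (\<lambda>x. 2)" using DERIV_imp_deriv[OF 2] by auto
  show "L1 (\<lambda>x. x\<^sup>2) = (\<lambda>x. 1)" by (simp add: fun_eq_iff L1_def d1 d2)
  show "(\<lambda>x::real. x\<^sup>2) \<in> D_L1"
    using exI[where P = "\<lambda>D. (_ has_real_derivative D) _", OF 1] exI[where P = "\<lambda>D. (_ has_real_derivative D) _", OF 2]
    by (simp add: D_L1_def C2_def d1 d2 field_differentiable_def)
qed

lemma bes1_X: "bes1 M T W x\<^sub>0 X"
  unfolding bes1_def besq1_def
proof (intro conjI ballI)
  show "adapted_process (usual_filtration M T W) T (\<lambda>t \<omega>. (X t \<omega>)\<^sup>2)"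
    using X_adapted by (auto simp: adapted_process_def)
  show "continuous_paths M T (\<lambda>t \<omega>. (X t \<omega>)\<^sup>2)"
    using X_continuous by (auto simp: continuous_paths_def intro!: continuous_intros)
  have "has_ito_integral (completion M) (usual_filtration M T W) T W
      (\<lambda>t \<omega>. deriv (\<lambda>x. x\<^sup>2) (X t \<omega>)) (mp_process L1 x\<^sub>0 X (\<lambda>x. x\<^sup>2))"
    by (rule ito_X) (rule square_D_L1)
  then show "has_ito_integral (completion M) (usual_filtration M T W) T W
      (\<lambda>t \<omega>. 2 * sqrt \<bar>(X t \<omega>)\<^sup>2\<bar>) (\<lambda>t \<omega>. (X t \<omega>)\<^sup>2 - x\<^sub>0\<^sup>2 - t)"
    by (rule has_ito_integral_cong) (auto simp: square_D_L1 mp_process_def X_ge_0)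
qed (use bm X_ge_0 X_0 in auto)

end

section \<open>Discrete stochastic integrals\<close>

text \<open>Truncation at height \<open>R\<close> costs at most \<open>K / R\<close> uniformly in \<open>n\<close>.\<close>

lemma (in prob_space) expectation_tendsto_of_L2_bounded:
  fixes Y :: "nat \<Rightarrow> 'a \<Rightarrow> real"
  assumes meas: "\<And>n. Y n \<in> borel_measurable M" "Z \<in> borel_measurable M"
    and int: "\<And>n. integrable M (\<lambda>\<omega>. (Y n \<omega>)\<^sup>2)" and K: "\<And>n. expectation (\<lambda>\<omega>. (Y n \<omega>)\<^sup>2) \<le> K"
    and lim: "AE \<omega> in M. (\<lambda>n. Y n \<omega>) \<longlonglongrightarrow> Z \<omega>" and B: "\<And>\<omega>. \<omega> \<in> space M \<Longrightarrow> \<bar>Z \<omega>\<bar> \<le> B"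
  shows "(\<lambda>n. expectation (Y n)) \<longlonglongrightarrow> expectation Z"
proof (rule tendstoI)
  fix \<epsilon> :: real assume "\<epsilon> > 0"
  have "K \<ge> 0" using K[of 0] by (rule order_trans[rotated]) simp
  \<comment> \<open>\<open>R\<close> is at least the bound on \<open>Z\<close>, so truncation does
    not change the limit, and large enough that \<open>K / R\<close> is below
    \<open>\<epsilon> / 2\<close>.\<close>
  define R where "R = \<bar>B\<bar> + 2 * (K + 1) / \<epsilon>"
  have R: "R > 0" "B \<le> R" "K / R < \<epsilon> / 2"
  proof -
    have "2 * (K + 1) / \<epsilon> > 0" using \<open>K \<ge> 0\<close> \<open>\<epsilon> > 0\<close> by simp
    then show "R > 0" "B \<le> R" unfolding R_def by linarith+
    have "2 * (K + 1) / \<epsilon> \<le> R" by (simp add: R_def)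
    then have "2 * (K + 1) \<le> R * \<epsilon>" using \<open>\<epsilon> > 0\<close> by (simp add: field_simps)
    then show "K / R < \<epsilon> / 2" using \<open>R > 0\<close> by (simp add: field_simps)
  qed
  define \<phi> where "\<phi> = confine (- R) R"
  have [measurable]: "\<phi> \<in> borel_measurable borel" unfolding \<phi>_def confine_def by measurable
  have \<phi>_bound: "\<bar>\<phi> y\<bar> \<le> R" for y using R(1) by (auto simp: \<phi>_def confine_def)
  have \<phi>_close: "\<bar>y - \<phi> y\<bar> \<le> y\<^sup>2 / R" for y
  proof (cases "\<bar>y\<bar> \<le> R")
    case True
    then have "\<phi> y = y" unfolding \<phi>_def by (intro confine_id) auto
    then show ?thesis using R(1) by simp
  next
    case False
    then have "\<bar>y - \<phi> y\<bar> \<le> \<bar>y\<bar>" using R(1) by (auto simp: \<phi>_def confine_def)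
    also have "\<bar>y\<bar> * R \<le> \<bar>y\<bar> * \<bar>y\<bar>" using False by (intro mult_left_mono) auto
    then have "\<bar>y\<bar> \<le> y\<^sup>2 / R" using R(1) by (simp add: field_simps power2_eq_square)
    finally show ?thesis .
  qed
  have Yint: "integrable M (Y n)" for n
    using square_integrable_imp_integrable[OF meas(1) int] .
  have \<phi>int: "integrable M (\<lambda>\<omega>. \<phi> (Y n \<omega>))" for n
    using \<phi>_bound meas by (intro integrable_const_bound[where B = R]) auto
  have trunc: "\<bar>expectation (Y n) - expectation (\<lambda>\<omega>. \<phi> (Y n \<omega>))\<bar> \<le> K / R" for n
  proof -
    have "\<bar>expectation (Y n) - expectation (\<lambda>\<omega>. \<phi> (Y n \<omega>))\<bar> = \<bar>expectation (\<lambda>\<omega>. Y n \<omega> - \<phi> (Y n \<omega>))\<bar>"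
      using Yint \<phi>int by simp
    also have "\<dots> \<le> expectation (\<lambda>\<omega>. \<bar>Y n \<omega> - \<phi> (Y n \<omega>)\<bar>)" by (rule integral_abs_bound)
    also have "\<dots> \<le> expectation (\<lambda>\<omega>. (Y n \<omega>)\<^sup>2 / R)"
      using Yint \<phi>int int \<phi>_close by (intro integral_mono) auto
    also have "\<dots> \<le> K / R" using K R(1) by (simp add: divide_right_mono)
    finally show ?thesis .
  qed
  have "(\<lambda>n. expectation (\<lambda>\<omega>. \<phi> (Y n \<omega>))) \<longlonglongrightarrow> expectation Z"
  proof (rule integral_dominated_convergence[where w = "\<lambda>_. R"])
    show "AE \<omega> in M. (\<lambda>n. \<phi> (Y n \<omega>)) \<longlonglongrightarrow> Z \<omega>"
      using lim AE_space
    proof eventually_elim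
      case (elim \<omega>)
      have "(\<lambda>n. \<phi> (Y n \<omega>)) \<longlonglongrightarrow> \<phi> (Z \<omega>)"
        unfolding \<phi>_def confine_def by (intro tendsto_intros elim)
      moreover have "\<phi> (Z \<omega>) = Z \<omega>"
        unfolding \<phi>_def using B[OF elim(2)] R(2) by (intro confine_id) auto
      ultimately show ?case by simp
    qed
  qed (use meas \<phi>_bound in auto)
  then have "\<forall>\<^sub>F n in sequentially. \<bar>expectation (\<lambda>\<omega>. \<phi> (Y n \<omega>)) - expectation Z\<bar> < \<epsilon> / 2"
    using tendstoD[where e = "\<epsilon> / 2"] \<open>\<epsilon> > 0\<close> by (fastforce simp: dist_real_def)
  then show "\<forall>\<^sub>F n in sequentially. dist (expectation (Y n)) (expectation Z) < \<epsilon>"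
  proof eventually_elim
    case (elim n)
    then show ?case using trunc[of n] R(3) unfolding dist_real_def by linarith
  qed
qed

context brownian
begin

context
  fixes n :: nat and c :: "nat \<Rightarrow> 'a \<Rightarrow> real" and C :: real
  assumes c_F: "\<And>i. i < 2 ^ n \<Longrightarrow> c i \<in> borel_measurable (F (grid T n i))"
    and c_bound: "\<And>i \<omega>. i < 2 ^ n \<Longrightarrow> \<omega> \<in> space M \<Longrightarrow> \<bar>c i \<omega>\<bar> \<le> C"
begin

text \<open>Half of the Ito isometry. The coefficient of a cell is known at its left end, so the
  cross term with the new increment has mean 0, and its square is at most \<open>C^2\<close>. The
  minimum with \<open>t\<close> cuts the cell containing \<open>t\<close>; cells beyond
  \<open>t\<close> add nothing.\<close>

lemma simple_integral_L2:
  assumes t: "t \<in> {0..T}" and "k \<le> 2 ^ n"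
  defines "S \<equiv> \<lambda>k. simple_integral W k (grid T n) c t"
  shows "S k \<in> borel_measurable (F (min t (grid T n k))) \<and> integrable M (\<lambda>\<omega>. (S k \<omega>)\<^sup>2) \<and>
    expectation (\<lambda>\<omega>. (S k \<omega>)\<^sup>2) \<le> C\<^sup>2 * min t (grid T n k)"
  using assms(2)
proof (induction k)
  case 0
  then show ?case using t by (simp add: S_def simple_integral_def[abs_def])
next
  case (Suc k)
  define u v where "u = grid T n k" and "v = min t (grid T n (Suc k))"
  have k: "k < 2 ^ n" using Suc.prems by simp
  have uv: "0 \<le> u" "u \<le> grid T n (Suc k)" "v \<le> T"
    using grid_in[of T k n] k t T_pos by (auto simp: u_def v_def grid_Suc)
  have S: "S (Suc k) = (\<lambda>\<omega>. S k \<omega> + c k \<omega> * (W v \<omega> - W (min t u) \<omega>))"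
    by (simp add: S_def simple_integral_def[abs_def] u_def v_def)
  show ?case
  proof (cases "u < t")
    case False
    then have "v = min t u" using uv by (auto simp: v_def)
    then have "S (Suc k) = S k" unfolding S by simp
    then show ?thesis using Suc \<open>v = min t u\<close> by (simp add: u_def v_def)
  next
    case True
    then have mu: "min t u = u" "u < v" using uv T_pos by (auto simp: v_def u_def grid_Suc)
    have IH: "S k \<in> borel_measurable (F u)" "integrable M (\<lambda>\<omega>. (S k \<omega>)\<^sup>2)" "expectation (\<lambda>\<omega>. (S k \<omega>)\<^sup>2) \<le> C\<^sup>2 * u"
      using Suc mu by (auto simp: u_def)
    have ck: "c k \<in> borel_measurable (F u)" "\<And>\<omega>. \<omega> \<in> space M \<Longrightarrow> \<bar>c k \<omega>\<bar> \<le> C"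
      using c_F[OF k] c_bound[OF k] by (auto simp: u_def)
    note [measurable] = F_measurable_M[OF IH(1)] F_measurable_M[OF ck(1)]
    note mom = increment_moments[OF uv(1) mu(2) uv(3)]
    define D where "D \<omega> = W v \<omega> - W u \<omega>" for \<omega>
    have Sk: "integrable M (S k)"
      by (rule square_integrable_imp_integrable[OF _ IH(2)]) measurable
    have V: "integrable M (\<lambda>\<omega>. c k \<omega> * S k \<omega>)"
    proof (rule Bochner_Integration.integrable_bound[where f = "\<lambda>\<omega>. C * S k \<omega>"])
      have "\<bar>c k \<omega>\<bar> \<le> \<bar>C\<bar>" if "\<omega> \<in> space M" for \<omega>
        using ck(2)[OF that] by linarith
      then show "AE \<omega> in M. norm (c k \<omega> * S k \<omega>) \<le> norm (C * S k \<omega>)"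
        unfolding real_norm_def abs_mult by (intro AE_I2 mult_right_mono) auto
    qed (use Sk in auto)
    have 1: "integrable M (\<lambda>\<omega>. (c k \<omega> * S k \<omega>) * D \<omega>)" "expectation (\<lambda>\<omega>. (c k \<omega> * S k \<omega>) * D \<omega>) = 0"
      using expectation_times_increment[OF uv(1) mu(2) uv(3) borel_measurable_times[OF ck(1) IH(1)], of "\<lambda>x. x"]
        V mom(1)[of 1] mom(2) by (simp_all add: D_def)
    have c2: "integrable M (\<lambda>\<omega>. (c k \<omega>)\<^sup>2)" "expectation (\<lambda>\<omega>. (c k \<omega>)\<^sup>2) \<le> C\<^sup>2"
    proof -
      have b: "(c k \<omega>)\<^sup>2 \<le> C\<^sup>2" if "\<omega> \<in> space M" for \<omega>
        using power_mono[OF ck(2)[OF that], of 2] by simp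
      show i: "integrable M (\<lambda>\<omega>. (c k \<omega>)\<^sup>2)"
        using b by (intro integrable_const_bound[where B = "C\<^sup>2"] AE_I2) auto
      have "expectation (\<lambda>\<omega>. (c k \<omega>)\<^sup>2) \<le> expectation (\<lambda>\<omega>. C\<^sup>2)"
        using b i by (intro integral_mono) auto
      then show "expectation (\<lambda>\<omega>. (c k \<omega>)\<^sup>2) \<le> C\<^sup>2" by (simp add: prob_space)
    qed
    have 2: "integrable M (\<lambda>\<omega>. (c k \<omega>)\<^sup>2 * (D \<omega>)\<^sup>2)"
      "expectation (\<lambda>\<omega>. (c k \<omega>)\<^sup>2 * (D \<omega>)\<^sup>2) = expectation (\<lambda>\<omega>. (c k \<omega>)\<^sup>2) * (v - u)"
      using expectation_times_increment[OF uv(1) mu(2) uv(3) borel_measurable_power[OF ck(1), of 2], of "\<lambda>x. x\<^sup>2"]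
        c2(1) mom(1)[of 2] mom(3) by (simp_all add: D_def)
    have sq: "(\<lambda>\<omega>. (S (Suc k) \<omega>)\<^sup>2) = (\<lambda>\<omega>. (S k \<omega>)\<^sup>2 + 2 * ((c k \<omega> * S k \<omega>) * D \<omega>) + (c k \<omega>)\<^sup>2 * (D \<omega>)\<^sup>2)"
      unfolding S mu D_def by (simp add: power2_sum fun_eq_iff power_mult_distrib)
    have "integrable M (\<lambda>\<omega>. (S (Suc k) \<omega>)\<^sup>2)" unfolding sq using IH(2) 1(1) 2(1) by simp
    moreover have "expectation (\<lambda>\<omega>. (S (Suc k) \<omega>)\<^sup>2) = expectation (\<lambda>\<omega>. (S k \<omega>)\<^sup>2) + expectation (\<lambda>\<omega>. (c k \<omega>)\<^sup>2) * (v - u)"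
      unfolding sq using IH(2) 1 2 by simp
    then have "expectation (\<lambda>\<omega>. (S (Suc k) \<omega>)\<^sup>2) \<le> C\<^sup>2 * u + C\<^sup>2 * (v - u)"
      using IH(3) c2(2) mu by (simp add: add_mono mult_right_mono)
    then have "expectation (\<lambda>\<omega>. (S (Suc k) \<omega>)\<^sup>2) \<le> C\<^sup>2 * v" by (simp add: algebra_simps)
    moreover have "S (Suc k) \<in> borel_measurable (F v)"
    proof -
      have "S k \<in> borel_measurable (F v)" "c k \<in> borel_measurable (F v)"
        using F_measurable_mono[OF IH(1)] F_measurable_mono[OF ck(1)] mu by auto
      moreover have "W v \<in> borel_measurable (F v)" "W u \<in> borel_measurable (F v)"
        using uv mu by (auto intro!: W_F_measurable)
      ultimately show ?thesis unfolding S mu by measurable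
    qed
    ultimately show ?thesis by (simp add: v_def)
  qed
qed

text \<open>Each cell is cut to its part from \<open>u\<close> to \<open>v\<close> after
  \<open>s\<close> and before \<open>t\<close>. The event \<open>A\<close> and the coefficient are
  both known at \<open>u\<close>, so their product is independent of the centred increment over the
  remaining piece.\<close>

lemma simple_integral_martingale:
  assumes st: "0 \<le> s" "s \<le> t" "t \<le> T" and A: "A \<in> sets (F s)"
  shows "expectation (\<lambda>\<omega>. indicat_real A \<omega> * (simple_integral W (2 ^ n) (grid T n) c t \<omega> -
    simple_integral W (2 ^ n) (grid T n) c s \<omega>)) = 0"
proof -
  define I where "I r i \<omega> = W (min r (grid T n (Suc i))) \<omega> - W (min r (grid T n i)) \<omega>" for r i \<omega>
  have summand: "integrable M (\<lambda>\<omega>. indicat_real A \<omega> * c i \<omega> * (I t i \<omega> - I s i \<omega>)) \<and>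
      expectation (\<lambda>\<omega>. indicat_real A \<omega> * c i \<omega> * (I t i \<omega> - I s i \<omega>)) = 0" if i: "i < 2 ^ n" for i
  proof -
    define u v where "u = max s (grid T n i)" and "v = min t (grid T n (Suc i))"
    have G: "grid T n i < grid T n (Suc i)" "0 \<le> grid T n i"
      using T_pos by (auto simp: grid_Suc) (simp add: grid_def)
    show ?thesis
    proof (cases "u < v")
      case False
      then have "I t i \<omega> = I s i \<omega>" for \<omega>
        using st G unfolding I_def u_def v_def by (auto simp: min_def max_def split: if_splits)
      then show ?thesis by simp
    next
      case True
      then have I: "I t i \<omega> - I s i \<omega> = W v \<omega> - W u \<omega>" for \<omega>
        using st G unfolding I_def u_def v_def by (auto simp: min_def max_def split: if_splits)
      have uv: "0 \<le> u" "v \<le> T" using st by (auto simp: u_def v_def)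
      have [measurable]: "c i \<in> borel_measurable (F u)"
        by (rule F_measurable_mono[OF c_F[OF i]]) (simp add: u_def)
      have [measurable]: "A \<in> sets (F u)"
        using A natural_filtration_mono[of s u M T W] by (auto simp: u_def)
      have V: "(\<lambda>\<omega>. indicat_real A \<omega> * c i \<omega>) \<in> borel_measurable (F u)" by measurable
      have "integrable M (\<lambda>\<omega>. indicat_real A \<omega> * c i \<omega>)"
        using c_bound[OF i] F_measurable_M[OF V]
        by (intro integrable_const_bound[where B = "\<bar>C\<bar>"] AE_I2) (auto simp: indicator_def intro: order_trans[OF _ abs_ge_self])
      from expectation_times_increment[OF uv(1) True uv(2) V, of "\<lambda>x. x"] this
        increment_moments(1)[OF uv(1) True uv(2), of 1] increment_moments(2)[OF uv(1) True uv(2)]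
      show ?thesis unfolding I by simp
    qed
  qed
  have "(\<lambda>\<omega>. indicat_real A \<omega> * (simple_integral W (2 ^ n) (grid T n) c t \<omega> -
    simple_integral W (2 ^ n) (grid T n) c s \<omega>)) = (\<lambda>\<omega>. \<Sum>i<2 ^ n. indicat_real A \<omega> * c i \<omega> * (I t i \<omega> - I s i \<omega>))"
    by (simp add: simple_integral_def I_def fun_eq_iff sum_distrib_left right_diff_distrib mult.assoc flip: sum_subtractf)
  then show ?thesis using summand by (simp add: Bochner_Integration.integral_sum)
qed

end

end

section \<open>The martingale problem for reflected Brownian motion\<close>

context reflected_brownian
begin

abbreviation FX :: "real \<Rightarrow> 'a measure" where "FX \<equiv> natural_filtration M T X"

text \<open>The martingale property is demanded for the filtration of \<open>X\<close>, while
  increments are known to be independent of the past of \<open>W\<close>. This inclusion transfers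
  it.\<close>

lemma FX_subset_F: "sets (FX t) \<subseteq> sets (F t)"
  by (rule natural_filtration_least) (auto intro: X_F_measurable)

lemma subalgebra_FX: "subalgebra M (FX t)"
  using FX_subset_F[of t] F_subset[of t] by (auto simp: subalgebra_def)

text \<open>Inserting \<open>T\<close> caps the hitting time and gives exactly \<open>T\<close> when
  the level is not reached, as localization on the closed interval requires.\<close>

definition hit :: "nat \<Rightarrow> 'a \<Rightarrow> real" where
  "hit N \<omega> = Inf (insert T {t\<in>{0..T}. real N \<le> \<bar>X t \<omega>\<bar>})"

lemma hit_in: "hit N \<omega> \<in> {0..T}"
  and hit_le: "t \<in> {0..T} \<Longrightarrow> real N \<le> \<bar>X t \<omega>\<bar> \<Longrightarrow> hit N \<omega> \<le> t"
proof -
  have bdd: "bdd_below (insert T {t\<in>{0..T}. real N \<le> \<bar>X t \<omega>\<bar>})" by (auto intro: bdd_belowI[of _ 0])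
  show "hit N \<omega> \<in> {0..T}"
    unfolding hit_def using T_pos by (auto intro!: cInf_greatest cInf_lower bdd)
  show "hit N \<omega> \<le> t" if "t \<in> {0..T}" "real N \<le> \<bar>X t \<omega>\<bar>"
    unfolding hit_def using that by (intro cInf_lower bdd) auto
qed

lemma X_before_hit: "t \<in> {0..T} \<Longrightarrow> t < hit N \<omega> \<Longrightarrow> \<bar>X t \<omega>\<bar> < real N"
  using hit_le[of t N \<omega>] by force

lemma X_at_hit:
  assumes "\<omega> \<in> space M" "hit N \<omega> < T"
  shows "real N \<le> \<bar>X (hit N \<omega>) \<omega>\<bar>"
proof -
  define K where "K = {t\<in>{0..T}. real N \<le> \<bar>X t \<omega>\<bar>}"
  have "closed K"
    unfolding K_def using X_continuous[OF assms(1)]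
    by (intro continuous_on_closed_Collect_le continuous_intros) auto
  moreover have "K \<noteq> {}" using assms(2) unfolding hit_def K_def[symmetric] by auto
  moreover have "bdd_below K" by (auto simp: K_def intro: bdd_belowI[of _ 0])
  ultimately have "Inf K \<in> K" by (intro closed_contains_Inf) auto
  moreover have "Inf (insert T K) = min T (Inf K)"
    using \<open>K \<noteq> {}\<close> \<open>bdd_below K\<close> by (simp add: cInf_insert inf_min)
  ultimately show ?thesis
    using assms(2) unfolding hit_def K_def[symmetric] by (auto simp: min_def K_def split: if_splits)
qed

text \<open>The set of times with \<open>\<bar>X\<bar>\<close> at least \<open>N\<close> is closed,
  so hitting by time \<open>t < T\<close> means that the running supremum up to \<open>t\<close> is
  at least \<open>N\<close>. No right-continuity of the filtration is involved. Negative times and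
  times from \<open>T\<close> on are decided by the range of \<open>hit\<close>.\<close>

lemma stopping_time_hit: "stopping_time FX (hit N)"
proof
  fix t :: real
  consider "t < 0" | "T \<le> t" | "0 \<le> t" "t < T" by linarith
  then show "Measurable.pred (FX t) (\<lambda>\<omega>. hit N \<omega> \<le> t)"
  proof cases
    case 1
    then have "\<not> hit N \<omega> \<le> t" for \<omega> using hit_in[of N \<omega>] by auto
    then show ?thesis by simp
  next
    case 2
    then have "hit N \<omega> \<le> t" for \<omega> using hit_in[of N \<omega>] by auto
    then show ?thesis by simp
  next
    case 3
    have cont: "continuous_on {0..t} (\<lambda>s. \<bar>X s \<omega>\<bar>)" if "\<omega> \<in> space M" for \<omega>
      using 3 by (intro continuous_intros continuous_on_subset[OF X_continuous[OF that]]) auto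
    have "(\<lambda>\<omega>. running_sup (\<lambda>s. \<bar>X s \<omega>\<bar>) t) \<in> borel_measurable (FX t)"
      using 3 cont by (intro borel_measurable_running_sup borel_measurable_abs measurable_natural_filtration) auto
    then have "Measurable.pred (FX t) (\<lambda>\<omega>. real N \<le> running_sup (\<lambda>s. \<bar>X s \<omega>\<bar>) t)" by measurable
    moreover have "hit N \<omega> \<le> t \<longleftrightarrow> real N \<le> running_sup (\<lambda>s. \<bar>X s \<omega>\<bar>) t" if \<omega>: "\<omega> \<in> space M" for \<omega>
    proof
      assume "hit N \<omega> \<le> t"
      then have "real N \<le> \<bar>X (hit N \<omega>) \<omega>\<bar>" using 3 by (intro X_at_hit \<omega>) auto
      also have "\<dots> \<le> running_sup (\<lambda>s. \<bar>X s \<omega>\<bar>) t"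
        using \<open>hit N \<omega> \<le> t\<close> hit_in[of N \<omega>] by (intro running_sup_upper cont \<omega>) auto
      finally show "real N \<le> running_sup (\<lambda>s. \<bar>X s \<omega>\<bar>) t" .
    next
      assume N: "real N \<le> running_sup (\<lambda>s. \<bar>X s \<omega>\<bar>) t"
      obtain r where r: "r \<in> {0..t}" "running_sup (\<lambda>s. \<bar>X s \<omega>\<bar>) t = \<bar>X r \<omega>\<bar>"
        by (rule running_sup_attained[OF cont[OF \<omega>]]) (use 3 in auto)
      then show "hit N \<omega> \<le> t" using hit_le[of r N \<omega>] N 3 by auto
    qed
    then have "Measurable.pred (FX t) (\<lambda>\<omega>. hit N \<omega> \<le> t) \<longleftrightarrow>
        Measurable.pred (FX t) (\<lambda>\<omega>. real N \<le> running_sup (\<lambda>s. \<bar>X s \<omega>\<bar>) t)"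
      by (intro measurable_cong) simp
    ultimately show ?thesis by blast
  qed
qed

lemma hit_mono: "N \<le> N' \<Longrightarrow> hit N \<omega> \<le> hit N' \<omega>"
  unfolding hit_def by (rule cInf_superset_mono) (auto intro: bdd_belowI[of _ 0] order_trans simp: T_pos less_imp_le)

lemma eventually_hit: "\<omega> \<in> space M \<Longrightarrow> \<forall>\<^sub>F N in sequentially. hit N \<omega> = T"
proof -
  assume "\<omega> \<in> space M"
  then obtain B where B: "\<And>t. t \<in> {0..T} \<Longrightarrow> \<bar>X t \<omega>\<bar> \<le> B"
    using continuous_path_bound[OF X_continuous] by metis
  obtain m :: nat where m: "B < real m" using reals_Archimedean2 by blast
  have "hit N \<omega> = T" if "m \<le> N" for N
  proof -
    have "{t\<in>{0..T}. real N \<le> \<bar>X t \<omega>\<bar>} = {}" using B m that by force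
    then show ?thesis unfolding hit_def by (simp only:) simp
  qed
  then show ?thesis unfolding eventually_sequentially by blast
qed

text \<open>The discrete integral cannot stop at \<sigma> itself; it stops at the first grid point
  not before it, at most one mesh later.\<close>

lemma grid_after:
  assumes "\<sigma> \<in> {0..T}"
  obtains j where "\<sigma> \<le> grid T n j" "grid T n j \<le> T" "grid T n j - \<sigma> \<le> T / 2 ^ n" "\<And>i. i < j \<longleftrightarrow> grid T n i < \<sigma>"
proof -
  define j where "j = (LEAST j. \<sigma> \<le> grid T n j)"
  have ex: "\<sigma> \<le> grid T n (2 ^ n)" using assms by simp
  have 1: "\<sigma> \<le> grid T n j" unfolding j_def using ex by (rule LeastI)
  have 2: "grid T n i < \<sigma>" if "i < j" for i
    using not_less_Least[of i "\<lambda>j. \<sigma> \<le> grid T n j"] that unfolding j_def by simp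
  have 3: "j \<le> 2 ^ n" unfolding j_def using ex by (rule Least_le)
  have "0 \<le> T / 2 ^ n" using T_pos by simp
  then have 4: "grid T n j - \<sigma> \<le> T / 2 ^ n"
  proof (cases j)
    case 0
    moreover have "grid T n 0 = 0" "0 \<le> \<sigma>" using assms by auto
    ultimately show ?thesis using \<open>0 \<le> T / 2 ^ n\<close> by (simp only:)
  next
    case (Suc i)
    then show ?thesis using 2[of i] by (simp add: grid_Suc)
  qed
  have 5: "\<not> grid T n i < \<sigma>" if "\<not> i < j" for i
    using 1 grid_mono[of T j i n] that T_pos by simp
  show ?thesis
    by (rule that[OF 1 _ 4]) (use 2 5 grid_in[OF _ 3, of T] T_pos in auto)
qed

section \<open>The stopped process for one test function and one level\<close>

context
  fixes f :: "real \<Rightarrow> real" and N :: nat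
  assumes f: "f \<in> D_L1"
begin

lemma f_C2: "f \<in> C2" and f_deriv_0: "deriv f 0 = 0"
  using f by (auto simp: D_L1_def)

definition Z :: "real \<Rightarrow> 'a \<Rightarrow> real" where "Z = mp_process L1 x\<^sub>0 X f"

definition stopped :: "real \<Rightarrow> 'a \<Rightarrow> real" where "stopped t \<omega> = Z (min t (hit N \<omega>)) \<omega>"

lemma stopped_measurable:
  assumes t: "t \<in> {0..T}"
  shows "stopped t \<in> borel_measurable (FX t)"
  unfolding stopped_def[abs_def]
proof (rule borel_measurable_random_time[where a = 0 and b = t and h = Z and \<tau> = "\<lambda>\<omega>. min t (hit N \<omega>)"])
  show "Z s \<in> borel_measurable (FX t)" if "s \<in> {0..t}" for s
    unfolding Z_def using that t
    by (intro mp_process_borel_measurable f_C2 measurable_natural_filtration) auto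
  show "continuous_on {0..t} (\<lambda>s. Z s \<omega>)" if "\<omega> \<in> space (FX t)" for \<omega>
    unfolding Z_def using that t by (intro continuous_on_subset[OF mp_process_continuous[OF f_C2]]) auto
  show "(\<lambda>\<omega>. min t (hit N \<omega>)) \<in> borel_measurable (FX t)"
    unfolding borel_measurable_iff_le
  proof
    fix a
    show "{\<omega> \<in> space (FX t). min t (hit N \<omega>) \<le> a} \<in> sets (FX t)"
    proof (cases "t \<le> a")
      case False
      have "{\<omega> \<in> space (FX a). hit N \<omega> \<le> a} \<in> sets (FX a)"
        using stopping_timeD[OF stopping_time_hit[of N], of a] by measurable
      then have "{\<omega> \<in> space (FX a). hit N \<omega> \<le> a} \<in> sets (FX t)"
        using natural_filtration_mono[of a t M T X] False by auto
      also have "{\<omega> \<in> space (FX a). hit N \<omega> \<le> a} = {\<omega> \<in> space (FX t). min t (hit N \<omega>) \<le> a}"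
        using False by auto
      finally show ?thesis .
    next
      case True
      then have "{\<omega> \<in> space (FX t). min t (hit N \<omega>) \<le> a} = space (FX t)" by auto
      then show ?thesis by (metis sets.top)
    qed
  qed
  show "min t (hit N \<omega>) \<in> {0..t}" for \<omega> using t hit_in[of N \<omega>] by auto
qed

text \<open>Strictly before \<open>hit\<close> the path stays in \<open>{- real N..real N}\<close>,
  and continuity extends this to the hitting time, unless that time is 0. Then the start may lie
  outside the interval, but the stopped process is identically 0.\<close>

lemma stopped_bounded:
  obtains B where "\<And>t \<omega>. t \<in> {0..T} \<Longrightarrow> \<omega> \<in> space M \<Longrightarrow> \<bar>stopped t \<omega>\<bar> \<le> B"
proof -
  obtain B0 where B0: "B0 > 0" "\<And>x. x \<in> {- real N..real N} \<Longrightarrow> \<bar>f x\<bar> \<le> B0"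
    using continuous_path_bound[OF C2_derivs(3)[OF f_C2]] by metis
  obtain B2 where B2: "B2 > 0" "\<And>x. x \<in> {- real N..real N} \<Longrightarrow> \<bar>deriv (deriv f) x\<bar> \<le> B2"
    using continuous_path_bound[OF C2_derivs(5)[OF f_C2]] by metis
  show ?thesis
  proof (rule that[of "2 * B0 + B2 * T"])
    fix t \<omega> assume t: "t \<in> {0..T}" and \<omega>: "\<omega> \<in> space M"
    define r where "r = min t (hit N \<omega>)"
    have r: "r \<in> {0..T}" "r \<le> hit N \<omega>" using t hit_in[of N \<omega>] by (auto simp: r_def)
    show "\<bar>stopped t \<omega>\<bar> \<le> 2 * B0 + B2 * T"
    proof (cases "hit N \<omega> = 0")
      case True
      then have "stopped t \<omega> = 0" using t by (simp add: stopped_def Z_def mp_process_X X_0)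
      then show ?thesis using B0(1) B2(1) T_pos by simp
    next
      case False
      then have h: "0 < hit N \<omega>" using hit_in[of N \<omega>] by auto
      have "\<bar>X s \<omega>\<bar> \<le> real N" if "s \<in> {0..hit N \<omega>}" for s
      proof (rule continuous_le_on_closure[of "{0<..<hit N \<omega>}" "\<lambda>s. \<bar>X s \<omega>\<bar>"])
        show "continuous_on (closure {0<..<hit N \<omega>}) (\<lambda>s. \<bar>X s \<omega>\<bar>)"
          using h hit_in[of N \<omega>] by (intro continuous_intros continuous_on_subset[OF X_continuous[OF \<omega>]]) auto
        show "s \<in> closure {0<..<hit N \<omega>}" using that h by simp
        show "\<bar>X s \<omega>\<bar> \<le> real N" if "s \<in> {0<..<hit N \<omega>}" for s
          using X_before_hit[of s N \<omega>] that hit_in[of N \<omega>] by auto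
      qed
      then have X: "X s \<omega> \<in> {- real N..real N}" if "s \<in> {0..r}" for s
        using that r by (fastforce simp: abs_le_iff)
      have "\<bar>integral {0..r} (\<lambda>s. deriv (deriv f) (X s \<omega>))\<bar> \<le> B2 * (r - 0)"
        using r by (intro integral_bound[where 'a = real, unfolded real_norm_def] C2_X_continuous(3) f_C2 \<omega> B2(2) X) auto
      also have "\<dots> \<le> B2 * T" using r B2(1) by simp
      finally have 1: "\<bar>integral {0..r} (\<lambda>s. deriv (deriv f) (X s \<omega>))\<bar> \<le> B2 * T" .
      have 2: "\<bar>f (X r \<omega>)\<bar> \<le> B0" "\<bar>f (X 0 \<omega>)\<bar> \<le> B0" using r by (auto intro!: B0(2) X)
      have "stopped t \<omega> = f (X r \<omega>) - f (X 0 \<omega>) - integral {0..r} (\<lambda>s. deriv (deriv f) (X s \<omega>)) / 2"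
        by (simp add: stopped_def Z_def mp_process_X X_0 r_def)
      then show ?thesis using 1 2 by linarith
    qed
  qed
qed

text \<open>The cutoff is decided at the left end of the cell, so the coefficient is known there. A
  cell in which \<open>hit\<close> falls is still integrated completely.\<close>

definition c :: "nat \<Rightarrow> nat \<Rightarrow> 'a \<Rightarrow> real" where
  "c n i \<omega> = (if grid T n i < hit N \<omega> then deriv f (X (grid T n i) \<omega>) else 0)"

lemma c_measurable:
  assumes i: "i < 2 ^ n"
  shows "c n i \<in> borel_measurable (F (grid T n i))"
proof -
  have "Measurable.pred (FX (grid T n i)) (\<lambda>\<omega>. grid T n i < hit N \<omega>)"
    by (rule stopping_timeD2[OF stopping_time_hit])
  then have [measurable]: "Measurable.pred (F (grid T n i)) (\<lambda>\<omega>. grid T n i < hit N \<omega>)"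
    using FX_subset_F[of "grid T n i"] by (auto simp: measurable_def)
  have [measurable]: "(\<lambda>\<omega>. deriv f (X (grid T n i) \<omega>)) \<in> borel_measurable (F (grid T n i))"
    using grid_in[of T i n] i T_pos
    by (intro measurable_compose[OF X_F_measurable C2_borel_measurable(2)[OF f_C2]]) auto
  show ?thesis unfolding c_def by measurable
qed

lemma c_bounded:
  obtains C where "\<And>n i \<omega>. i < 2 ^ n \<Longrightarrow> \<omega> \<in> space M \<Longrightarrow> \<bar>c n i \<omega>\<bar> \<le> C"
proof -
  obtain C where C: "C > 0" "\<And>x. x \<in> {- real N..real N} \<Longrightarrow> \<bar>deriv f x\<bar> \<le> C"
    using continuous_path_bound[OF C2_derivs(4)[OF f_C2]] by metis
  have "\<bar>c n i \<omega>\<bar> \<le> C" if i: "i < 2 ^ n" for n i \<omega>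
  proof (cases "grid T n i < hit N \<omega>")
    case True
    then have "\<bar>X (grid T n i) \<omega>\<bar> < real N"
      using grid_in[of T i n] i T_pos by (intro X_before_hit) auto
    then show ?thesis using True C(2)[of "X (grid T n i) \<omega>"] by (simp add: c_def abs_less_iff)
  qed (use C in \<open>auto simp: c_def\<close>)
  then show ?thesis using that by blast
qed

text \<open>The sum with switched-off coefficients equals the full sum evaluated at
  \<open>u\<close>, the smaller of \<open>t\<close> and the first grid point after
  \<open>hit\<close>. Since \<open>ito_uniform\<close> is uniform in time, it applies at this
  path-dependent time, and continuity of \<open>Z\<close> absorbs the distance to the stopping
  time.\<close>

lemma AE_simple_integral_stopped:
  assumes t: "t \<in> {0..T}"
  shows "AE \<omega> in M. (\<lambda>n. simple_integral W (2 ^ n) (grid T n) (c n) t \<omega>) \<longlonglongrightarrow> stopped t \<omega>"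
  using AE_reflected_path AE_space
proof eventually_elim
  case (elim \<omega>)
  interpret reflected_path T "\<lambda>t. W t \<omega>" "\<lambda>t. L t \<omega>" "\<lambda>t. X t \<omega>" by (rule elim(1))
  show ?case
  proof (rule tendstoI)
    fix \<epsilon> :: real assume "\<epsilon> > 0"
    then have e: "\<epsilon> / 2 > 0" by simp
    have Z_cont: "continuous_on {0..T} (\<lambda>t. Z t \<omega>)"
      unfolding Z_def by (rule mp_process_continuous[OF f_C2 elim(2)])
    from ito_uniform[OF f_C2 f_deriv_0 e] eventually_grid_osc[OF T_pos Z_cont e]
    show "\<forall>\<^sub>F n in sequentially. dist (simple_integral W (2 ^ n) (grid T n) (c n) t \<omega>) (stopped t \<omega>) < \<epsilon>"
    proof eventually_elim
      case (elim n)
      obtain j where j: "hit N \<omega> \<le> grid T n j" "grid T n j \<le> T" "grid T n j - hit N \<omega> \<le> T / 2 ^ n"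
        "\<And>i. i < j \<longleftrightarrow> grid T n i < hit N \<omega>"
        using grid_after[OF hit_in] by metis
      define u where "u = min t (grid T n j)"
      have "simple_integral W (2 ^ n) (grid T n) (c n) t \<omega> =
          (\<Sum>i<2 ^ n. deriv f (X (grid T n i) \<omega>) * (W (min u (grid T n (Suc i))) \<omega> - W (min u (grid T n i)) \<omega>))"
        unfolding simple_integral_def
      proof (rule sum.cong)
        fix i
        show "c n i \<omega> * (W (min t (grid T n (Suc i))) \<omega> - W (min t (grid T n i)) \<omega>) =
          deriv f (X (grid T n i) \<omega>) * (W (min u (grid T n (Suc i))) \<omega> - W (min u (grid T n i)) \<omega>)"
        proof (cases "i < j")
          case True
          then have "grid T n (Suc i) \<le> grid T n j" "grid T n i \<le> grid T n j"
            using T_pos by (auto intro!: grid_mono)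
          then show ?thesis using j(4)[of i] True by (simp add: c_def u_def min_def)
        next
          case False
          then have "grid T n j \<le> grid T n i" "grid T n j \<le> grid T n (Suc i)"
            using T_pos by (auto intro!: grid_mono)
          then show ?thesis using j(4)[of i] False by (simp add: c_def u_def min_def)
        qed
      qed simp
      moreover have u: "u \<in> {0..T}" using t j hit_in[of N \<omega>] by (auto simp: u_def)
      ultimately have "\<bar>simple_integral W (2 ^ n) (grid T n) (c n) t \<omega> - Z u \<omega>\<bar> < \<epsilon> / 2"
        using elim(1) by (simp add: Z_def mp_process_X X_0)
      moreover have "\<bar>Z u \<omega> - stopped t \<omega>\<bar> < \<epsilon> / 2"
        unfolding stopped_def using t j(1,3) hit_in[of N \<omega>] u
        by (intro elim(2)[rule_format]) (auto simp: u_def min_def)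
      ultimately show ?case unfolding dist_real_def by linarith
    qed
  qed
qed

text \<open>The increment of the discrete integral from \<open>s\<close> to \<open>t\<close>, tested
  on an event of the past, has mean 0 at every level. It converges almost surely to a bounded limit
  and is bounded in mean square, so the mean of the limit is 0 as well.\<close>

lemma stopped_martingale: "martingale M FX T stopped"
  unfolding martingale_def
proof (intro conjI ballI allI impI)
  obtain B where B: "\<And>t \<omega>. t \<in> {0..T} \<Longrightarrow> \<omega> \<in> space M \<Longrightarrow> \<bar>stopped t \<omega>\<bar> \<le> B"
    using stopped_bounded by blast
  obtain C where C: "\<And>n i \<omega>. i < 2 ^ n \<Longrightarrow> \<omega> \<in> space M \<Longrightarrow> \<bar>c n i \<omega>\<bar> \<le> C"
    using c_bounded by blast
  show "adapted_process FX T stopped"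
    using stopped_measurable by (simp add: adapted_process_def)
  have meas: "stopped t \<in> borel_measurable M" if "t \<in> {0..T}" for t
    using measurable_from_subalg[OF subalgebra_FX stopped_measurable[OF that]] .
  show int: "integrable M (stopped t)" if "t \<in> {0..T}" for t
    using B[OF that] meas[OF that] by (intro integrable_const_bound[where B = B]) auto
  fix s t assume st: "0 \<le> s" "s \<le> t" "t \<le> T"
  then have s: "s \<in> {0..T}" and t: "t \<in> {0..T}" by auto
  interpret S: finite_measure_subalgebra M "FX s"
    by standard (rule subalgebra_FX)
  show "AE \<omega> in M. real_cond_exp M (FX s) (stopped t) \<omega> = stopped s \<omega>"
  proof (rule S.real_cond_exp_charact)
    fix A assume A: "A \<in> sets (FX s)"
    then have AF: "A \<in> sets (F s)" and [measurable]: "A \<in> sets M"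
      using FX_subset_F[of s] F_subset[of s] by auto
    define S where "S n r = simple_integral W (2 ^ n) (grid T n) (c n) r" for n r
    have S: "S n r \<in> borel_measurable M" "integrable M (\<lambda>\<omega>. (S n r \<omega>)\<^sup>2)" "expectation (\<lambda>\<omega>. (S n r \<omega>)\<^sup>2) \<le> C\<^sup>2 * T"
      if "r \<in> {0..T}" for n r
    proof -
      have L2: "S n r \<in> borel_measurable (F (min r (grid T n (2 ^ n))))" "integrable M (\<lambda>\<omega>. (S n r \<omega>)\<^sup>2)"
        "expectation (\<lambda>\<omega>. (S n r \<omega>)\<^sup>2) \<le> C\<^sup>2 * min r (grid T n (2 ^ n))"
        using simple_integral_L2[OF c_measurable C that order_refl, of n] by (simp_all add: S_def)
      show "S n r \<in> borel_measurable M" by (rule F_measurable_M[OF L2(1)])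
      show "integrable M (\<lambda>\<omega>. (S n r \<omega>)\<^sup>2)" by (rule L2(2))
      have "C\<^sup>2 * min r (grid T n (2 ^ n)) \<le> C\<^sup>2 * T" by (intro mult_left_mono) auto
      with L2(3) show "expectation (\<lambda>\<omega>. (S n r \<omega>)\<^sup>2) \<le> C\<^sup>2 * T" by (rule order_trans)
    qed
    define V where "V n \<omega> = indicat_real A \<omega> * (S n t \<omega> - S n s \<omega>)" for n \<omega>
    have "(\<lambda>n. expectation (V n)) \<longlonglongrightarrow> expectation (\<lambda>\<omega>. indicat_real A \<omega> * (stopped t \<omega> - stopped s \<omega>))"
    proof (rule expectation_tendsto_of_L2_bounded[where K = "4 * (C\<^sup>2 * T)" and B = "2 * B"])
      show Vm: "V n \<in> borel_measurable M" for n
        unfolding V_def using S(1)[OF s] S(1)[OF t] by measurable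
      show "(\<lambda>\<omega>. indicat_real A \<omega> * (stopped t \<omega> - stopped s \<omega>)) \<in> borel_measurable M"
        using meas[OF s] meas[OF t] by measurable
      have le: "(V n \<omega>)\<^sup>2 \<le> 2 * (S n t \<omega>)\<^sup>2 + 2 * (S n s \<omega>)\<^sup>2" for n \<omega>
      proof -
        have "(V n \<omega>)\<^sup>2 \<le> (S n t \<omega> - S n s \<omega>)\<^sup>2" by (simp add: V_def indicator_def)
        also have "\<dots> \<le> (S n t \<omega> - S n s \<omega>)\<^sup>2 + (S n t \<omega> + S n s \<omega>)\<^sup>2" by simp
        also have "\<dots> = 2 * (S n t \<omega>)\<^sup>2 + 2 * (S n s \<omega>)\<^sup>2" by (simp add: power2_sum power2_diff)
        finally show ?thesis .
      qed
      show Vi: "integrable M (\<lambda>\<omega>. (V n \<omega>)\<^sup>2)" for n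
      proof (rule Bochner_Integration.integrable_bound)
        show "integrable M (\<lambda>\<omega>. 2 * (S n t \<omega>)\<^sup>2 + 2 * (S n s \<omega>)\<^sup>2)"
          using S(2)[OF s] S(2)[OF t] by simp
        show "(\<lambda>\<omega>. (V n \<omega>)\<^sup>2) \<in> borel_measurable M" using Vm[of n] by measurable
        show "AE \<omega> in M. norm ((V n \<omega>)\<^sup>2) \<le> norm (2 * (S n t \<omega>)\<^sup>2 + 2 * (S n s \<omega>)\<^sup>2)"
          using le[of n] by (intro AE_I2) (simp add: abs_of_nonneg)
      qed
      show "expectation (\<lambda>\<omega>. (V n \<omega>)\<^sup>2) \<le> 4 * (C\<^sup>2 * T)" for n
      proof -
        have "expectation (\<lambda>\<omega>. (V n \<omega>)\<^sup>2) \<le> expectation (\<lambda>\<omega>. 2 * (S n t \<omega>)\<^sup>2 + 2 * (S n s \<omega>)\<^sup>2)"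
          using Vi S(2)[OF s] S(2)[OF t] le by (intro integral_mono) auto
        also have "\<dots> = 2 * expectation (\<lambda>\<omega>. (S n t \<omega>)\<^sup>2) + 2 * expectation (\<lambda>\<omega>. (S n s \<omega>)\<^sup>2)"
          using S(2)[OF s] S(2)[OF t] by simp
        finally show ?thesis using S(3)[OF s, of n] S(3)[OF t, of n] by linarith
      qed
      show "AE \<omega> in M. (\<lambda>n. V n \<omega>) \<longlonglongrightarrow> indicat_real A \<omega> * (stopped t \<omega> - stopped s \<omega>)"
        using AE_simple_integral_stopped[OF s] AE_simple_integral_stopped[OF t]
        by eventually_elim (auto simp: V_def S_def intro!: tendsto_intros)
      show "\<bar>indicat_real A \<omega> * (stopped t \<omega> - stopped s \<omega>)\<bar> \<le> 2 * B" if "\<omega> \<in> space M" for \<omega>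
        using B[OF s that] B[OF t that] by (auto simp: indicator_def)
    qed
    moreover have "expectation (V n) = 0" for n
      unfolding V_def S_def by (rule simple_integral_martingale[OF c_measurable C st AF])
    ultimately have "expectation (\<lambda>\<omega>. indicat_real A \<omega> * (stopped t \<omega> - stopped s \<omega>)) = 0"
      using LIMSEQ_unique[OF _ tendsto_const] by force
    moreover have "integrable M (\<lambda>\<omega>. indicat_real A \<omega> * stopped r \<omega>)" if "r \<in> {0..T}" for r
      using int[OF that] by (simp add: integrable_mult_indicator[where 'b = real, simplified])
    ultimately show "(\<integral>\<omega>\<in>A. stopped t \<omega> \<partial>M) = (\<integral>\<omega>\<in>A. stopped s \<omega> \<partial>M)"
      using s t by (simp add: set_lebesgue_integral_def right_diff_distrib)
  qed (use int s t stopped_measurable in auto)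
qed

end

lemma martingale_problem_X: "solves_martingale_problem M T D_L1 L1 x\<^sub>0 X"
  unfolding solves_martingale_problem_def
proof (intro conjI ballI)
  fix f assume f: "f \<in> D_L1"
  show "local_martingale M FX T (mp_process L1 x\<^sub>0 X f)"
    unfolding local_martingale_def
  proof (intro conjI exI[of _ hit] allI ballI)
    show "adapted_process FX T (mp_process L1 x\<^sub>0 X f)"
      unfolding adapted_process_def using f
      by (intro ballI mp_process_borel_measurable measurable_natural_filtration) (auto simp: D_L1_def)
    show "AE \<omega> in M. incseq (\<lambda>n. hit n \<omega>) \<and> (\<forall>\<^sub>F n in sequentially. hit n \<omega> = T)"
      using hit_mono eventually_hit by (auto simp: incseq_def)
    show "martingale M FX T (\<lambda>t \<omega>. mp_process L1 x\<^sub>0 X f (min t (hit N \<omega>)) \<omega>)" for N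
      using stopped_martingale[OF f, of N] by (simp add: stopped_def[OF f, abs_def] Z_def[OF f])
  qed (use hit_in stopping_time_hit in auto)
qed (use X_0 X_continuous X_measurable prob_space_axioms in \<open>auto simp: continuous_paths_def\<close>)

end

section \<open>Non-uniqueness\<close>

text \<open>Reflection leaves the filtration unchanged, so the local martingales required of
  \<open>- X\<close> are literally those of \<open>X\<close> for reflected test functions.\<close>

lemma natural_filtration_uminus:
  "natural_filtration M T (\<lambda>t \<omega>. - X t \<omega>) = natural_filtration M T X"
proof -
  have sub: "{Y -` A \<inter> space M |A. A \<in> sets borel} \<subseteq> {(\<lambda>\<omega>. - Y \<omega>) -` A \<inter> space M |A. A \<in> sets borel}"
    for Y :: "'a \<Rightarrow> real"
  proof safe
    fix A :: "real set" assume A: "A \<in> sets borel"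
    have "uminus -` A \<inter> space borel \<in> sets borel"
      by (rule measurable_sets[OF _ A]) measurable
    moreover have "Y -` A = (\<lambda>\<omega>. - Y \<omega>) -` (uminus -` A)" by auto
    ultimately show "\<exists>B. Y -` A \<inter> space M = (\<lambda>\<omega>. - Y \<omega>) -` B \<inter> space M \<and> B \<in> sets borel"
      by (intro exI[of _ "uminus -` A"]) auto
  qed
  have "{(\<lambda>\<omega>. - X s \<omega>) -` A \<inter> space M |A. A \<in> sets borel} = {X s -` A \<inter> space M |A. A \<in> sets borel}" for s
    using sub[of "X s"] sub[of "\<lambda>\<omega>. - X s \<omega>"] by simp
  then show ?thesis by (simp add: natural_filtration_def fun_eq_iff)
qed

lemma D_L1_reflect:
  assumes "f \<in> D_L1"
  shows "(\<lambda>x. f (- x)) \<in> D_L1" "L1 (\<lambda>x. f (- x)) x = L1 f (- x)"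
proof -
  have f: "f \<in> C2" "deriv f 0 = 0" using assms by (auto simp: D_L1_def)
  have u: "((\<lambda>x. - x) has_real_derivative - 1) (at x)" for x :: real
    by (auto intro!: derivative_eq_intros)
  have 1: "((\<lambda>x. f (- x)) has_real_derivative - deriv f (- x)) (at x)" for x
    using DERIV_chain2[OF C2_derivs(1)[OF f(1)] u] by simp
  then have d1: "deriv (\<lambda>x. f (- x)) = (\<lambda>x. - deriv f (- x))" using DERIV_imp_deriv by blast
  have 2: "((\<lambda>x. - deriv f (- x)) has_real_derivative deriv (deriv f) (- x)) (at x)" for x
    using DERIV_minus[OF DERIV_chain2[OF C2_derivs(2)[OF f(1)] u]] by simp
  then have d2: "deriv (\<lambda>x. - deriv f (- x)) = (\<lambda>x. deriv (deriv f) (- x))" using DERIV_imp_deriv by blast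
  show "L1 (\<lambda>x. f (- x)) x = L1 f (- x)" by (simp add: L1_def d1 d2)
  have "continuous_on UNIV (\<lambda>x. deriv (deriv f) (- x))"
    by (intro continuous_on_compose2[OF C2_derivs(5)[OF f(1), of UNIV]] continuous_intros) auto
  moreover have "\<exists>D. ((\<lambda>x. f (- x)) has_real_derivative D) (at x)"
    "\<exists>D. ((\<lambda>x. - deriv f (- x)) has_real_derivative D) (at x)" for x
    using 1 2 by blast+
  ultimately show "(\<lambda>x. f (- x)) \<in> D_L1"
    using f(2) by (simp add: D_L1_def C2_def d1 d2 field_differentiable_def)
qed

lemma martingale_problem_uminus:
  assumes "solves_martingale_problem M T D_L1 L1 x\<^sub>0 X"
  shows "solves_martingale_problem M T D_L1 L1 (- x\<^sub>0) (\<lambda>t \<omega>. - X t \<omega>)"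
proof -
  have "local_martingale M (natural_filtration M T X) T (mp_process L1 (- x\<^sub>0) (\<lambda>t \<omega>. - X t \<omega>) f)"
    if f: "f \<in> D_L1" for f
  proof -
    have "mp_process L1 (- x\<^sub>0) (\<lambda>t \<omega>. - X t \<omega>) f = mp_process L1 x\<^sub>0 X (\<lambda>x. f (- x))"
      by (simp add: mp_process_def fun_eq_iff D_L1_reflect(2)[OF f])
    then show ?thesis
      using assms D_L1_reflect(1)[OF f] by (simp add: solves_martingale_problem_def)
  qed
  then show ?thesis
    using assms by (auto simp: solves_martingale_problem_def natural_filtration_uminus continuous_paths_def
        intro!: continuous_intros)
qed

context reflected_brownian
begin

text \<open>Equal laws would give \<open>X T > 0\<close> the probability of
  \<open>- X T > 0\<close>, which is 0. As \<open>X\<close> dominates \<open>Y\<close>, the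
  increment of \<open>W\<close> over \<open>{0..T}\<close> would be nonpositive almost surely;
  having mean 0 it would vanish, against its variance \<open>T\<close>.\<close>

lemma law_X_asymmetric: "law M T X \<noteq> law M T (\<lambda>t \<omega>. - X t \<omega>)"
proof
  assume eq: "law M T X = law M T (\<lambda>t \<omega>. - X t \<omega>)"
  define E :: "(real \<Rightarrow> real) set" where "E = (\<lambda>g. g T) -` {0<..} \<inter> space (PiM {0..T} (\<lambda>_. borel))"
  have T: "T \<in> {0..T}" using T_pos by simp
  have E: "E \<in> sets (PiM {0..T} (\<lambda>_. borel))"
    unfolding E_def by (rule measurable_sets[OF measurable_component_singleton[OF T]]) simp
  have law_E: "measure (law M T U) E = prob {\<omega>\<in>space M. 0 < U T \<omega>}"
    if "\<And>t. t \<in> {0..T} \<Longrightarrow> U t \<in> borel_measurable M" for U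
  proof -
    have U: "(\<lambda>\<omega>. \<lambda>t\<in>{0..T}. U t \<omega>) \<in> measurable M (PiM {0..T} (\<lambda>_. borel))"
      using that by (rule measurable_restrict)
    have "(\<lambda>\<omega>. \<lambda>t\<in>{0..T}. U t \<omega>) -` E \<inter> space M = {\<omega>\<in>space M. 0 < U T \<omega>}"
      using T by (auto simp: E_def space_PiM)
    then show ?thesis unfolding law_def by (simp add: measure_distr[OF U E])
  qed
  have "prob {\<omega>\<in>space M. 0 < X T \<omega>} = prob {\<omega>\<in>space M. 0 < - X T \<omega>}"
    using eq law_E[of X] law_E[of "\<lambda>t \<omega>. - X t \<omega>"] X_measurable by simp
  also have "{\<omega>\<in>space M. 0 < - X T \<omega>} = {}" using X_ge_0[OF _ T] by fastforce
  finally have "prob {\<omega>\<in>space M. 0 < X T \<omega>} = 0" by simp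
  moreover have "{\<omega>\<in>space M. 0 < X T \<omega>} \<in> sets M" using X_measurable[OF T] by measurable
  ultimately have "AE \<omega> in M. \<not> 0 < X T \<omega>"
    by (subst AE_iff_measurable[where N = "{\<omega>\<in>space M. 0 < X T \<omega>}"]) (auto simp: emeasure_eq_measure)
  define D where "D \<omega> = W T \<omega> - W 0 \<omega>" for \<omega>
  have mom: "integrable M D" "expectation D = 0" "expectation (\<lambda>\<omega>. (D \<omega>)\<^sup>2) = T"
    using increment_moments(1)[of 0 T 1] increment_moments(2,3)[of 0 T] T_pos by (auto simp: D_def[abs_def])
  have neg: "AE \<omega> in M. 0 \<le> - D \<omega>"
    using \<open>AE \<omega> in M. \<not> 0 < X T \<omega>\<close> AE_space
    by eventually_elim (use X_ge_Y[OF _ T] x0_nonneg in \<open>force simp: Y_def D_def\<close>)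
  have "AE \<omega> in M. - D \<omega> = 0"
    using integral_nonneg_eq_0_iff_AE[OF _ neg] mom(1,2) by simp
  then have "expectation (\<lambda>\<omega>. (D \<omega>)\<^sup>2) = expectation (\<lambda>\<omega>. 0)"
    using mom(1) by (intro integral_cong_AE) auto
  then show False using mom(3) T_pos by simp
qed

end

text \<open>The sample type is the one over which \<open>martingale_problem_unique\<close>
  quantifies, and 0 is the initial value that reflection fixes.\<close>

lemma martingale_problem_not_unique:
  fixes M :: "(real \<Rightarrow> real) measure"
  assumes "0 < T" "brownian_motion M T W"
  shows "\<not> martingale_problem_unique T D_L1 L1"
proof
  interpret reflected_brownian M T W 0
    by standard (use assms in auto)
  have neg: "solves_martingale_problem M T D_L1 L1 0 (\<lambda>t \<omega>. - X t \<omega>)"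
    using martingale_problem_uminus[OF martingale_problem_X] by simp
  assume "martingale_problem_unique T D_L1 L1"
  from this[unfolded martingale_problem_unique_def, rule_format, OF martingale_problem_X neg]
  have "law M T X = law M T (\<lambda>t \<omega>. - X t \<omega>)" .
  then show False using law_X_asymmetric by simp
qed

section \<open>Independent Gaussian variables\<close>

text \<open>A finite selection of events is padded to whole blocks; independence of the blocks and
  the product formula inside each of them then give a nested product, from which the padding drops
  out. In Levy's construction a block is an interval increment with its fresh variable, and the two
  halves are functions of it.\<close>

lemma (in prob_space) indep_vars_refine:
  assumes ind: "indep_vars N V K"
    and fin: "\<And>k. k \<in> K \<Longrightarrow> finite (J k)" and disj: "disjoint_family_on J K"
    and X: "\<And>k i. k \<in> K \<Longrightarrow> i \<in> J k \<Longrightarrow> \<exists>h\<in>measurable (N k) (M' i). \<forall>\<omega>\<in>space M. X i \<omega> = h (V k \<omega>)"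
    and block: "\<And>k A. k \<in> K \<Longrightarrow> (\<And>i. i \<in> J k \<Longrightarrow> A i \<in> sets (M' i)) \<Longrightarrow>
      prob (\<Inter>i\<in>J k. X i -` A i \<inter> space M) = (\<Prod>i\<in>J k. prob (X i -` A i \<inter> space M))"
  shows "indep_vars M' X (\<Union>k\<in>K. J k)"
proof -
  have V: "V k \<in> measurable M (N k)" if "k \<in> K" for k
    using ind that by (simp add: indep_vars_def2)
  have rv: "X i \<in> measurable M (M' i)" if i: "i \<in> (\<Union>k\<in>K. J k)" for i
  proof -
    from i obtain k where k: "k \<in> K" "i \<in> J k" by auto
    obtain h where h: "h \<in> measurable (N k) (M' i)" "\<forall>\<omega>\<in>space M. X i \<omega> = h (V k \<omega>)"
      using X[OF k] by blast
    have "(\<lambda>\<omega>. h (V k \<omega>)) \<in> measurable M (M' i)" by (rule measurable_compose[OF V[OF k(1)] h(1)])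
    then show ?thesis using h(2) by (simp cong: measurable_cong)
  qed
  show ?thesis
    unfolding indep_vars_def2
  proof (intro conjI ballI rv indep_setsI)
    fix i assume "i \<in> (\<Union>k\<in>K. J k)"
    then show "{X i -` A \<inter> space M |A. A \<in> sets (M' i)} \<subseteq> events"
      using rv by (auto intro: measurable_sets)
  next
    fix A L assume L: "L \<noteq> {}" "L \<subseteq> (\<Union>k\<in>K. J k)" "finite L"
      and A: "\<forall>j\<in>L. A j \<in> {X j -` B \<inter> space M |B. B \<in> sets (M' j)}"
    obtain B where B: "\<And>j. j \<in> L \<Longrightarrow> B j \<in> sets (M' j)" "\<And>j. j \<in> L \<Longrightarrow> A j = X j -` B j \<inter> space M"
      using A unfolding mem_Collect_eq by metis
    obtain \<kappa> where \<kappa>: "\<And>j. j \<in> L \<Longrightarrow> \<kappa> j \<in> K" "\<And>j. j \<in> L \<Longrightarrow> j \<in> J (\<kappa> j)"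
      using L(2) by (metis UN_E subsetD)
    define K' where "K' = \<kappa> ` L"
    have K': "finite K'" "K' \<subseteq> K" "K' \<noteq> {}" using L(1,3) \<kappa>(1) by (auto simp: K'_def)
    \<comment> \<open>The padding: an index outside \<open>L\<close> receives the whole space, an
      event of probability 1.\<close>
    define B' where "B' j = (if j \<in> L then B j else space (M' j))" for j
    define E where "E j = X j -` B' j \<inter> space M" for j
    have B': "B' j \<in> sets (M' j)" for j using B(1) by (simp add: B'_def)
    have J: "k \<in> K' \<Longrightarrow> j \<in> J k \<Longrightarrow> j \<in> (\<Union>k\<in>K. J k)" for j k using K' by auto
    have E_full: "E j = space M" if "j \<notin> L" "k \<in> K'" "j \<in> J k" for j k
      using that measurable_space[OF rv[OF J[OF that(2,3)]]] by (auto simp: E_def B'_def)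
    have E_A: "E j = A j" if "j \<in> L" for j using that B(2) by (simp add: E_def B'_def)
    have E_sub: "E j \<subseteq> space M" for j by (auto simp: E_def)
    have J_nonempty: "J k \<noteq> {}" if "k \<in> K'" for k using that \<kappa>(2) by (auto simp: K'_def)
    have inter: "(\<Inter>j\<in>L. A j) = (\<Inter>k\<in>K'. \<Inter>j\<in>J k. E j)"
    proof (intro equalityI subsetI)
      fix \<omega> assume \<omega>: "\<omega> \<in> (\<Inter>j\<in>L. A j)"
      then have "\<omega> \<in> space M" using L(1) B(2) by auto
      then show "\<omega> \<in> (\<Inter>k\<in>K'. \<Inter>j\<in>J k. E j)"
        using \<omega> E_A E_full by (intro INT_I) (metis INT_D)
    next
      fix \<omega> assume \<omega>: "\<omega> \<in> (\<Inter>k\<in>K'. \<Inter>j\<in>J k. E j)"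
      show "\<omega> \<in> (\<Inter>j\<in>L. A j)"
      proof (rule INT_I)
        fix j assume j: "j \<in> L"
        then have "\<omega> \<in> E j" using \<omega> \<kappa>(2)[OF j] by (auto simp: K'_def)
        then show "\<omega> \<in> A j" using E_A[OF j] by simp
      qed
    qed
    have "\<exists>C\<in>sets (N k). (\<Inter>j\<in>J k. E j) = V k -` C \<inter> space M" if k: "k \<in> K'" for k
    proof -
      have kK: "k \<in> K" using k K' by auto
      obtain h where h: "\<And>j. j \<in> J k \<Longrightarrow> h j \<in> measurable (N k) (M' j)"
        "\<And>j \<omega>. j \<in> J k \<Longrightarrow> \<omega> \<in> space M \<Longrightarrow> X j \<omega> = h j (V k \<omega>)"
        using X[OF kK] by metis
      have "(\<Inter>j\<in>J k. h j -` B' j \<inter> space (N k)) \<in> sets (N k)"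
        using fin[OF kK] J_nonempty[OF k] h(1) B' by (intro sets.finite_INT) (auto intro: measurable_sets)
      moreover have "(\<Inter>j\<in>J k. E j) = V k -` (\<Inter>j\<in>J k. h j -` B' j \<inter> space (N k)) \<inter> space M"
        using J_nonempty[OF k] h(2) measurable_space[OF V[OF kK]] by (auto simp: E_def)
      ultimately show ?thesis by blast
    qed
    then obtain C where C: "\<And>k. k \<in> K' \<Longrightarrow> C k \<in> sets (N k)"
      "\<And>k. k \<in> K' \<Longrightarrow> (\<Inter>j\<in>J k. E j) = V k -` C k \<inter> space M" by metis
    have "prob (\<Inter>j\<in>L. A j) = prob (\<Inter>k\<in>K'. V k -` C k \<inter> space M)"
      unfolding inter using C(2) by (intro arg_cong[where f = prob] INF_cong) auto
    also have "\<dots> = (\<Prod>k\<in>K'. prob (V k -` C k \<inter> space M))"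
      using C(1) K' by (intro indep_varsD[OF ind]) auto
    also have "\<dots> = (\<Prod>k\<in>K'. \<Prod>j\<in>J k. prob (E j))"
    proof (rule prod.cong)
      fix k assume "k \<in> K'"
      then have "V k -` C k \<inter> space M = (\<Inter>j\<in>J k. X j -` B' j \<inter> space M)" and kK: "k \<in> K"
        using C(2) K' by (auto simp only: E_def)
      then show "prob (V k -` C k \<inter> space M) = (\<Prod>j\<in>J k. prob (E j))"
        unfolding E_def by (simp only: block[OF kK B'])
    qed simp
    also have "\<dots> = (\<Prod>j\<in>(\<Union>k\<in>K'. J k). prob (E j))"
    proof (rule prod.UNION_disjoint[symmetric])
      show "\<forall>i\<in>K'. \<forall>j\<in>K'. i \<noteq> j \<longrightarrow> J i \<inter> J j = {}"
        using disj K'(2) unfolding disjoint_family_on_def by blast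
    qed (use K' fin in auto)
    also have "\<dots> = (\<Prod>j\<in>L. prob (E j))"
    proof (rule prod.mono_neutral_right)
      show "finite (\<Union>k\<in>K'. J k)" using K' fin by auto
      show "L \<subseteq> (\<Union>k\<in>K'. J k)" using \<kappa>(2) by (auto simp: K'_def)
      show "\<forall>i\<in>(\<Union>k\<in>K'. J k) - L. prob (E i) = 1" using E_full prob_space by auto
    qed
    also have "\<dots> = (\<Prod>j\<in>L. prob (A j))" using E_A by simp
    finally show "prob (\<Inter>j\<in>L. A j) = (\<Prod>j\<in>L. prob (A j))" .
  qed
qed

text \<open>The squares of \<open>(u + v) / 2\<close> and \<open>(u - v) / 2\<close> add up to
  \<open>(u^2 + v^2) / 2\<close>. The factor 2 is the absolute Jacobian determinant of the map from
  \<open>(x, y)\<close> to \<open>(x + y, x - y)\<close>.\<close>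

lemma normal_density_rotate:
  assumes "\<sigma> > 0"
  shows "normal_density 0 \<sigma> ((u + v) / 2) * normal_density 0 \<sigma> ((u - v) / 2) =
    2 * (normal_density 0 (sqrt 2 * \<sigma>) u * normal_density 0 (sqrt 2 * \<sigma>) v)"
proof -
  have "exp (- ((u + v) / 2)\<^sup>2 / (2 * \<sigma>\<^sup>2)) * exp (- ((u - v) / 2)\<^sup>2 / (2 * \<sigma>\<^sup>2)) =
      exp (- u\<^sup>2 / (2 * (sqrt 2 * \<sigma>)\<^sup>2)) * exp (- v\<^sup>2 / (2 * (sqrt 2 * \<sigma>)\<^sup>2))"
    using assms by (simp add: exp_add[symmetric] power_mult_distrib field_simps power2_sum power2_diff)
  moreover have "(sqrt (2 * pi * (sqrt 2 * \<sigma>)\<^sup>2))\<^sup>2 = 2 * (sqrt (2 * pi * \<sigma>\<^sup>2))\<^sup>2"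
    by (simp add: power_mult_distrib)
  ultimately show ?thesis
    by (simp add: normal_density_def power2_eq_square[of "sqrt _", symmetric] field_simps)
qed

text \<open>The planar substitution is carried out one variable at a time: \<open>x = u - y\<close>
  for fixed \<open>y\<close>, an exchange of the integrals, and \<open>y = (u - v) / 2\<close> for
  fixed \<open>u\<close>.\<close>

lemma nn_integral_normal_rotate:
  fixes F :: "real \<times> real \<Rightarrow> ennreal"
  assumes F [measurable]: "F \<in> borel_measurable (borel \<Otimes>\<^sub>M borel)" and \<sigma>: "\<sigma> > 0"
  defines "g \<equiv> normal_density 0 \<sigma>" and "G \<equiv> normal_density 0 (sqrt 2 * \<sigma>)"
  shows "(\<integral>\<^sup>+y. \<integral>\<^sup>+x. F (x + y, x - y) * (ennreal (g x) * ennreal (g y)) \<partial>lborel \<partial>lborel) =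
    (\<integral>\<^sup>+u. \<integral>\<^sup>+v. F (u, v) * (ennreal (G u) * ennreal (G v)) \<partial>lborel \<partial>lborel)"
proof -
  have [measurable]: "g \<in> borel_measurable borel" "G \<in> borel_measurable borel" by (simp_all add: g_def G_def)
  have "(\<integral>\<^sup>+y. \<integral>\<^sup>+x. F (x + y, x - y) * (ennreal (g x) * ennreal (g y)) \<partial>lborel \<partial>lborel) =
      (\<integral>\<^sup>+y. \<integral>\<^sup>+u. F (u, u - 2 * y) * (ennreal (g (u - y)) * ennreal (g y)) \<partial>lborel \<partial>lborel)"
  proof (rule nn_integral_cong)
    fix y :: real
    show "(\<integral>\<^sup>+x. F (x + y, x - y) * (ennreal (g x) * ennreal (g y)) \<partial>lborel) =
      (\<integral>\<^sup>+u. F (u, u - 2 * y) * (ennreal (g (u - y)) * ennreal (g y)) \<partial>lborel)"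
      by (subst nn_integral_real_affine[where c = 1 and t = "- y"]) (auto simp: algebra_simps)
  qed
  also have "\<dots> = (\<integral>\<^sup>+u. \<integral>\<^sup>+y. F (u, u - 2 * y) * (ennreal (g (u - y)) * ennreal (g y)) \<partial>lborel \<partial>lborel)"
    by (rule lborel_pair.Fubini') measurable
  also have "\<dots> = (\<integral>\<^sup>+u. \<integral>\<^sup>+v. F (u, v) * (ennreal (G u) * ennreal (G v)) \<partial>lborel \<partial>lborel)"
  proof (rule nn_integral_cong)
    fix u :: real
    have "(\<integral>\<^sup>+y. F (u, u - 2 * y) * (ennreal (g (u - y)) * ennreal (g y)) \<partial>lborel) =
        ennreal (1 / 2) * (\<integral>\<^sup>+v. F (u, v) * (ennreal (g ((u + v) / 2)) * ennreal (g ((u - v) / 2))) \<partial>lborel)"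
      by (subst nn_integral_real_affine[where c = "- 1 / 2" and t = "u / 2"]) (auto simp: field_simps)
    also have "\<dots> = (\<integral>\<^sup>+v. ennreal (1 / 2) * (F (u, v) * (ennreal (g ((u + v) / 2)) * ennreal (g ((u - v) / 2)))) \<partial>lborel)"
      by (rule nn_integral_cmult[symmetric]) measurable
    also have "\<dots> = (\<integral>\<^sup>+v. F (u, v) * (ennreal (G u) * ennreal (G v)) \<partial>lborel)"
    proof (rule nn_integral_cong)
      fix v :: real
      have "ennreal (g ((u + v) / 2) * g ((u - v) / 2)) = ennreal (g ((u + v) / 2)) * ennreal (g ((u - v) / 2))"
        by (rule ennreal_mult) (simp_all add: g_def)
      then have "ennreal (1 / 2) * (ennreal (g ((u + v) / 2)) * ennreal (g ((u - v) / 2))) =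
          ennreal (1 / 2 * (g ((u + v) / 2) * g ((u - v) / 2)))"
        by (subst ennreal_mult) (simp_all add: g_def)
      also have "\<dots> = ennreal (G u) * ennreal (G v)"
        unfolding g_def G_def normal_density_rotate[OF \<sigma>] by (simp add: ennreal_mult)
      finally show "ennreal (1 / 2) * (F (u, v) * (ennreal (g ((u + v) / 2)) * ennreal (g ((u - v) / 2)))) =
          F (u, v) * (ennreal (G u) * ennreal (G v))"
        by (metis mult.left_commute)
    qed
    finally show "(\<integral>\<^sup>+y. F (u, u - 2 * y) * (ennreal (g (u - y)) * ennreal (g y)) \<partial>lborel) =
      (\<integral>\<^sup>+v. F (u, v) * (ennreal (G u) * ennreal (G v)) \<partial>lborel)" .
  qed
  finally show ?thesis .
qed

text \<open>The marginal laws are known separately, so independence amounts to the joint law of sum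
  and difference being their product. This is read off from the rotated integral with the indicator
  of a Borel set.\<close>

lemma (in prob_space) indep_normal_sum_diff:
  assumes ind: "indep_var borel X borel Y" and \<sigma>: "\<sigma> > 0"
    and X: "distributed M lborel X (normal_density 0 \<sigma>)" and Y: "distributed M lborel Y (normal_density 0 \<sigma>)"
  shows "distributed M lborel (\<lambda>\<omega>. X \<omega> + Y \<omega>) (normal_density 0 (sqrt 2 * \<sigma>))"
    and "distributed M lborel (\<lambda>\<omega>. X \<omega> - Y \<omega>) (normal_density 0 (sqrt 2 * \<sigma>))"
    and "indep_var borel (\<lambda>\<omega>. X \<omega> + Y \<omega>) borel (\<lambda>\<omega>. X \<omega> - Y \<omega>)"
proof -
  have s: "sqrt (\<sigma>\<^sup>2 + \<sigma>\<^sup>2) = sqrt 2 * \<sigma>" using \<sigma> by (simp add: real_sqrt_mult flip: mult_2)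
  show P: "distributed M lborel (\<lambda>\<omega>. X \<omega> + Y \<omega>) (normal_density 0 (sqrt 2 * \<sigma>))"
    using add_indep_normal[OF ind \<sigma> \<sigma> X Y, unfolded s] by simp
  show Q: "distributed M lborel (\<lambda>\<omega>. X \<omega> - Y \<omega>) (normal_density 0 (sqrt 2 * \<sigma>))"
    using diff_indep_normal[OF ind \<sigma> \<sigma> X Y, unfolded s] by simp
  have [measurable]: "X \<in> borel_measurable M" "Y \<in> borel_measurable M"
    using X Y by (auto simp: distributed_def)
  have distr: "distr M borel Z = density lborel f" if "distributed M lborel Z f" for Z :: "'a \<Rightarrow> real" and f
    using distributed_distr_eq_density[OF that] by (simp cong: distr_cong)
  define N where "N \<sigma> = density lborel (normal_density 0 \<sigma>)" for \<sigma>
  have N: "prob_space (N \<sigma>)" if "\<sigma> > 0" for \<sigma>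
    unfolding N_def by (rule prob_space_normal_density[OF that])
  \<comment> \<open>Integrals against the normal laws are written with densities, where substitution
    for Lebesgue measure applies.\<close>
  have N_int: "(\<integral>\<^sup>+u. \<integral>\<^sup>+v. H u v \<partial>N \<sigma> \<partial>N \<sigma>) =
      (\<integral>\<^sup>+u. \<integral>\<^sup>+v. H u v * (ennreal (normal_density 0 \<sigma> u) * ennreal (normal_density 0 \<sigma> v)) \<partial>lborel \<partial>lborel)"
    if [measurable]: "case_prod H \<in> borel_measurable (borel \<Otimes>\<^sub>M borel)" for H :: "real \<Rightarrow> real \<Rightarrow> ennreal" and \<sigma>
  proof -
    have "(\<integral>\<^sup>+u. \<integral>\<^sup>+v. H u v \<partial>N \<sigma> \<partial>N \<sigma>) =
        (\<integral>\<^sup>+u. \<integral>\<^sup>+v. ennreal (normal_density 0 \<sigma> v) * H u v \<partial>lborel \<partial>N \<sigma>)"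
      unfolding N_def by (intro nn_integral_cong nn_integral_density) measurable
    also have "\<dots> = (\<integral>\<^sup>+u. ennreal (normal_density 0 \<sigma> u) * (\<integral>\<^sup>+v. ennreal (normal_density 0 \<sigma> v) * H u v \<partial>lborel) \<partial>lborel)"
      unfolding N_def by (rule nn_integral_density) measurable
    also have "\<dots> = (\<integral>\<^sup>+u. \<integral>\<^sup>+v. ennreal (normal_density 0 \<sigma> u) * (ennreal (normal_density 0 \<sigma> v) * H u v) \<partial>lborel \<partial>lborel)"
      by (intro nn_integral_cong nn_integral_cmult[symmetric]) measurable
    finally show ?thesis by (simp add: mult_ac)
  qed
  have pos: "sqrt 2 * \<sigma> > 0" using \<sigma> by simp
  interpret N1: prob_space "N \<sigma>" by (rule N[OF \<sigma>])
  interpret N2: prob_space "N (sqrt 2 * \<sigma>)" by (rule N[OF pos])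
  interpret NN: pair_prob_space "N \<sigma>" "N \<sigma>" ..
  have sets_N [measurable_cong]: "sets (N \<sigma>) = sets borel" for \<sigma> by (simp add: N_def)
  have XY: "distr M (borel \<Otimes>\<^sub>M borel) (\<lambda>\<omega>. (X \<omega>, Y \<omega>)) = N \<sigma> \<Otimes>\<^sub>M N \<sigma>"
    using ind unfolding indep_var_distribution_eq distr[OF X] distr[OF Y] N_def by simp
  have "distr M (borel \<Otimes>\<^sub>M borel) (\<lambda>\<omega>. (X \<omega> + Y \<omega>, X \<omega> - Y \<omega>)) = N (sqrt 2 * \<sigma>) \<Otimes>\<^sub>M N (sqrt 2 * \<sigma>)"
  proof (rule measure_eqI)
    show "sets (distr M (borel \<Otimes>\<^sub>M borel) (\<lambda>\<omega>. (X \<omega> + Y \<omega>, X \<omega> - Y \<omega>))) = sets (N (sqrt 2 * \<sigma>) \<Otimes>\<^sub>M N (sqrt 2 * \<sigma>))"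
      by (simp add: sets_N cong: sets_pair_measure_cong)
    fix B assume "B \<in> sets (distr M (borel \<Otimes>\<^sub>M borel) (\<lambda>\<omega>. (X \<omega> + Y \<omega>, X \<omega> - Y \<omega>)))"
    then have [measurable]: "B \<in> sets (borel \<Otimes>\<^sub>M borel)" by simp
    have "emeasure (distr M (borel \<Otimes>\<^sub>M borel) (\<lambda>\<omega>. (X \<omega> + Y \<omega>, X \<omega> - Y \<omega>))) B =
        (\<integral>\<^sup>+z. indicator B z \<partial>distr M (borel \<Otimes>\<^sub>M borel) (\<lambda>\<omega>. (X \<omega> + Y \<omega>, X \<omega> - Y \<omega>)))"
      by simp
    also have "\<dots> = (\<integral>\<^sup>+\<omega>. indicator B (X \<omega> + Y \<omega>, X \<omega> - Y \<omega>) \<partial>M)"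
      by (rule nn_integral_distr) measurable
    also have "\<dots> = (\<integral>\<^sup>+z. indicator B (fst z + snd z, fst z - snd z) \<partial>distr M (borel \<Otimes>\<^sub>M borel) (\<lambda>\<omega>. (X \<omega>, Y \<omega>)))"
      by (subst nn_integral_distr) (auto, measurable)
    also have "\<dots> = (\<integral>\<^sup>+y. \<integral>\<^sup>+x. indicator B (x + y, x - y) \<partial>N \<sigma> \<partial>N \<sigma>)"
      unfolding XY by (subst NN.nn_integral_snd[symmetric]) (auto, measurable)
    also have "\<dots> = (\<integral>\<^sup>+u. \<integral>\<^sup>+v. indicator B (u, v) \<partial>N (sqrt 2 * \<sigma>) \<partial>N (sqrt 2 * \<sigma>))"
      using nn_integral_normal_rotate[of "indicator B" \<sigma>] \<sigma>
      by (simp add: N_int mult.commute)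
    also have "\<dots> = emeasure (N (sqrt 2 * \<sigma>) \<Otimes>\<^sub>M N (sqrt 2 * \<sigma>)) B"
      by (subst N2.emeasure_pair_measure) (auto simp: sets_N cong: sets_pair_measure_cong)
    finally show "emeasure (distr M (borel \<Otimes>\<^sub>M borel) (\<lambda>\<omega>. (X \<omega> + Y \<omega>, X \<omega> - Y \<omega>))) B =
      emeasure (N (sqrt 2 * \<sigma>) \<Otimes>\<^sub>M N (sqrt 2 * \<sigma>)) B" .
  qed
  then show "indep_var borel (\<lambda>\<omega>. X \<omega> + Y \<omega>) borel (\<lambda>\<omega>. X \<omega> - Y \<omega>)"
    unfolding indep_var_distribution_eq distr[OF P] distr[OF Q] N_def by simp
qed

section \<open>Levy's construction\<close>

lemma (in prob_space) indep_vars_pair: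
  assumes "indep_vars (\<lambda>_. borel) U I" "i \<in> I" "j \<in> I" "i \<noteq> j"
  shows "indep_var borel (U i) borel (U j)"
proof -
  have "indep_var (PiM {i} (\<lambda>_. borel)) (\<lambda>\<omega>. restrict (\<lambda>i. U i \<omega>) {i}) (PiM {j} (\<lambda>_. borel)) (\<lambda>\<omega>. restrict (\<lambda>i. U i \<omega>) {j})"
    using assms by (intro indep_var_restrict) auto
  from indep_var_compose[OF this measurable_component_singleton measurable_component_singleton, of i j]
  show ?thesis by (simp add: comp_def)
qed

text \<open>
  One step of Levy's construction on sequences: the first \<open>2 ^ n\<close> entries are the increments over
  the intervals of level \<open>n\<close>, the others are fresh standard normal variables, of which the next
  \<open>2 ^ n\<close> are used to split the increments into halves.
\<close>

definition levy_split :: "real \<Rightarrow> nat \<Rightarrow> (nat \<Rightarrow> real) \<Rightarrow> nat \<Rightarrow> real" where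
  "levy_split T n v i = (if i < 2 ^ Suc n
     then (v (i div 2) + (if even i then 1 else - 1) * (sqrt (T / 2 ^ n) * v (2 ^ n + i div 2))) / 2
     else v i)"

definition levy_sd :: "real \<Rightarrow> nat \<Rightarrow> nat \<Rightarrow> real" where
  "levy_sd T n i = (if i < 2 ^ n then sqrt (T / 2 ^ n) else 1)"

text \<open>Scaling the fresh variable by \<open>s\<close> gives it the variance of the parent
  increment. Sum and difference are then independent, and halving them leaves half of the parent's
  variance.\<close>

lemma (in prob_space) levy_split_indep:
  assumes T: "0 < T" and ind: "indep_vars (\<lambda>_. borel) U UNIV"
    and U: "\<And>i. distributed M lborel (U i) (normal_density 0 (levy_sd T n i))"
  defines "U' \<equiv> \<lambda>i \<omega>. levy_split T n (\<lambda>i. U i \<omega>) i"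
  shows "indep_vars (\<lambda>_. borel) U' UNIV"
    and "distributed M lborel (U' i) (normal_density 0 (levy_sd T (Suc n) i))"
proof -
  define s where "s = sqrt (T / 2 ^ n)"
  have s: "s > 0" using T by (simp add: s_def)
  have pair: "distributed M lborel (U' (2 * k)) (normal_density 0 (sqrt (T / 2 ^ Suc n))) \<and>
      distributed M lborel (U' (Suc (2 * k))) (normal_density 0 (sqrt (T / 2 ^ Suc n))) \<and>
      indep_var borel (U' (2 * k)) borel (U' (Suc (2 * k)))" if k: "k < 2 ^ n" for k
  proof -
    have X: "distributed M lborel (U k) (normal_density 0 s)"
      using U[of k] k by (simp add: levy_sd_def s_def)
    have "distributed M lborel (U (2 ^ n + k)) (normal_density 0 1)"
      using U[of "2 ^ n + k"] by (simp add: levy_sd_def)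
    from normal_density_affine[OF this, of s 0]
    have Y: "distributed M lborel (\<lambda>\<omega>. s * U (2 ^ n + k) \<omega>) (normal_density 0 s)" using s by simp
    have "indep_var borel (U k) borel (U (2 ^ n + k))"
      by (rule indep_vars_pair[OF ind]) auto
    from indep_var_compose[OF this, of "\<lambda>x. x" borel "\<lambda>x. s * x" borel]
    have "indep_var borel (U k) borel (\<lambda>\<omega>. s * U (2 ^ n + k) \<omega>)" by (simp add: comp_def)
    note rot = indep_normal_sum_diff[OF this s X Y]
    have e: "U' (2 * k) = (\<lambda>\<omega>. (U k \<omega> + s * U (2 ^ n + k) \<omega>) / 2)"
      "U' (Suc (2 * k)) = (\<lambda>\<omega>. (U k \<omega> - s * U (2 ^ n + k) \<omega>) / 2)"
      using k by (auto simp: U'_def levy_split_def s_def)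
    have sd: "sqrt 2 * s / 2 = sqrt (T / 2 ^ Suc n)"
      by (simp add: s_def real_sqrt_divide real_sqrt_mult real_div_sqrt field_simps)
    have pos: "0 < sqrt 2 * s" using s by simp
    show ?thesis
      unfolding e
      using normal_density_affine[OF rot(1) pos, of "1 / 2" 0] normal_density_affine[OF rot(2) pos, of "1 / 2" 0]
        indep_var_compose[OF rot(3), of "\<lambda>x. x / 2" borel "\<lambda>x. x / 2" borel]
      by (simp add: comp_def sd)
  qed
  have tail: "U' i = U i" if "\<not> i < 2 ^ Suc n" for i
    using that by (auto simp: U'_def levy_split_def)
  have normal: "distributed M lborel (U' i) (normal_density 0 (levy_sd T (Suc n) i))" for i
  proof (cases "i < 2 ^ Suc n")
    case True
    then have k: "i div 2 < 2 ^ n" by auto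
    show ?thesis
    proof (cases "even i")
      case True
      then have "i = 2 * (i div 2)" by simp
      then show ?thesis using pair[OF k] \<open>i < 2 ^ Suc n\<close> by (metis levy_sd_def)
    next
      case False
      then have "i = Suc (2 * (i div 2))" by simp
      then show ?thesis using pair[OF k] \<open>i < 2 ^ Suc n\<close> by (metis levy_sd_def)
    qed
  next
    case False
    then have "\<not> i < 2 ^ n" by simp
    then show ?thesis using False U[of i] by (simp add: tail levy_sd_def del: power_Suc)
  qed
  then show "distributed M lborel (U' i) (normal_density 0 (levy_sd T (Suc n) i))" .
  have U'_rv: "U' i \<in> borel_measurable M" for i
    using normal[of i] by (auto simp: distributed_def)
  \<comment> \<open>Block \<open>k\<close> consumes the inputs \<open>k\<close> and
    \<open>2 ^ n + k\<close> and produces the outputs \<open>2 * k\<close> and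
    \<open>2 * k + 1\<close>. The indices from \<open>2 ^ n\<close> to \<open>2 ^ Suc n - 1\<close>
    name no block of their own, since their inputs are consumed as partners.\<close>
  define K :: "nat set" where "K = {..<2 ^ n} \<union> {2 ^ Suc n..}"
  define B where "B k = (if k < 2 ^ n then {k, 2 ^ n + k} else {k})" for k :: nat
  define J where "J k = (if k < 2 ^ n then {2 * k, Suc (2 * k)} else {k})" for k :: nat
  have "indep_vars (\<lambda>_. borel) U' (\<Union>k\<in>K. J k)"
  proof (rule indep_vars_refine)
    show "indep_vars (\<lambda>k. PiM (B k) (\<lambda>_. borel)) (\<lambda>k \<omega>. restrict (\<lambda>i. U i \<omega>) (B k)) K"
      by (rule indep_vars_restrict[OF ind]) (auto simp: disjoint_family_on_def B_def K_def)
    show "disjoint_family_on J K"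
      by (auto simp: disjoint_family_on_def J_def K_def)
    show "finite (J k)" for k by (simp add: J_def)
    show "\<exists>h\<in>measurable (PiM (B k) (\<lambda>_. borel)) borel. \<forall>\<omega>\<in>space M. U' i \<omega> = h (restrict (\<lambda>i. U i \<omega>) (B k))"
      if k: "k \<in> K" and i: "i \<in> J k" for k i
    proof (cases "k < 2 ^ n")
      case True
      then have ik: "i div 2 = k" "i < 2 ^ Suc n" using i by (auto simp: J_def)
      have [measurable]: "(\<lambda>v. v k) \<in> measurable (PiM (B k) (\<lambda>_. borel)) borel"
        "(\<lambda>v. v (2 ^ n + k)) \<in> measurable (PiM (B k) (\<lambda>_. borel)) borel"
        using True by (auto simp: B_def intro!: measurable_component_singleton)
      show ?thesis
      proof (intro bexI[of _ "\<lambda>v. (v k + (if even i then 1 else - 1) * (sqrt (T / 2 ^ n) * v (2 ^ n + k))) / 2"] ballI)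
        show "U' i \<omega> = (restrict (\<lambda>i. U i \<omega>) (B k) k + (if even i then 1 else - 1) *
            (sqrt (T / 2 ^ n) * restrict (\<lambda>i. U i \<omega>) (B k) (2 ^ n + k))) / 2" for \<omega>
          unfolding U'_def levy_split_def ik(1) using ik(2) True by (simp add: B_def)
      qed measurable
    next
      case False
      then have "i = k" "\<not> k < 2 ^ Suc n" using i k by (auto simp: J_def K_def)
      then show ?thesis
        using False by (intro bexI[of _ "\<lambda>v. v k"] ballI) (auto simp: B_def tail intro!: measurable_component_singleton)
    qed
    show "prob (\<Inter>i\<in>J k. U' i -` A i \<inter> space M) = (\<Prod>i\<in>J k. prob (U' i -` A i \<inter> space M))"
      if k: "k \<in> K" and A: "\<And>i. i \<in> J k \<Longrightarrow> A i \<in> sets borel" for k A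
    proof (cases "k < 2 ^ n")
      case True
      have "prob ((\<lambda>\<omega>. (U' (2 * k) \<omega>, U' (Suc (2 * k)) \<omega>)) -` (A (2 * k) \<times> A (Suc (2 * k))) \<inter> space M) =
          prob (U' (2 * k) -` A (2 * k) \<inter> space M) * prob (U' (Suc (2 * k)) -` A (Suc (2 * k)) \<inter> space M)"
        using pair[OF True] A True by (intro indep_varD) (auto simp: J_def)
      also have "(\<lambda>\<omega>. (U' (2 * k) \<omega>, U' (Suc (2 * k)) \<omega>)) -` (A (2 * k) \<times> A (Suc (2 * k))) \<inter> space M =
          (\<Inter>i\<in>J k. U' i -` A i \<inter> space M)"
        using True by (auto simp: J_def)
      finally show ?thesis using True by (simp add: J_def)
    qed (simp add: J_def)
  qed
  also have "(\<Union>k\<in>K. J k) = UNIV"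
  proof -
    have "i \<in> (\<Union>k\<in>K. J k)" for i
    proof (cases "i < 2 ^ Suc n")
      case True
      then have "i div 2 < 2 ^ n" by auto
      then have "i \<in> J (i div 2)" "i div 2 \<in> K" by (auto simp: J_def K_def)
      then show ?thesis by blast
    next
      case False
      then have "i \<in> J i" "i \<in> K" by (auto simp: J_def K_def)
      then show ?thesis by blast
    qed
    then show ?thesis by blast
  qed
  finally show "indep_vars (\<lambda>_. borel) U' UNIV" .
qed

primrec levy :: "real \<Rightarrow> nat \<Rightarrow> (nat \<Rightarrow> real) \<Rightarrow> nat \<Rightarrow> real" where
  "levy T 0 z = z"
| "levy T (Suc n) z = levy_split T n (levy T n z)"

lemma levy_halves:
  "k < 2 ^ n \<Longrightarrow> levy T n z k = levy T (Suc n) z (2 * k) + levy T (Suc n) z (Suc (2 * k))"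
  by (simp add: levy_split_def field_simps)

locale dyadic_increments = prob_space +
  fixes T :: real and D :: "nat \<Rightarrow> nat \<Rightarrow> 'a \<Rightarrow> real"
  assumes T_pos: "0 < T"
    and D_indep: "\<And>n. indep_vars (\<lambda>_. borel) (D n) {..<2 ^ n}"
    and D_normal: "\<And>n k. k < 2 ^ n \<Longrightarrow> distributed M lborel (D n k) (normal_density 0 (sqrt (T / 2 ^ n)))"
    and D_halves: "\<And>n k \<omega>. k < 2 ^ n \<Longrightarrow> D n k \<omega> = D (Suc n) (2 * k) \<omega> + D (Suc n) (Suc (2 * k)) \<omega>"

text \<open>The product runs over all real indices so that its points have the type
  \<open>real \<Rightarrow> real\<close>; only coordinates at natural numbers are read. Coordinate 0
  has variance \<open>T\<close> because it is the increment over the whole interval.\<close>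

lemma ex_dyadic_increments:
  assumes "0 < T"
  shows "\<exists>(M :: (real \<Rightarrow> real) measure) D. dyadic_increments M T D"
proof -
  define N where "N x = density lborel (\<lambda>y. ennreal (normal_density 0 (if x = 0 then sqrt T else 1) y))" for x :: real
  have N: "prob_space (N x)" for x
    unfolding N_def using assms by (intro prob_space_normal_density) auto
  have sets_N [measurable_cong]: "sets (N x) = sets borel" for x by (simp add: N_def)
  define M where "M = PiM UNIV N"
  define U where "U i \<omega> = \<omega> (real i)" for i and \<omega> :: "real \<Rightarrow> real"
  interpret prob_space M unfolding M_def by (intro prob_space_PiM N)
  have U_rv: "U i \<in> borel_measurable M" for i
    unfolding U_def[abs_def] M_def using measurable_component_singleton[of "real i" UNIV N] by (simp cong: measurable_cong_sets)
  have U_distr: "distr M borel (U i) = N (real i)" for i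
    using distr_PiM_component[of UNIV N "real i"] N unfolding M_def U_def[abs_def]
    by (simp add: sets_N cong: distr_cong)
  have "distr M (PiM UNIV (\<lambda>i. N (real i))) (\<lambda>\<omega>. \<lambda>i\<in>UNIV. \<omega> (real i)) = PiM UNIV (\<lambda>i. N (real i))"
    unfolding M_def using N by (intro distr_PiM_reindex) (auto simp: inj_on_def)
  moreover have "distr M (PiM UNIV (\<lambda>i. N (real i))) (\<lambda>\<omega>. \<lambda>i\<in>UNIV. \<omega> (real i)) = distr M (PiM UNIV (\<lambda>_. borel)) (\<lambda>\<omega>. \<lambda>i\<in>UNIV. U i \<omega>)"
    unfolding U_def by (intro distr_cong sets_PiM_cong) (auto simp: sets_N)
  ultimately have U_indep: "indep_vars (\<lambda>_. borel) U UNIV"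
    by (subst indep_vars_iff_distr_eq_PiM) (auto simp: U_rv U_distr)
  have U_normal: "distributed M lborel (U i) (normal_density 0 (levy_sd T 0 i))" for i
    unfolding distributed_def
  proof (intro conjI)
    have "distr M lborel (U i) = N (real i)"
      unfolding U_distr[symmetric] by (intro distr_cong) auto
    then show "distr M lborel (U i) = density lborel (\<lambda>x. ennreal (normal_density 0 (levy_sd T 0 i) x))"
      by (simp add: N_def levy_sd_def)
  qed (use U_rv in auto)
  define D where "D n k \<omega> = levy T n (\<lambda>i. U i \<omega>) k" for n k \<omega>
  have D: "indep_vars (\<lambda>_. borel) (D n) UNIV \<and> (\<forall>i. distributed M lborel (D n i) (normal_density 0 (levy_sd T n i)))" for n
  proof (induction n)
    case 0
    then show ?case using U_indep U_normal by (simp add: D_def[abs_def])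
  next
    case (Suc n)
    have "D (Suc n) = (\<lambda>i \<omega>. levy_split T n (\<lambda>i. D n i \<omega>) i)"
      by (simp add: D_def fun_eq_iff)
    then show ?case using levy_split_indep[OF assms, of "D n" n] Suc by simp
  qed
  have "dyadic_increments M T D"
  proof
    show "indep_vars (\<lambda>_. borel) (D n) {..<2 ^ n}" for n
      using D indep_vars_subset by blast
    show "distributed M lborel (D n k) (normal_density 0 (sqrt (T / 2 ^ n)))" if "k < 2 ^ n" for n k
      using D[of n] that by (simp add: levy_sd_def) metis
    show "D n k \<omega> = D (Suc n) (2 * k) \<omega> + D (Suc n) (Suc (2 * k)) \<omega>" if "k < 2 ^ n" for n k \<omega>
      unfolding D_def by (rule levy_halves[OF that])
  qed fact
  then show ?thesis by blast
qed

section \<open>Brownian motion from dyadic increments\<close>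

lemma (in prob_space) char_of_normal:
  assumes Y: "distributed M lborel Y (normal_density 0 \<sigma>)" and \<sigma>: "0 < \<sigma>"
  shows "(CLINT \<omega>|M. iexp (u * Y \<omega>)) = complex_of_real (exp (- (\<sigma> * u)\<^sup>2 / 2))"
proof -
  have "distributed M lborel (\<lambda>\<omega>. Y \<omega> / \<sigma>) std_normal_density"
    using Y normal_standard_normal_convert[OF \<sigma>, of Y 0] by simp
  then have d: "distr M lborel (\<lambda>\<omega>. Y \<omega> / \<sigma>) = std_normal_distribution" and
    m: "(\<lambda>\<omega>. Y \<omega> / \<sigma>) \<in> measurable M lborel"
    by (auto simp: distributed_def)
  have "complex_of_real (exp (- (\<sigma> * u)\<^sup>2 / 2)) = char std_normal_distribution (\<sigma> * u)"
    by (simp add: char_std_normal_distribution)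
  also have "\<dots> = (CLINT x|distr M lborel (\<lambda>\<omega>. Y \<omega> / \<sigma>). iexp (\<sigma> * u * x))"
    by (simp add: char_def d)
  also have "\<dots> = (CLINT \<omega>|M. iexp (\<sigma> * u * (Y \<omega> / \<sigma>)))"
    by (rule integral_distr[OF m]) measurable
  also have "\<dots> = (CLINT \<omega>|M. iexp (u * Y \<omega>))"
    using \<sigma> by (simp add: mult.commute)
  finally show ?thesis by simp
qed

text \<open>
  Conditionally on an event of \<open>G\<close> the variable \<open>Y\<close> has the characteristic function of a normal
  variable, hence is normal by Levy's uniqueness theorem.
\<close>

lemma (in prob_space) normal_indep_of_char:
  assumes Y [measurable]: "Y \<in> borel_measurable M" and \<sigma>: "0 < \<sigma>"
    and G: "space G = space M" "sets G \<subseteq> events"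
    and char: "\<And>A u. A \<in> sets G \<Longrightarrow>
      (CLINT \<omega>|M. indicat_real A \<omega> *\<^sub>R iexp (u * Y \<omega>)) = complex_of_real (prob A * exp (- (\<sigma> * u)\<^sup>2 / 2))"
  shows "distributed M lborel Y (normal_density 0 \<sigma>)"
    and "indep_set (sets G) (sets (vimage_algebra (space M) Y borel))"
proof -
  define N where "N = density lborel (normal_density 0 \<sigma>)"
  have N: "prob_space N" unfolding N_def by (rule prob_space_normal_density[OF \<sigma>])
  have "sets N = sets borel" by (simp add: N_def)
  then have N_real: "real_distribution N"
    using N by (simp add: real_distribution_def real_distribution_axioms_def)
  have "distributed N lborel (\<lambda>x. x) (normal_density 0 \<sigma>)"
    unfolding distributed_def N_def by (auto simp: distr_id2)
  then have N_char: "char N u = complex_of_real (exp (- (\<sigma> * u)\<^sup>2 / 2))" for u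
    unfolding char_def by (rule prob_space.char_of_normal[OF N _ \<sigma>])
  have cond: "prob (A \<inter> (Y -` B \<inter> space M)) = prob A * measure N B"
    if A: "A \<in> sets G" and B: "B \<in> sets borel" for A B
  proof (cases "prob A = 0")
    case True
    have "prob (A \<inter> (Y -` B \<inter> space M)) \<le> prob A"
      using A G by (intro finite_measure_mono) auto
    then show ?thesis using True measure_nonneg[of M "A \<inter> (Y -` B \<inter> space M)"] by simp
  next
    case False
    then have pA: "prob A > 0" by (simp add: zero_less_measure_iff)
    have A' [measurable]: "A \<in> events" using A G by auto
    \<comment> \<open>\<open>Q\<close> is \<open>M\<close> conditioned on \<open>A\<close>; events
      of probability 0 were set aside for the division.\<close>
    define Q where "Q = density M (\<lambda>\<omega>. ennreal (indicat_real A \<omega> / prob A))"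
    have [measurable]: "(\<lambda>\<omega>. indicat_real A \<omega> / prob A) \<in> borel_measurable M"
      using A' by measurable
    have Q_eq: "emeasure Q C = ennreal (prob (A \<inter> C) / prob A)" if C: "C \<in> events" for C
    proof -
      have "emeasure Q C = (\<integral>\<^sup>+\<omega>. ennreal (1 / prob A) * indicator (A \<inter> C) \<omega> \<partial>M)"
        unfolding Q_def
        by (subst emeasure_density[OF _ C]) (measurable, auto intro!: nn_integral_cong simp: indicator_def)
      also have "\<dots> = ennreal (1 / prob A) * emeasure M (A \<inter> C)"
        using A' C by (intro nn_integral_cmult_indicator) auto
      finally show ?thesis by (simp add: emeasure_eq_measure ennreal_mult[symmetric])
    qed
    have "emeasure Q (space Q) = 1"
      using Q_eq[of "space M"] A' pA sets.sets_into_space[OF A'] by (simp add: Q_def Int_absorb2)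
    then have Q: "prob_space Q" by (rule prob_spaceI)
    have YQ: "Y \<in> borel_measurable Q" by (simp add: Q_def)
    have Q_real: "real_distribution (distr Q borel Y)"
      using prob_space.prob_space_distr[OF Q YQ] by (simp add: real_distribution_def real_distribution_axioms_def)
    have "char (distr Q borel Y) u = char N u" for u
    proof -
      have "char (distr Q borel Y) u = (CLINT \<omega>|Q. iexp (u * Y \<omega>))"
        unfolding char_def by (rule integral_distr[OF YQ]) measurable
      also have "\<dots> = (CLINT \<omega>|M. (indicat_real A \<omega> / prob A) *\<^sub>R iexp (u * Y \<omega>))"
        unfolding Q_def
      proof (rule integral_density)
        show "(\<lambda>\<omega>. iexp (u * Y \<omega>)) \<in> borel_measurable M" by measurable
      qed (fact, simp)
      also have "\<dots> = (CLINT \<omega>|M. (1 / prob A) *\<^sub>R (indicat_real A \<omega> *\<^sub>R iexp (u * Y \<omega>)))"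
        by simp
      also have "\<dots> = (1 / prob A) *\<^sub>R (CLINT \<omega>|M. indicat_real A \<omega> *\<^sub>R iexp (u * Y \<omega>))"
        by (rule integral_scaleR_right)
      also have "\<dots> = char N u"
        unfolding char[OF A] N_char using pA by (simp add: scaleR_conv_of_real)
      finally show ?thesis .
    qed
    then have "distr Q borel Y = N" by (intro Levy_uniqueness Q_real N_real ext)
    then have "emeasure N B = emeasure Q (Y -` B \<inter> space Q)"
      using emeasure_distr[OF YQ B] by simp
    also have "\<dots> = ennreal (prob (A \<inter> (Y -` B \<inter> space M)) / prob A)"
      using B by (simp add: Q_eq[symmetric]) (simp add: Q_def)
    finally have "measure N B = prob (A \<inter> (Y -` B \<inter> space M)) / prob A"
      by (simp add: measure_def)
    then show ?thesis using pA by simp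
  qed
  have marginal: "prob (Y -` B \<inter> space M) = measure N B" if "B \<in> sets borel" for B
    using cond[OF sets.top that] G prob_space by (simp add: Int_absorb1)
  interpret N: prob_space N by (rule N)
  have "distr M lborel Y = N"
  proof (rule measure_eqI)
    fix B assume B: "B \<in> sets (distr M lborel Y)"
    then show "emeasure (distr M lborel Y) B = emeasure N B"
      using marginal[of B] by (simp add: emeasure_distr emeasure_eq_measure N.emeasure_eq_measure)
  qed (simp add: N_def)
  then show "distributed M lborel Y (normal_density 0 \<sigma>)"
    by (simp add: distributed_def N_def)
  have vi: "sets (vimage_algebra (space M) Y borel) = {Y -` B \<inter> space M |B. B \<in> sets borel}"
    by (rule sets_vimage_algebra2) auto
  show "indep_set (sets G) (sets (vimage_algebra (space M) Y borel))"
    unfolding indep_sets2_eq vi using G(2) cond marginal by (auto intro: measurable_sets)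
qed

section \<open>The dyadic cell of a time\<close>

definition cell :: "real \<Rightarrow> nat \<Rightarrow> real \<Rightarrow> nat" where
  "cell T n t = nat \<lfloor>2 ^ n * t / T\<rfloor>"

context
  fixes T :: real
  assumes T: "0 < T"
begin

lemma cell_mono: "s \<le> t \<Longrightarrow> cell T n s \<le> cell T n t"
  unfolding cell_def using T by (intro nat_mono floor_mono divide_right_mono mult_left_mono) auto

lemma cell_grid: "m \<le> n \<Longrightarrow> cell T n (grid T m j) = j * 2 ^ (n - m)"
proof -
  assume "m \<le> n"
  then have "2 ^ n * grid T m j / T = real (j * 2 ^ (n - m))"
    using T by (simp add: grid_def field_simps flip: power_add)
  then show ?thesis unfolding cell_def by (simp only: floor_of_nat nat_int)
qed

lemma cell_le: "t \<le> grid T m j \<Longrightarrow> m \<le> n \<Longrightarrow> cell T n t \<le> j * 2 ^ (n - m)"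
  using cell_mono[of t "grid T m j" n] cell_grid[of m n j] by simp

lemma cell_le_end: "t \<le> T \<Longrightarrow> cell T n t \<le> 2 ^ n"
  using cell_le[of t 0 1 n] by (simp add: grid_def)

lemma cell_bounds:
  assumes "0 \<le> t"
  shows "grid T n (cell T n t) \<le> t" "t < grid T n (Suc (cell T n t))"
proof -
  have r: "real (cell T n t) = of_int \<lfloor>2 ^ n * t / T\<rfloor>"
    using assms T by (simp add: cell_def)
  have "real (cell T n t) \<le> 2 ^ n * t / T" "2 ^ n * t / T < real (cell T n t) + 1"
    unfolding r by linarith+
  then show "grid T n (cell T n t) \<le> t" "t < grid T n (Suc (cell T n t))"
    using T by (auto simp: grid_def field_simps)
qed

lemma cell_Suc:
  assumes "0 \<le> t"
  shows "cell T (Suc n) t = 2 * cell T n t \<or> cell T (Suc n) t = Suc (2 * cell T n t)"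
proof -
  define y where "y = 2 ^ n * t / T"
  have "0 \<le> y" using assms T by (simp add: y_def)
  have "cell T (Suc n) t = nat \<lfloor>2 * y\<rfloor>" "cell T n t = nat \<lfloor>y\<rfloor>"
    by (simp_all add: cell_def y_def mult.assoc)
  moreover have "\<lfloor>2 * y\<rfloor> = 2 * \<lfloor>y\<rfloor> \<or> \<lfloor>2 * y\<rfloor> = 2 * \<lfloor>y\<rfloor> + 1" by linarith
  moreover have "0 \<le> \<lfloor>y\<rfloor>" using \<open>0 \<le> y\<close> by simp
  ultimately show ?thesis by (auto simp: nat_add_distrib nat_mult_distrib)
qed

lemma cell_close:
  assumes "0 \<le> s" "t - s \<le> T / 2 ^ n"
  shows "cell T n t \<le> Suc (cell T n s)"
proof -
  have "2 ^ n * t / T \<le> 2 ^ n * s / T + 1"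
    using assms(2) T by (simp add: field_simps)
  then have "\<lfloor>2 ^ n * t / T\<rfloor> \<le> \<lfloor>2 ^ n * s / T\<rfloor> + 1" by linarith
  moreover have "0 \<le> \<lfloor>2 ^ n * s / T\<rfloor>" using assms(1) T by simp
  ultimately show ?thesis unfolding cell_def by linarith
qed

end

text \<open>The bound is imposed at every sample point, since \<open>continuous_paths\<close> allows
  no exceptional null set. The rate \<open>9 / 10\<close> is explained by
  \<open>AE_increments_small\<close>.\<close>

locale regular_dyadic_increments = dyadic_increments +
  assumes D_small: "\<And>\<omega>. \<omega> \<in> space M \<Longrightarrow> \<exists>m. \<forall>n\<ge>m. \<forall>k<2 ^ n. \<bar>D n k \<omega>\<bar> \<le> (9 / 10) ^ n"
begin

text \<open>Only cells completed by time \<open>t\<close> are counted, so \<open>step\<close> is the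
  value at the last grid point not after \<open>t\<close>.\<close>

definition step :: "nat \<Rightarrow> real \<Rightarrow> 'a \<Rightarrow> real" where
  "step n t \<omega> = (\<Sum>k<cell T n t. D n k \<omega>)"

definition W :: "real \<Rightarrow> 'a \<Rightarrow> real" where "W t \<omega> = lim (\<lambda>n. step n t \<omega>)"

lemma D_rv: "k < 2 ^ n \<Longrightarrow> D n k \<in> borel_measurable M"
  using D_indep[of n] by (simp add: indep_vars_def2)

lemma sum_refine_Suc: "a \<le> 2 ^ n \<Longrightarrow> (\<Sum>k<2 * a. D (Suc n) k \<omega>) = (\<Sum>k<a. D n k \<omega>)"
proof (induction a)
  case (Suc a)
  then show ?case using D_halves[of a n \<omega>] by simp
qed simp

lemma sum_refine: "a \<le> 2 ^ n \<Longrightarrow> (\<Sum>k<a * 2 ^ p. D (n + p) k \<omega>) = (\<Sum>k<a. D n k \<omega>)"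
proof (induction p)
  case (Suc p)
  have "a * 2 ^ p \<le> 2 ^ (n + p)" using Suc.prems by (simp add: power_add)
  from sum_refine_Suc[OF this] Suc show ?case by (simp add: mult_ac)
qed simp

text \<open>Sums over complete cells do not change under refinement, so passing to the next level
  adds at most one increment, that of a half cell.\<close>

lemma step_Suc:
  assumes t: "t \<in> {0..T}" and small: "\<forall>k<2 ^ Suc n. \<bar>D (Suc n) k \<omega>\<bar> \<le> (9 / 10) ^ Suc n"
  shows "\<bar>step (Suc n) t \<omega> - step n t \<omega>\<bar> \<le> (9 / 10) ^ Suc n"
proof -
  have le: "cell T n t \<le> 2 ^ n" "cell T (Suc n) t \<le> 2 ^ Suc n"
    using t by (auto intro!: cell_le_end[OF T_pos] simp del: power_Suc)
  consider "cell T (Suc n) t = 2 * cell T n t" | "cell T (Suc n) t = Suc (2 * cell T n t)"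
    using cell_Suc[OF T_pos, of t n] t by auto
  then show ?thesis
  proof cases
    case 1
    then show ?thesis using le by (simp add: step_def sum_refine_Suc)
  next
    case 2
    then have "step (Suc n) t \<omega> - step n t \<omega> = D (Suc n) (2 * cell T n t) \<omega>"
      using le by (simp add: step_def sum_refine_Suc)
    then show ?thesis using small 2 le(2) by auto
  qed
qed

text \<open>The factor 9 comes from the geometric tail: the powers of \<open>9 / 10\<close> beyond
  \<open>n\<close> sum to \<open>9 * (9 / 10) ^ n\<close>. The induction keeps the exact finite sum,
  which closes without loss.\<close>

lemma step_uniform:
  assumes \<omega>: "\<omega> \<in> space M"
  obtains m where "\<And>n t. m \<le> n \<Longrightarrow> t \<in> {0..T} \<Longrightarrow> \<bar>W t \<omega> - step n t \<omega>\<bar> \<le> 9 * (9 / 10) ^ n"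
    "\<And>t. t \<in> {0..T} \<Longrightarrow> (\<lambda>n. step n t \<omega>) \<longlonglongrightarrow> W t \<omega>"
    "\<And>n k. m \<le> n \<Longrightarrow> k < 2 ^ n \<Longrightarrow> \<bar>D n k \<omega>\<bar> \<le> (9 / 10) ^ n"
proof -
  obtain m where m: "\<And>n k. m \<le> n \<Longrightarrow> k < 2 ^ n \<Longrightarrow> \<bar>D n k \<omega>\<bar> \<le> (9 / 10) ^ n"
    using D_small[OF \<omega>] by blast
  have diff: "\<bar>step (n + p) t \<omega> - step n t \<omega>\<bar> \<le> 9 * (9 / 10) ^ n * (1 - (9 / 10) ^ p)"
    if n: "m \<le> n" and t: "t \<in> {0..T}" for n p t
  proof (induction p)
    case (Suc p)
    have incr: "\<bar>step (Suc (n + p)) t \<omega> - step (n + p) t \<omega>\<bar> \<le> (9 / 10) ^ Suc (n + p)"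
    proof (rule step_Suc[OF t], intro allI impI)
      fix k :: nat assume "k < 2 ^ Suc (n + p)"
      then show "\<bar>D (Suc (n + p)) k \<omega>\<bar> \<le> (9 / 10) ^ Suc (n + p)" by (rule m[rotated]) (use n in simp)
    qed
    have "\<bar>step (n + Suc p) t \<omega> - step n t \<omega>\<bar> \<le>
        \<bar>step (Suc (n + p)) t \<omega> - step (n + p) t \<omega>\<bar> + \<bar>step (n + p) t \<omega> - step n t \<omega>\<bar>"
      using abs_triangle_ineq[of "step (Suc (n + p)) t \<omega> - step (n + p) t \<omega>" "step (n + p) t \<omega> - step n t \<omega>"]
      by simp
    also have "\<dots> \<le> (9 / 10) ^ Suc (n + p) + 9 * (9 / 10) ^ n * (1 - (9 / 10) ^ p)"
      by (intro add_mono incr Suc)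
    also have "\<dots> = 9 * (9 / 10) ^ n * (1 - (9 / 10) ^ Suc p)"
      by (simp add: power_add algebra_simps)
    finally show ?case .
  qed simp
  have diff': "\<bar>step n' t \<omega> - step n t \<omega>\<bar> \<le> 9 * (9 / 10) ^ n" if "m \<le> n" "n \<le> n'" "t \<in> {0..T}" for n n' t
  proof -
    have "\<bar>step n' t \<omega> - step n t \<omega>\<bar> \<le> 9 * (9 / 10) ^ n * (1 - (9 / 10) ^ (n' - n))"
      using diff[OF that(1,3), of "n' - n"] that(2) by simp
    also have "\<dots> \<le> 9 * (9 / 10 :: real) ^ n * 1"
      by (intro mult_left_mono) auto
    finally show ?thesis by (simp only: mult_1_right)
  qed
  have null: "(\<lambda>n. 9 * (9 / 10 :: real) ^ n) \<longlonglongrightarrow> 0"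
    using tendsto_mult_right_zero[OF LIMSEQ_power_zero[of "9 / 10 :: real"], of 9] by simp
  have lim: "(\<lambda>n. step n t \<omega>) \<longlonglongrightarrow> W t \<omega>" if t: "t \<in> {0..T}" for t
  proof -
    have "Cauchy (\<lambda>n. step n t \<omega>)"
    proof (rule CauchyI')
      fix e :: real assume "0 < e"
      then obtain n0 where n0: "\<And>n. n0 \<le> n \<Longrightarrow> 9 * (9 / 10) ^ n < e"
        using order_tendstoD(2)[OF null, of e] by (auto simp: eventually_sequentially)
      have "dist (step n t \<omega>) (step n' t \<omega>) < e" if "max m n0 \<le> n" "n < n'" for n n'
        using diff'[of n n' t] n0[of n] that t by (auto simp: dist_real_def)
      then show "\<exists>n0. \<forall>n\<ge>n0. \<forall>n'>n. dist (step n t \<omega>) (step n' t \<omega>) < e" by blast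
    qed
    then show ?thesis unfolding W_def by (intro convergent_LIMSEQ_iff[THEN iffD1] Cauchy_convergent)
  qed
  have "\<bar>W t \<omega> - step n t \<omega>\<bar> \<le> 9 * (9 / 10) ^ n" if "m \<le> n" "t \<in> {0..T}" for n t
  proof (rule LIMSEQ_le_const2)
    show "(\<lambda>n'. \<bar>step n' t \<omega> - step n t \<omega>\<bar>) \<longlonglongrightarrow> \<bar>W t \<omega> - step n t \<omega>\<bar>"
      by (intro tendsto_intros lim that)
    show "\<exists>N. \<forall>n'\<ge>N. \<bar>step n' t \<omega> - step n t \<omega>\<bar> \<le> 9 * (9 / 10) ^ n"
      using diff'[OF that(1) _ that(2)] by blast
  qed
  then show ?thesis using that lim m by blast
qed

lemma W_limit: "\<omega> \<in> space M \<Longrightarrow> t \<in> {0..T} \<Longrightarrow> (\<lambda>n. step n t \<omega>) \<longlonglongrightarrow> W t \<omega>"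
  using step_uniform by metis

lemma W_continuous:
  assumes \<omega>: "\<omega> \<in> space M"
  shows "continuous_on {0..T} (\<lambda>t. W t \<omega>)"
proof -
  obtain m where m: "\<And>n t. m \<le> n \<Longrightarrow> t \<in> {0..T} \<Longrightarrow> \<bar>W t \<omega> - step n t \<omega>\<bar> \<le> 9 * (9 / 10) ^ n"
    "\<And>n k. m \<le> n \<Longrightarrow> k < 2 ^ n \<Longrightarrow> \<bar>D n k \<omega>\<bar> \<le> (9 / 10) ^ n"
    using step_uniform[OF \<omega>] by metis
  \<comment> \<open>19 is 9 + 1 + 9: two distances to the step function and the single increment by
    which it can change between such times.\<close>
  have main: "\<bar>W t \<omega> - W s \<omega>\<bar> \<le> 19 * (9 / 10) ^ n"
    if n: "m \<le> n" and st: "s \<in> {0..T}" "t \<in> {0..T}" "s \<le> t" "t - s \<le> T / 2 ^ n" for n s t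
  proof -
    have "cell T n t = cell T n s \<or> cell T n t = Suc (cell T n s)"
      using cell_close[OF T_pos _ st(4)] cell_mono[OF T_pos st(3), of n] st(1) by auto
    then have "\<bar>step n t \<omega> - step n s \<omega>\<bar> \<le> (9 / 10) ^ n"
    proof
      assume c: "cell T n t = Suc (cell T n s)"
      then have "cell T n s < 2 ^ n" using cell_le_end[OF T_pos, of t n] st(2) by simp
      then show ?thesis using m(2)[OF n] c by (simp add: step_def)
    qed (simp add: step_def)
    then show ?thesis using m(1)[OF n st(1)] m(1)[OF n st(2)] by linarith
  qed
  have null: "(\<lambda>n. 19 * (9 / 10 :: real) ^ n) \<longlonglongrightarrow> 0"
    using tendsto_mult_right_zero[OF LIMSEQ_power_zero[of "9 / 10 :: real"], of 19] by simp
  have "uniformly_continuous_on {0..T} (\<lambda>t. W t \<omega>)"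
    unfolding uniformly_continuous_on_def
  proof (intro allI impI)
    fix e :: real assume "e > 0"
    then obtain n0 where n0: "\<And>n. n0 \<le> n \<Longrightarrow> 19 * (9 / 10) ^ n < e"
      using order_tendstoD(2)[OF null, of e] by (auto simp: eventually_sequentially)
    define n where "n = max m n0"
    have "dist (W t \<omega>) (W s \<omega>) < e" if "s \<in> {0..T}" "t \<in> {0..T}" "dist t s < T / 2 ^ n" for s t
      using main[of n s t] main[of n t s] n0[of n] that
      by (cases "s \<le> t") (auto simp: n_def dist_real_def)
    then show "\<exists>d>0. \<forall>s\<in>{0..T}. \<forall>t\<in>{0..T}. dist t s < d \<longrightarrow> dist (W t \<omega>) (W s \<omega>) < e"
      using T_pos by (intro exI[of _ "T / 2 ^ n"]) auto
  qed
  then show ?thesis by (rule uniformly_continuous_imp_continuous)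
qed

lemma W_grid:
  assumes "\<omega> \<in> space M" "j \<le> 2 ^ m"
  shows "W (grid T m j) \<omega> = (\<Sum>k<j. D m k \<omega>)"
proof (rule LIMSEQ_unique)
  show "(\<lambda>n. step n (grid T m j) \<omega>) \<longlonglongrightarrow> W (grid T m j) \<omega>"
    using grid_in[of T j m] assms T_pos by (intro W_limit) auto
  have "step n (grid T m j) \<omega> = (\<Sum>k<j. D m k \<omega>)" if "m \<le> n" for n
    using sum_refine[OF assms(2), of "n - m" \<omega>] that by (simp add: step_def cell_grid[OF T_pos])
  then show "(\<lambda>n. step n (grid T m j) \<omega>) \<longlonglongrightarrow> (\<Sum>k<j. D m k \<omega>)"
    by (intro tendsto_eventually eventually_sequentiallyI)
qed

lemma W_measurable:
  assumes t: "t \<in> {0..T}"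
  shows "W t \<in> borel_measurable M"
proof (rule borel_measurable_LIMSEQ_real)
  show "step n t \<in> borel_measurable M" for n
    unfolding step_def using cell_le_end[OF T_pos, of t n] t
    by (intro borel_measurable_sum D_rv) auto
qed (rule W_limit[OF _ t])

section \<open>Increments of \<open>W\<close> between two grid points\<close>

context
  fixes m i j :: nat
  assumes ij: "i < j" "j \<le> 2 ^ m"
begin

abbreviation (input) "Y \<equiv> \<lambda>\<omega>. W (grid T m j) \<omega> - W (grid T m i) \<omega>"

text \<open>The level is free because the past is described at ever finer levels, and independence
  of \<open>Y\<close> from it is proved at each level separately.\<close>

lemma Y_sum:
  assumes "\<omega> \<in> space M"
  shows "Y \<omega> = (\<Sum>k\<in>{i * 2 ^ p..<j * 2 ^ p}. D (m + p) k \<omega>)"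
proof -
  have "Y \<omega> = (\<Sum>k<j * 2 ^ p. D (m + p) k \<omega>) - (\<Sum>k<i * 2 ^ p. D (m + p) k \<omega>)"
    using ij assms by (simp add: W_grid sum_refine)
  also have "\<dots> = (\<Sum>k\<in>{i * 2 ^ p..<j * 2 ^ p}. D (m + p) k \<omega>)"
    using ij by (simp add: lessThan_atLeast0 sum_diff_nat_ivl)
  finally show ?thesis .
qed

lemma Y_normal: "distributed M lborel Y (normal_density 0 (sqrt (grid T m j - grid T m i)))"
proof -
  have "distributed M lborel (\<lambda>\<omega>. \<Sum>k\<in>{i..<j}. D m k \<omega>)
      (normal_density (\<Sum>k\<in>{i..<j}. 0) (sqrt (\<Sum>k\<in>{i..<j}. (sqrt (T / 2 ^ m))\<^sup>2)))"
    using ij T_pos by (intro sum_indep_normal indep_vars_subset[OF D_indep[of m]] D_normal) auto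
  moreover have "(\<Sum>k\<in>{i..<j}. (sqrt (T / 2 ^ m))\<^sup>2) = grid T m j - grid T m i"
    using ij T_pos by (simp add: grid_def field_simps of_nat_diff)
  ultimately have "distributed M lborel (\<lambda>\<omega>. \<Sum>k\<in>{i..<j}. D m k \<omega>) (normal_density 0 (sqrt (grid T m j - grid T m i)))"
    by simp
  moreover have "distr M lborel Y = distr M lborel (\<lambda>\<omega>. \<Sum>k\<in>{i..<j}. D m k \<omega>)"
    using Y_sum[of _ 0] by (intro distr_cong) simp_all
  moreover have "Y \<in> measurable M lborel \<longleftrightarrow> (\<lambda>\<omega>. \<Sum>k\<in>{i..<j}. D m k \<omega>) \<in> measurable M lborel"
    using Y_sum[of _ 0] by (intro measurable_cong) simp
  ultimately show ?thesis unfolding distributed_def by simp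
qed

text \<open>The past of the grid point \<open>grid T m i\<close> as seen at level
  \<open>m + p\<close>: the increments over cells to its left.\<close>

definition G :: "nat \<Rightarrow> 'a measure" where
  "G p = vimage_algebra (space M) (\<lambda>\<omega>. restrict (\<lambda>k. D (m + p) k \<omega>) {..<i * 2 ^ p}) (PiM {..<i * 2 ^ p} (\<lambda>_. borel))"

lemma space_G [simp]: "space (G p) = space M"
  by (simp add: G_def)

lemma D_G_measurable: "k < i * 2 ^ p \<Longrightarrow> D (m + p) k \<in> borel_measurable (G p)"
proof -
  assume k: "k < i * 2 ^ p"
  have "(\<lambda>\<omega>. restrict (\<lambda>k. D (m + p) k \<omega>) {..<i * 2 ^ p}) \<in> measurable (G p) (PiM {..<i * 2 ^ p} (\<lambda>_. borel))"
    unfolding G_def by (rule measurable_vimage_algebra1) (auto simp: space_PiM)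
  from measurable_compose[OF this measurable_component_singleton[of k]] k
  show ?thesis by simp
qed

lemma G_Suc: "sets (G p) \<subseteq> sets (G (Suc p))"
  unfolding G_def[of p]
proof (rule sets_image_in_sets)
  show "(\<lambda>\<omega>. restrict (\<lambda>k. D (m + p) k \<omega>) {..<i * 2 ^ p}) \<in> measurable (G (Suc p)) (PiM {..<i * 2 ^ p} (\<lambda>_. borel))"
  proof (rule measurable_restrict)
    fix k assume "k \<in> {..<i * 2 ^ p}"
    then have k: "k < i * 2 ^ p" by simp
    also have "i * 2 ^ p \<le> 2 ^ m * 2 ^ p" using ij by (intro mult_right_mono) auto
    finally have "k < 2 ^ (m + p)" by (simp add: power_add)
    then have "D (m + p) k = (\<lambda>\<omega>. D (m + Suc p) (2 * k) \<omega> + D (m + Suc p) (Suc (2 * k)) \<omega>)"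
      using D_halves[of k "m + p"] by (simp add: fun_eq_iff)
    moreover have "2 * k < i * 2 ^ Suc p" "Suc (2 * k) < i * 2 ^ Suc p" using k by auto
    ultimately show "D (m + p) k \<in> borel_measurable (G (Suc p))"
      by (simp only:) (intro borel_measurable_add D_G_measurable)
  qed
qed simp

lemma G_mono: "p \<le> q \<Longrightarrow> sets (G p) \<subseteq> sets (G q)"
  by (rule lift_Suc_mono_le[of "\<lambda>p. sets (G p)"]) (rule G_Suc)

text \<open>At level \<open>m + p\<close> the past uses the increments with index below
  \<open>i * 2 ^ p\<close> and \<open>Y\<close> those from there to \<open>j * 2 ^ p\<close>.
  Disjoint subfamilies of an independent family are independent.\<close>

lemma G_indep:
  assumes A: "A \<in> sets (G p)" and B: "B \<in> sets borel"
  shows "A \<in> events" "prob (A \<inter> (Y -` B \<inter> space M)) = prob A * prob (Y -` B \<inter> space M)"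
proof -
  let ?I = "{..<i * 2 ^ p}" and ?J = "{i * 2 ^ p..<j * 2 ^ p}"
  have sub: "?I \<subseteq> {..<2 ^ (m + p)}" "?J \<subseteq> {..<2 ^ (m + p)}"
  proof -
    have "i * 2 ^ p \<le> 2 ^ m * 2 ^ p" "j * 2 ^ p \<le> 2 ^ m * 2 ^ p" using ij by (auto intro!: mult_right_mono)
    then show "?I \<subseteq> {..<2 ^ (m + p)}" "?J \<subseteq> {..<2 ^ (m + p)}" by (auto simp: power_add intro: less_le_trans)
  qed
  have iv: "indep_var (PiM ?I (\<lambda>_. borel)) (\<lambda>\<omega>. restrict (\<lambda>k. D (m + p) k \<omega>) ?I) (PiM ?J (\<lambda>_. borel)) (\<lambda>\<omega>. restrict (\<lambda>k. D (m + p) k \<omega>) ?J)"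
    by (rule indep_var_restrict[OF D_indep[of "m + p"] _ sub]) auto
  define B' where "B' = (\<lambda>v. \<Sum>k\<in>?J. v k) -` B \<inter> space (PiM ?J (\<lambda>_. borel :: real measure))"
  have "(\<lambda>v. \<Sum>k\<in>?J. v k) \<in> borel_measurable (PiM ?J (\<lambda>_. borel :: real measure))"
    by (intro borel_measurable_sum measurable_component_singleton)
  then have B': "B' \<in> sets (PiM ?J (\<lambda>_. borel))" unfolding B'_def by (rule measurable_sets[OF _ B])
  have "sets (G p) = {(\<lambda>\<omega>. restrict (\<lambda>k. D (m + p) k \<omega>) ?I) -` C \<inter> space M |C. C \<in> sets (PiM ?I (\<lambda>_. borel))}"
    unfolding G_def by (rule sets_vimage_algebra2) (auto simp: space_PiM)
  then obtain C where C: "C \<in> sets (PiM ?I (\<lambda>_. borel))" "A = (\<lambda>\<omega>. restrict (\<lambda>k. D (m + p) k \<omega>) ?I) -` C \<inter> space M"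
    using A by blast
  show "A \<in> events" unfolding C(2) by (rule measurable_sets[OF indep_var_rv1[OF iv] C(1)])
  have YB: "Y -` B \<inter> space M = (\<lambda>\<omega>. restrict (\<lambda>k. D (m + p) k \<omega>) ?J) -` B' \<inter> space M"
    using Y_sum[of _ p] by (auto simp: B'_def space_PiM)
  show "prob (A \<inter> (Y -` B \<inter> space M)) = prob A * prob (Y -` B \<inter> space M)"
    unfolding YB unfolding C(2) indep_varD[OF iv C(1) B', symmetric]
    by (intro arg_cong[where f = prob]) auto
qed

text \<open>
  The \<open>\<sigma>\<close>-algebras \<open>G p\<close> increase with \<open>p\<close>; together they generate the past of \<open>W\<close> up to the grid point.
\<close>

lemma Y_indep:
  "indep_set (sets (natural_filtration M T W (grid T m i))) (sets (vimage_algebra (space M) Y borel))"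
proof -
  define \<A> where "\<A> = (\<Union>p. sets (G p))"
  define \<B> where "\<B> = {Y -` B \<inter> space M |B. B \<in> sets borel}"
  have Y_rv: "Y \<in> borel_measurable M" using Y_normal by (simp add: distributed_def)
  have vi: "sets (vimage_algebra (space M) Y borel) = \<B>"
    unfolding \<B>_def by (rule sets_vimage_algebra2) auto
  have "indep_set \<A> \<B>"
    unfolding indep_sets2_eq
  proof (intro conjI ballI)
    show "\<A> \<subseteq> events" unfolding \<A>_def using G_indep(1) sets.empty_sets by blast
    show "\<B> \<subseteq> events" unfolding \<B>_def using measurable_sets[OF Y_rv] by blast
    fix a b assume "a \<in> \<A>" "b \<in> \<B>"
    then show "prob (a \<inter> b) = prob a * prob b"
      unfolding \<A>_def \<B>_def using G_indep(2) by blast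
  qed
  \<comment> \<open>The union of an increasing chain of \<sigma>-algebras need not be a
    \<sigma>-algebra, but it is stable under intersection, which suffices to extend independence to
    what it generates.\<close>
  moreover have "Int_stable \<A>"
  proof (rule Int_stableI)
    fix a b assume "a \<in> \<A>" "b \<in> \<A>"
    then obtain p q where "a \<in> sets (G p)" "b \<in> sets (G q)" by (auto simp: \<A>_def)
    then have "a \<in> sets (G (max p q))" "b \<in> sets (G (max p q))"
      using G_mono[of p "max p q"] G_mono[of q "max p q"] by auto
    then show "a \<inter> b \<in> \<A>" unfolding \<A>_def by blast
  qed
  moreover have "Int_stable \<B>"
  proof -
    have "Int_stable (sets (vimage_algebra (space M) Y borel))" by (auto simp: Int_stable_def)
    then show ?thesis unfolding vi .
  qed
  ultimately have ind: "indep_set (sigma_sets (space M) \<A>) (sigma_sets (space M) \<B>)"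
    by (rule indep_set_sigma_sets)
  have \<A>_sub: "\<A> \<subseteq> Pow (space M)"
    unfolding \<A>_def using sets.space_closed[of "G _"] by force
  define H where "H = sigma (space M) \<A>"
  have H: "space H = space M" "sets H = sigma_sets (space M) \<A>"
    unfolding H_def using \<A>_sub by (auto simp: space_measure_of sets_measure_of)
  have G_H: "sets (G p) \<subseteq> sets H" for p
    unfolding H(2) \<A>_def by (auto intro: sigma_sets.Basic)
  \<comment> \<open>Up to the grid point, \<open>W\<close> is a limit of step functions each known
    to some \<open>G p\<close>, so the natural past lies in the \<sigma>-algebra they
    generate.\<close>
  have "W r \<in> borel_measurable H" if r: "r \<in> {0..T}" "r \<le> grid T m i" for r
  proof (rule borel_measurable_LIMSEQ_real)
    fix p
    have "step (m + p) r \<in> borel_measurable (G p)"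
      unfolding step_def using cell_le[OF T_pos r(2), of "m + p"]
      by (intro borel_measurable_sum D_G_measurable) auto
    then show "step (m + p) r \<in> borel_measurable H"
      using G_H[of p] H(1) by (auto simp: measurable_def)
  next
    fix \<omega> assume "\<omega> \<in> space H"
    then have "(\<lambda>p. step p r \<omega>) \<longlonglongrightarrow> W r \<omega>" using W_limit r(1) H(1) by simp
    then show "(\<lambda>p. step (m + p) r \<omega>) \<longlonglongrightarrow> W r \<omega>"
      using LIMSEQ_ignore_initial_segment[of _ _ m] by (simp add: add.commute)
  qed
  then have "sets (natural_filtration M T W (grid T m i)) \<subseteq> sets H"
    by (intro natural_filtration_least H(1)) auto
  then show ?thesis
    using ind unfolding vi indep_set_def H(2)
    by (elim indep_sets_mono_sets) (auto split: bool.split intro: sigma_sets.Basic)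
qed

text \<open>Independence and normality are put into one identity that is stable under limits of the
  increment with the event held fixed.\<close>

lemma Y_char:
  assumes A: "A \<in> sets (natural_filtration M T W (grid T m i))"
  shows "(CLINT \<omega>|M. indicat_real A \<omega> *\<^sub>R iexp (u * Y \<omega>)) =
    complex_of_real (prob A * exp (- ((grid T m j - grid T m i) * u\<^sup>2) / 2))"
proof -
  have Y_rv: "Y \<in> borel_measurable M" using Y_normal by (simp add: distributed_def)
  have pos: "0 < grid T m j - grid T m i"
    using ij T_pos by (simp add: grid_def divide_strict_right_mono)
  have A': "A \<in> events" using Y_indep A by (auto simp: indep_sets2_eq)
  have "indep_var borel (\<lambda>\<omega>. complex_of_real (indicat_real A \<omega>)) borel (\<lambda>\<omega>. iexp (u * Y \<omega>))"
    by (rule indep_var_of_indep_set[OF Y_indep _ _ Y_rv]) (use A in measurable)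
  moreover have "integrable M (\<lambda>\<omega>. complex_of_real (indicat_real A \<omega>))"
    using A' by (intro integrable_of_real integrable_real_indicator) (auto simp: emeasure_eq_measure)
  moreover have "(\<lambda>\<omega>. complex_of_real (u * Y \<omega>)) \<in> borel_measurable M"
    by (rule measurable_compose[OF borel_measurable_times[OF borel_measurable_const Y_rv]]) measurable
  then have "integrable M (\<lambda>\<omega>. iexp (u * Y \<omega>))"
    by (rule integrable_iexp) simp
  ultimately have "(CLINT \<omega>|M. complex_of_real (indicat_real A \<omega>) * iexp (u * Y \<omega>)) =
      (CLINT \<omega>|M. complex_of_real (indicat_real A \<omega>)) * (CLINT \<omega>|M. iexp (u * Y \<omega>))"
    by (rule indep_var_lebesgue_integral)
  also have "(CLINT \<omega>|M. complex_of_real (indicat_real A \<omega>)) = complex_of_real (prob A)"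
    using A' by (subst integral_complex_of_real) simp
  also have "(CLINT \<omega>|M. iexp (u * Y \<omega>)) = complex_of_real (exp (- ((grid T m j - grid T m i) * u\<^sup>2) / 2))"
    using char_of_normal[OF Y_normal] pos by (simp add: power_mult_distrib)
  finally show ?thesis by (simp add: scaleR_conv_of_real)
qed

end

text \<open>Arbitrary times are approximated by grid points from inside, \<open>s'\<close> from the
  right and \<open>t'\<close> from the left. With \<open>s'\<close> not before \<open>s\<close>, an
  event of the past of \<open>s\<close> belongs to the past of \<open>s'\<close>, so the identity at
  grid points applies to it; dominated convergence gives it at \<open>s\<close> and
  \<open>t\<close>.\<close>

lemma brownian_motion_W: "brownian_motion M T W"
  unfolding brownian_motion_def
proof (intro conjI allI impI ballI)
  show "prob_space M" by (rule prob_space_axioms)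
  show "W t \<in> borel_measurable M" if "t \<in> {0..T}" for t by (rule W_measurable[OF that])
  show "continuous_paths M T W" using W_continuous by (simp add: continuous_paths_def)
  show "AE \<omega> in M. W 0 \<omega> = 0" using W_grid[of _ 0 0] by (intro AE_I2) simp
  fix s t :: real assume st: "0 \<le> s" "s < t" "t \<le> T"
  define s' t' where "s' p = grid T p (Suc (cell T p s))" and "t' p = grid T p (cell T p t)" for p
  have s': "s \<le> s' p" "s' p \<le> s + T / 2 ^ p" and t': "t' p \<le> t" "t - T / 2 ^ p \<le> t' p" for p
    using cell_bounds[OF T_pos, of s p] cell_bounds[OF T_pos, of t p] st
    by (auto simp: s'_def t'_def grid_Suc)
  have null: "(\<lambda>p. T / 2 ^ p) \<longlonglongrightarrow> 0"
    using tendsto_mult_right_zero[OF LIMSEQ_power_zero[of "1 / 2 :: real"], of T] by (simp add: power_divide)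
  have s'_lim: "s' \<longlonglongrightarrow> s"
    by (rule tendsto_sandwich[OF _ _ tendsto_const]) (use s' tendsto_add[OF tendsto_const null, of s] in auto)
  have t'_lim: "t' \<longlonglongrightarrow> t"
    by (rule tendsto_sandwich[OF _ _ _ tendsto_const]) (use t' tendsto_diff[OF tendsto_const null, of t] in auto)
  have ev: "\<forall>\<^sub>F p in sequentially. s' p < t' p"
    using order_tendstoD(1)[OF tendsto_diff[OF t'_lim s'_lim], of 0] st by simp
  have char: "(CLINT \<omega>|M. indicat_real A \<omega> *\<^sub>R iexp (u * (W t \<omega> - W s \<omega>))) =
      complex_of_real (prob A * exp (- (sqrt (t - s) * u)\<^sup>2 / 2))"
    if A: "A \<in> sets (natural_filtration M T W s)" for A u
  proof (rule LIMSEQ_unique)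
    have A': "A \<in> events"
      using A natural_filtration_least[of M M T s W] W_measurable by auto
    \<comment> \<open>On a coarse grid \<open>s' p\<close> need not lie before \<open>t' p\<close>;
      the default 0 then concerns finitely many \<open>p\<close> only.\<close>
    define Q where "Q p = (if s' p < t' p then (CLINT \<omega>|M. indicat_real A \<omega> *\<^sub>R iexp (u * (W (t' p) \<omega> - W (s' p) \<omega>))) else 0)" for p
    have in_T: "s' p \<in> {0..T}" "t' p \<in> {0..T}" if "s' p < t' p" for p
      using s'[of p] t'[of p] st that by auto
    define Y' where "Y' p \<omega> = (if s' p < t' p then indicat_real A \<omega> *\<^sub>R iexp (u * (W (t' p) \<omega> - W (s' p) \<omega>)) else 0)" for p \<omega>
    have Q: "Q p = (CLINT \<omega>|M. Y' p \<omega>)" for p by (simp add: Q_def Y'_def)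
    show "Q \<longlonglongrightarrow> (CLINT \<omega>|M. indicat_real A \<omega> *\<^sub>R iexp (u * (W t \<omega> - W s \<omega>)))"
      unfolding Q[abs_def]
    proof (rule integral_dominated_convergence[where w = "\<lambda>_. 1"])
      have [measurable]: "W t \<in> borel_measurable M" "W s \<in> borel_measurable M" using st by (auto intro: W_measurable)
      show "(\<lambda>\<omega>. indicat_real A \<omega> *\<^sub>R iexp (u * (W t \<omega> - W s \<omega>))) \<in> borel_measurable M"
        using A' by measurable
      show "Y' p \<in> borel_measurable M" for p
      proof (cases "s' p < t' p")
        case True
        have [measurable]: "W (t' p) \<in> borel_measurable M" "W (s' p) \<in> borel_measurable M"
          using in_T[OF True] by (auto intro: W_measurable)
        show ?thesis unfolding Y'_def using A' by measurable
      qed (simp add: Y'_def[abs_def])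
      show "AE \<omega> in M. (\<lambda>p. Y' p \<omega>) \<longlonglongrightarrow> indicat_real A \<omega> *\<^sub>R iexp (u * (W t \<omega> - W s \<omega>))"
      proof (rule AE_I2)
        fix \<omega> assume \<omega>: "\<omega> \<in> space M"
        have "(\<lambda>p. W (t' p) \<omega>) \<longlonglongrightarrow> W t \<omega>"
          using st t'_lim ev in_T(2)
          by (intro continuous_on_tendsto_compose[OF W_continuous[OF \<omega>]]) (auto elim: eventually_mono)
        moreover have "(\<lambda>p. W (s' p) \<omega>) \<longlonglongrightarrow> W s \<omega>"
          using st s'_lim ev in_T(1)
          by (intro continuous_on_tendsto_compose[OF W_continuous[OF \<omega>]]) (auto elim: eventually_mono)
        ultimately have "(\<lambda>p. indicat_real A \<omega> *\<^sub>R iexp (u * (W (t' p) \<omega> - W (s' p) \<omega>))) \<longlonglongrightarrow>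
            indicat_real A \<omega> *\<^sub>R iexp (u * (W t \<omega> - W s \<omega>))"
          by (intro tendsto_intros)
        moreover have "\<forall>\<^sub>F p in sequentially. indicat_real A \<omega> *\<^sub>R iexp (u * (W (t' p) \<omega> - W (s' p) \<omega>)) = Y' p \<omega>"
          using ev by eventually_elim (simp add: Y'_def)
        ultimately show "(\<lambda>p. Y' p \<omega>) \<longlonglongrightarrow> indicat_real A \<omega> *\<^sub>R iexp (u * (W t \<omega> - W s \<omega>))"
          by (rule Lim_transform_eventually)
      qed
    qed (auto simp: Y'_def indicator_def)
    have "Q p = complex_of_real (prob A * exp (- ((t' p - s' p) * u\<^sup>2) / 2))" if p: "s' p < t' p" for p
    proof -
      have lt: "Suc (cell T p s) < cell T p t"
        using p grid_mono[of T "cell T p t" "Suc (cell T p s)" p] T_pos by (force simp: s'_def t'_def not_less[symmetric])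
      have "A \<in> sets (natural_filtration M T W (s' p))"
        using A natural_filtration_mono[of s "s' p" M T W] s' by auto
      from Y_char[OF lt cell_le_end[OF T_pos st(3)] this[unfolded s'_def]] p
      show ?thesis by (simp add: Q_def s'_def t'_def)
    qed
    then have "\<forall>\<^sub>F p in sequentially. complex_of_real (prob A * exp (- ((t' p - s' p) * u\<^sup>2) / 2)) = Q p"
      using ev by (auto elim: eventually_mono)
    moreover have "(\<lambda>p. complex_of_real (prob A * exp (- ((t' p - s' p) * u\<^sup>2) / 2))) \<longlonglongrightarrow>
        complex_of_real (prob A * exp (- ((t - s) * u\<^sup>2) / 2))"
      by (intro tendsto_intros t'_lim s'_lim) simp
    ultimately have "Q \<longlonglongrightarrow> complex_of_real (prob A * exp (- ((t - s) * u\<^sup>2) / 2))"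
      by (rule Lim_transform_eventually[rotated])
    then show "Q \<longlonglongrightarrow> complex_of_real (prob A * exp (- (sqrt (t - s) * u)\<^sup>2 / 2))"
      using st by (simp add: power_mult_distrib)
  qed
  have Y_rv: "(\<lambda>\<omega>. W t \<omega> - W s \<omega>) \<in> borel_measurable M"
    using W_measurable[of s] W_measurable[of t] st by auto
  have pos: "0 < sqrt (t - s)" using st by simp
  have sub: "sets (natural_filtration M T W s) \<subseteq> events"
    using W_measurable by (intro natural_filtration_least) auto
  show "distributed M lborel (\<lambda>\<omega>. W t \<omega> - W s \<omega>) (normal_density 0 (sqrt (t - s)))"
    "indep_set (sets (natural_filtration M T W s)) (sets (vimage_algebra (space M) (\<lambda>\<omega>. W t \<omega> - W s \<omega>) borel))"
    using normal_indep_of_char[OF Y_rv pos _ sub char] by simp_all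
qed

end

section \<open>Almost sure size of the increments and removal of a null set\<close>

context dyadic_increments
begin

text \<open>A level has \<open>2 ^ n\<close> increments with fourth moment
  \<open>3 * (T / 2 ^ n)^2\<close>. Relative to the fourth power of the bound \<open>r ^ n\<close>,
  their sum has a mean of order \<open>(1 / (2 r^4)) ^ n\<close>, summable once
  \<open>r^4 > 1 / 2\<close>; the choice \<open>9 / 10\<close> satisfies this and stays below 1.
  Second moments would not do, as over each level they sum to \<open>T\<close>.\<close>

lemma AE_increments_small: "AE \<omega> in M. \<exists>m. \<forall>n\<ge>m. \<forall>k<2 ^ n. \<bar>D n k \<omega>\<bar> \<le> (9 / 10) ^ n"
proof -
  define Q where "Q n \<omega> = (\<Sum>k<2 ^ n. (D n k \<omega>) ^ 4) / ((9 / 10) ^ n) ^ 4" for n \<omega>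
  have mom: "integrable M (\<lambda>\<omega>. (D n k \<omega>) ^ 4)" "expectation (\<lambda>\<omega>. (D n k \<omega>) ^ 4) = 3 * (T / 2 ^ n)\<^sup>2"
    if "k < 2 ^ n" for n k
    using centered_normal_moments(1,4)[OF D_normal[OF that]] T_pos by auto
  have EQ: "expectation (Q n) = 3 * T\<^sup>2 * (10 ^ 4 / (2 * 9 ^ 4)) ^ n" for n
  proof -
    have "expectation (Q n) = 2 ^ n * (3 * (T / 2 ^ n)\<^sup>2) / ((9 / 10) ^ n) ^ 4"
      unfolding Q_def using mom by (simp add: Bochner_Integration.integral_sum)
    also have "\<dots> = 3 * T\<^sup>2 * (2 ^ n / (2 ^ n)\<^sup>2) * (1 / ((9 / 10) ^ n) ^ 4)"
      by (simp add: power_divide)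
    also have "2 ^ n / (2 ^ n)\<^sup>2 = (1 / 2 :: real) ^ n"
      by (simp add: power2_eq_square power_divide)
    also have "1 / ((9 / 10) ^ n) ^ 4 = (10 ^ 4 / 9 ^ 4 :: real) ^ n"
    proof -
      have "((9 / 10 :: real) ^ n) ^ 4 = ((9 / 10) ^ 4) ^ n"
        by (simp only: power_mult[symmetric] mult.commute)
      then show ?thesis by (simp add: power_divide)
    qed
    also have "3 * T\<^sup>2 * (1 / 2) ^ n * (10 ^ 4 / 9 ^ 4) ^ n = 3 * T\<^sup>2 * (10 ^ 4 / (2 * 9 ^ 4)) ^ n"
      by (simp flip: power_mult_distrib)
    finally show ?thesis .
  qed
  have "AE \<omega> in M. (\<lambda>n. Q n \<omega>) \<longlonglongrightarrow> 0"
  proof (rule AE_tendsto_0_of_summable)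
    show "integrable M (Q n)" for n
      unfolding Q_def[abs_def] using mom by (intro integrable_divide Bochner_Integration.integrable_sum) auto
    show "summable (\<lambda>n. expectation (Q n))"
      unfolding EQ by (intro summable_mult summable_geometric) simp
  qed (auto simp: Q_def intro!: sum_nonneg divide_nonneg_nonneg)
  then show ?thesis
  proof eventually_elim
    case (elim \<omega>)
    then obtain m where m: "\<And>n. m \<le> n \<Longrightarrow> Q n \<omega> < 1"
      using order_tendstoD(2)[OF elim, of 1] by (auto simp: eventually_sequentially)
    have "\<bar>D n k \<omega>\<bar> \<le> (9 / 10) ^ n" if "m \<le> n" "k < 2 ^ n" for n k
    proof -
      have "(D n k \<omega>) ^ 4 \<le> (\<Sum>k<2 ^ n. (D n k \<omega>) ^ 4)"
        using that by (intro member_le_sum) auto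
      also have "\<dots> \<le> ((9 / 10) ^ n) ^ 4"
        using m[OF that(1)] by (simp add: Q_def)
      finally have "\<bar>D n k \<omega>\<bar> ^ 4 \<le> ((9 / 10) ^ n) ^ 4" by simp
      then show ?thesis by (rule power_mono_iff[THEN iffD1, rotated -1]) auto
    qed
    then show ?case by blast
  qed
qed

text \<open>Setting all increments to 0 on a measurable null set keeps the halving identity at every
  sample point and makes the bound trivial there. Independence is restated as an identity between
  laws, which does not see null sets.\<close>

lemma ex_regular: "\<exists>D'. regular_dyadic_increments M T D'"
proof -
  obtain N where sub: "{\<omega>\<in>space M. \<not> (\<exists>m. \<forall>n\<ge>m. \<forall>k<2 ^ n. \<bar>D n k \<omega>\<bar> \<le> (9 / 10) ^ n)} \<subseteq> N"
    and null: "emeasure M N = 0" "N \<in> sets M"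
    by (rule AE_E[OF AE_increments_small])
  then have N: "N \<in> null_sets M" by (intro null_setsI)
  note [measurable] = null(2)
  define D' where "D' n k \<omega> = (if \<omega> \<in> N then 0 else D n k \<omega>)" for n k \<omega>
  have rv: "D n k \<in> borel_measurable M" if "k < 2 ^ n" for n k
    using D_indep[of n] that by (simp add: indep_vars_def2)
  have rv': "D' n k \<in> borel_measurable M" if "k < 2 ^ n" for n k
  proof -
    note [measurable] = rv[OF that]
    show ?thesis unfolding D'_def by measurable
  qed
  have ae: "AE \<omega> in M. \<forall>n k. D' n k \<omega> = D n k \<omega>"
    using AE_not_in[OF N] by eventually_elim (simp add: D'_def)
  have distr: "distr M borel (D' n k) = distr M borel (D n k)" if "k < 2 ^ n" for n k
    using ae by (intro distr_cong_AE rv rv' that) auto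
  have "regular_dyadic_increments M T D'"
  proof
    show "0 < T" by (rule T_pos)
    fix n :: nat
    have ne: "{..<(2 :: nat) ^ n} \<noteq> {}" by (simp add: lessThan_empty_iff)
    have "distr M (PiM {..<2 ^ n} (\<lambda>_. borel)) (\<lambda>\<omega>. \<lambda>k\<in>{..<2 ^ n}. D' n k \<omega>) =
        distr M (PiM {..<2 ^ n} (\<lambda>_. borel)) (\<lambda>\<omega>. \<lambda>k\<in>{..<2 ^ n}. D n k \<omega>)"
      using ae by (intro distr_cong_AE measurable_restrict rv rv') auto
    also have "\<dots> = PiM {..<2 ^ n} (\<lambda>k. distr M borel (D n k))"
      using D_indep[of n] indep_vars_iff_distr_eq_PiM'[of "{..<2 ^ n}" "D n" "\<lambda>_. borel"] rv ne by simp
    also have "\<dots> = PiM {..<2 ^ n} (\<lambda>k. distr M borel (D' n k))"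
      by (intro PiM_cong) (auto simp: distr)
    finally show "indep_vars (\<lambda>_. borel) (D' n) {..<2 ^ n}"
      using rv' indep_vars_iff_distr_eq_PiM'[of "{..<2 ^ n}" "D' n" "\<lambda>_. borel"] ne by simp
    fix k :: nat and \<omega> assume k: "k < 2 ^ n"
    have "distr M lborel (D' n k) = distr M lborel (D n k)"
      using ae rv[OF k] rv'[OF k] by (intro distr_cong_AE) auto
    then show "distributed M lborel (D' n k) (normal_density 0 (sqrt (T / 2 ^ n)))"
      using D_normal[OF k] rv'[OF k] by (simp add: distributed_def)
    show "D' n k \<omega> = D' (Suc n) (2 * k) \<omega> + D' (Suc n) (Suc (2 * k)) \<omega>"
      using D_halves[OF k, of \<omega>] by (simp add: D'_def)
  next
    fix \<omega> assume "\<omega> \<in> space M"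
    then show "\<exists>m. \<forall>n\<ge>m. \<forall>k<2 ^ n. \<bar>D' n k \<omega>\<bar> \<le> (9 / 10) ^ n"
      using sub by (cases "\<omega> \<in> N") (auto simp: D'_def)
  qed
  then show ?thesis by blast
qed

end

lemma ex_brownian_motion:
  assumes "0 < T"
  shows "\<exists>(M :: (real \<Rightarrow> real) measure) W. brownian_motion M T W"
proof -
  obtain M :: "(real \<Rightarrow> real) measure" and D where "dyadic_increments M T D"
    using ex_dyadic_increments[OF assms] by blast
  then obtain D' where "regular_dyadic_increments M T D'"
    using dyadic_increments.ex_regular by blast
  then show ?thesis using regular_dyadic_increments.brownian_motion_W by blast
qed

theorem proposition3p23:
  fixes T :: real
  assumes "T > 0"
  shows "(\<forall>(M :: 'a measure) W x\<^sub>0. 0 \<le> x\<^sub>0 \<longrightarrow> brownian_motion M T W \<longrightarrow>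
            (\<exists>X. bes1 M T W x\<^sub>0 X \<and> solves_strong_martingale_problem M T D_L1 L1 W x\<^sub>0 X)) \<and>
         \<not> martingale_problem_unique T D_L1 L1"
proof (intro conjI allI impI)
  fix M :: "'a measure" and W and x\<^sub>0 :: real
  assume "0 \<le> x\<^sub>0" "brownian_motion M T W"
  then interpret reflected_brownian M T W x\<^sub>0
    using assms by unfold_locales
  show "\<exists>X. bes1 M T W x\<^sub>0 X \<and> solves_strong_martingale_problem M T D_L1 L1 W x\<^sub>0 X"
    using bes1_X strong_martingale_problem_X by blast
next
  show "\<not> martingale_problem_unique T D_L1 L1"
    using ex_brownian_motion[OF assms] martingale_problem_not_unique[OF assms] by blast
qed

end
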